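(* Let $I,J\subset\mathbb{R}$ be bounded closed intervals, $\Omega=I\times J$, let $a,b>0$ satisfy $\left(\frac{1-a^2-b^2}{2ab}\right)^2=1$ (equivalently, $a=|1-b|$ or $a=b+1$), and let $H\in C^3(\Omega)$ be real-valued with $H>\delta$, $|H_x|>\delta$, $|H_y|>\delta$ on $\Omega$ for some $\delta>0$, and $$a^{2}\frac{H_{xx}}{H_x^2}+(1-a^2-b^2)\frac{H_{xy}}{H_xH_y}+b^2\frac{H_{yy}}{H_y^2}\ge 0\quad\text{on }\Omega.$$ Then for any $1>\alpha>\beta>0$ with $\alpha+\beta>1$ there exists $R_0=R_0(\alpha,\beta,H)$ such that for all $R>R_0$, all $n\geq 1$ and all Borel measurable $f:\mathbb{R}^n\to I$, $g:\mathbb{R}^n\to J$, $$\int_{\mathbb{R}^{n}}\left(\int_{\mathbb{R}^{n}}H^{R}\left(f\left(\tfrac{x-y}{a}\right),g\left(\tfrac{y}{b}\right)\right)d\gamma_{p,q,x}(y)\right)^{\frac{1}{R-R^{\alpha}}}d\gamma_{n}(x)\ \ge\ H^{\frac{R}{R-R^{\alpha}}}\left(\int_{\mathbb{R}^{n}}f\left(x\sqrt{1+\tfrac{1}{a^{2}R^{\beta}}}\right)d\gamma_n(x),\int_{\mathbb{R}^{n}}g\left(x\sqrt{1+\tfrac{1}{b^{2}R^{\beta}}}\right)d\gamma_n(x)\right),$$ where $p=R^{\beta}$, and $q=-bR^{\beta}$ if $a=|1-b|$, $q=bR^{\beta}$ if $a=b+1$.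
   Context: $\gamma_n$ is the standard Gaussian measure on $\mathbb{R}^n$. For $p>0$, $q\in\mathbb{R}$, $x\in\mathbb{R}^n$, $\gamma_{p,q,x}$ is the probability measure on $\mathbb{R}^n$ given by $d\gamma_{p,q,x}(y)=\left(\frac{p}{2\pi}\right)^{n/2}e^{-\frac{|py+qx|^2}{2p}}\,dy$. $H^R(\cdot)$ means the $R$-th power of the value of $H$. The numbers $a,b$ are fixed throughout. *)

theory Defs
  imports "HOL-Probability.Probability"
begin

text \<open>
  Points of \<open>\<real>\<^sup>n\<close> are the extensional functions on \<open>{..<n}\<close>, because the dimension has to be
  quantified inside the statement, below \<open>R\<^sub>0\<close>. The sigma-algebra is the Borel one and the measure
  is \<open>n\<close>-dimensional Lebesgue measure.
\<close>

definition Rn :: "nat \<Rightarrow> (nat \<Rightarrow> real) measure" where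
  "Rn n = (\<Pi>\<^sub>M i\<in>{..<n}. lborel)"

definition std_gauss :: "nat \<Rightarrow> (nat \<Rightarrow> real) measure" where
  "std_gauss n = density (Rn n)
     (\<lambda>y. ennreal ((1 / (2 * pi)) powr (real n / 2) * exp (- (\<Sum>i<n. (y i)\<^sup>2) / 2)))"

definition gauss :: "nat \<Rightarrow> real \<Rightarrow> real \<Rightarrow> (nat \<Rightarrow> real) \<Rightarrow> (nat \<Rightarrow> real) measure" where
  "gauss n p q x = density (Rn n)
     (\<lambda>y. ennreal ((p / (2 * pi)) powr (real n / 2)
                   * exp (- (\<Sum>i<n. (p * y i + q * x i)\<^sup>2) / (2 * p))))"

text \<open>
  Partial derivatives on a closed rectangle \<open>I \<times> J\<close> are taken within the rectangle, so they are
  one-sided on the boundary and involve only the values of \<open>H\<close> on \<open>I \<times> J\<close>. They are uniquely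
  determined when \<open>I\<close> and \<open>J\<close> are nondegenerate intervals.
\<close>

definition partial1 :: "real set \<Rightarrow> (real \<Rightarrow> real \<Rightarrow> real) \<Rightarrow> real \<Rightarrow> real \<Rightarrow> real" where
  "partial1 I H x y = vector_derivative (\<lambda>s. H s y) (at x within I)"

definition partial2 :: "real set \<Rightarrow> (real \<Rightarrow> real \<Rightarrow> real) \<Rightarrow> real \<Rightarrow> real \<Rightarrow> real" where
  "partial2 J H x y = vector_derivative (\<lambda>t. H x t) (at y within J)"

primrec Ck_on :: "nat \<Rightarrow> real set \<Rightarrow> real set \<Rightarrow> (real \<Rightarrow> real \<Rightarrow> real) \<Rightarrow> bool" where
  "Ck_on 0 I J H \<longleftrightarrow> continuous_on (I \<times> J) (\<lambda>(x, y). H x y)"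
| "Ck_on (Suc k) I J H \<longleftrightarrow>
     continuous_on (I \<times> J) (\<lambda>(x, y). H x y) \<and>
     (\<forall>x\<in>I. \<forall>y\<in>J. (\<lambda>s. H s y) differentiable (at x within I) \<and>
                   (\<lambda>t. H x t) differentiable (at y within J)) \<and>
     Ck_on k I J (partial1 I H) \<and> Ck_on k I J (partial2 J H)"

end

theory Submission
  imports Defs
begin

text \<open>
  Write \<open>1 / \<theta> = R - R\<^sup>\<alpha>\<close> and \<open>s = 1 / \<theta> - 1\<close>. Under \<open>\<gamma>\<^sub>n(dx) \<gamma>\<^bsub>p,q,x\<^esub>(dy)\<close> the arguments of \<open>f\<close> and \<open>g\<close> are
  \<open>\<epsilon> x - z / (a \<surd>p)\<close> and \<open>\<epsilon>' x + z / (b \<surd>p)\<close> with \<open>x\<close>, \<open>z\<close> independent standard Gaussian vectors and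
  signs \<open>\<epsilon>\<close>, \<open>\<epsilon>'\<close> such that \<open>1 - a\<^sup>2 - b\<^sup>2 = 2 \<epsilon> \<epsilon>' a b\<close>. Let \<open>W x\<close> be the inner integral. The inequality is the
  Jensen inequality \<open>E \<Psi>(f, g, k) \<ge> \<Psi>(E f, E g, E k)\<close> for \<open>\<Psi>(u, v, w) = H(u, v)\<^sup>R w\<^bsup>-s\<^esup>\<close> and the third function
  \<open>k = W\<^sup>\<theta>\<close>: its left side is \<open>E (W k\<^bsup>-s\<^esup>) = E W\<^sup>\<theta>\<close>.

  Such a Jensen inequality for functions of correlated Gaussian vectors holds as soon as the Hessian of \<open>\<Psi>\<close>,
  multiplied entrywise by the covariance matrix, is positive semidefinite: for one short Gaussian step
  this is a second order Taylor expansion, steps compose because Gaussians convolve, and the dimension is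
  raised by applying the one-dimensional inequality coordinatewise under the integral.

  Eliminating \<open>w\<close> from the Hessian condition leaves a quadratic form in \<open>S = H\<^sub>x r\<close> and \<open>T = H\<^sub>y t\<close> whose leading terms are
  \<open>R\<^bsup>\<alpha>-1\<^esup> (S + T)\<^sup>2 + R\<^bsup>1-\<beta>\<^esup> (S / a - \<epsilon> \<epsilon>' T / b)\<^sup>2\<close>. The hypothesis on \<open>H\<close> says that the remaining form of size \<open>O(1)\<close> is
  nonnegative where the second square vanishes, so it is absorbed because \<open>\<alpha> > \<beta>\<close>; the perturbation of size
  \<open>1 / p = R\<^bsup>-\<beta>\<^esup>\<close> is absorbed because \<open>\<alpha> + \<beta> > 1\<close>.
\<close>

section \<open>Gaussian measures\<close>

text \<open>The function \<open>k\<close> is the equality case of Hoelder's inequality E W^\<theta>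
  \<le> (E (W k^(-s)))^\<theta> (E k)^(s \<theta>). Through it the power of the inner integral
  becomes the mean of a function of three Gaussian arguments, and only a convexity property is left.
  The mean of \<open>k\<close> then stands on both sides: Jensen gives H(E f, E g)^R (E k)^(-s)
  \<le> E k, which solves to the claim because s + 1 = 1 / \<theta>.

  The obstacle is regularity. The three functions are merely measurable and \<open>H\<close> has
  one-sided derivatives at the boundary of a closed rectangle. So a short step asks only for a
  first-order bound on the functions, of a kind that averaging keeps with the same constant, and
  \<open>Psi\<close> is expanded only between points of the box, which contains all values and all
  means. The error of a step of length h is at most e * h once h is small in terms of that constant
  and e, so steps of total length 1 cost e; smoothness is removed afterwards by limits.

  The coefficient of order R^(\<alpha>-1) is what remains of R - 1 after the square in
  \<open>w\<close> is completed.\<close>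

definition gamma1 :: "real measure" where
  "gamma1 = std_normal_distribution"

lemma sets_gamma1 [simp, measurable_cong]: "sets gamma1 = sets borel"
  by (simp add: gamma1_def)

lemma space_gamma1 [simp]: "space gamma1 = UNIV"
  by (simp add: gamma1_def)

lemma prob_space_gamma1: "prob_space gamma1"
  unfolding gamma1_def by (rule prob_space_normal_density) simp

interpretation gamma1: prob_space gamma1
  by (rule prob_space_gamma1)

interpretation gamma1_pair: pair_prob_space gamma1 gamma1
  by unfold_locales

section \<open>Sums of independent one-dimensional Gaussians\<close>

lemma char_gamma1: "char gamma1 t = complex_of_real (exp (- t\<^sup>2 / 2))"
  using char_std_normal_distribution by (simp add: gamma1_def)

lemma char_distr_scale_gamma1:
  "char (distr gamma1 borel (\<lambda>x. c * x)) t = complex_of_real (exp (- (c\<^sup>2 * t\<^sup>2) / 2))"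
proof -
  have "char (distr gamma1 borel (\<lambda>x. c * x)) t = char gamma1 (c * t)"
    unfolding char_def by (subst integral_distr) (auto simp: ac_simps)
  then show ?thesis
    by (simp add: char_gamma1 power_mult_distrib)
qed

text \<open>Both laws have the characteristic function exp (-(c^2 + d^2) t^2 / 2), since it factors
  over independent summands. With the right side written as an image of \<open>gamma1\<close>
  instead of a density, the degenerate case c = d = 0 is covered too.\<close>

lemma distr_pair_gamma1:
  "distr (gamma1 \<Otimes>\<^sub>M gamma1) borel (\<lambda>(x, z). c * x + d * z)
     = distr gamma1 borel (\<lambda>t. sqrt (c\<^sup>2 + d\<^sup>2) * t)"
proof (rule Levy_uniqueness)
  let ?P = "gamma1 \<Otimes>\<^sub>M gamma1"
  show "real_distribution (distr ?P borel (\<lambda>(x, z). c * x + d * z))"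
    by (rule gamma1_pair.real_distribution_distr) measurable
  show "real_distribution (distr gamma1 borel (\<lambda>t. sqrt (c\<^sup>2 + d\<^sup>2) * t))"
    by (rule gamma1.real_distribution_distr) measurable
  show "char (distr ?P borel (\<lambda>(x, z). c * x + d * z))
      = char (distr gamma1 borel (\<lambda>t. sqrt (c\<^sup>2 + d\<^sup>2) * t))"
  proof
    fix t
    have "char (distr ?P borel (\<lambda>(x, z). c * x + d * z)) t
        = (\<integral>w. iexp (t * (c * fst w)) * iexp (t * (d * snd w)) \<partial>?P)"
      unfolding char_def
      by (subst integral_distr) (auto simp: split_beta ring_distribs exp_add intro!: Bochner_Integration.integral_cong)
    also have "\<dots> = (\<integral>x. (\<integral>z. iexp (t * (c * x)) * iexp (t * (d * z)) \<partial>gamma1) \<partial>gamma1)"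
    proof (subst gamma1_pair.integral_fst'[symmetric])
      show "integrable ?P (\<lambda>w. iexp (t * (c * fst w)) * iexp (t * (d * snd w)))"
        by (rule gamma1_pair.integrable_const_bound[where B=1]) (auto simp: norm_mult)
    qed simp
    also have "\<dots> = char (distr gamma1 borel (\<lambda>x. c * x)) t * char (distr gamma1 borel (\<lambda>x. d * x)) t"
      unfolding char_def by (simp add: integral_distr)
    also have "\<dots> = complex_of_real (exp (- (c\<^sup>2 * t\<^sup>2) / 2) * exp (- (d\<^sup>2 * t\<^sup>2) / 2))"
      by (simp only: char_distr_scale_gamma1 of_real_mult)
    also have "exp (- (c\<^sup>2 * t\<^sup>2) / 2) * exp (- (d\<^sup>2 * t\<^sup>2) / 2) = exp (- ((sqrt (c\<^sup>2 + d\<^sup>2))\<^sup>2 * t\<^sup>2) / 2)"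
      by (simp add: exp_add[symmetric] field_simps)
    finally show "char (distr ?P borel (\<lambda>(x, z). c * x + d * z)) t
        = char (distr gamma1 borel (\<lambda>t. sqrt (c\<^sup>2 + d\<^sup>2) * t)) t"
      by (simp only: char_distr_scale_gamma1)
  qed
qed

lemma gamma1_convolution:
  fixes F :: "real \<Rightarrow> real"
  assumes [measurable]: "F \<in> borel_measurable borel" and "\<And>x. \<bar>F x\<bar> \<le> B"
  shows "(\<integral>x. (\<integral>z. F (c * x + d * z) \<partial>gamma1) \<partial>gamma1) = (\<integral>t. F (sqrt (c\<^sup>2 + d\<^sup>2) * t) \<partial>gamma1)"
proof -
  have "(\<integral>x. (\<integral>z. F (c * x + d * z) \<partial>gamma1) \<partial>gamma1)
      = (\<integral>w. F ((\<lambda>(x, z). c * x + d * z) w) \<partial>(gamma1 \<Otimes>\<^sub>M gamma1))"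
    by (subst gamma1_pair.integral_fst'[symmetric])
       (use assms in \<open>auto simp: split_beta intro!: gamma1_pair.integrable_const_bound[where B=B]\<close>)
  also have "\<dots> = integral\<^sup>L (distr (gamma1 \<Otimes>\<^sub>M gamma1) borel (\<lambda>(x, z). c * x + d * z)) F"
    by (rule integral_distr[symmetric]) measurable
  also have "\<dots> = (\<integral>t. F (sqrt (c\<^sup>2 + d\<^sup>2) * t) \<partial>gamma1)"
    unfolding distr_pair_gamma1 by (rule integral_distr) measurable
  finally show ?thesis .
qed

lemma distr_gamma1_affine:
  assumes "\<sigma> > 0"
  shows "distr gamma1 borel (\<lambda>z. \<mu> + \<sigma> * z) = density lborel (normal_density \<mu> \<sigma>)"
proof -
  have "distributed gamma1 lborel (\<lambda>x. x) std_normal_density"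
    unfolding distributed_def gamma1_def by (auto simp: distr_id2)
  from gamma1.normal_density_affine[OF this, of \<sigma> \<mu>] assms
  have "distributed gamma1 lborel (\<lambda>z. \<mu> + \<sigma> * z) (normal_density \<mu> \<sigma>)"
    by simp
  then have "distr gamma1 lborel (\<lambda>z. \<mu> + \<sigma> * z) = density lborel (normal_density \<mu> \<sigma>)"
    by (simp add: distributed_def)
  moreover have "distr gamma1 borel (\<lambda>z. \<mu> + \<sigma> * z) = distr gamma1 lborel (\<lambda>z. \<mu> + \<sigma> * z)"
    by (rule distr_cong) auto
  ultimately show ?thesis by simp
qed

lemma integrable_gamma1_power [simp]: "integrable gamma1 (\<lambda>x. x ^ k)"
  unfolding gamma1_def by (rule integrable_std_normal_distribution_moment)

lemma gamma1_moments:
  "(\<integral>x. x \<partial>gamma1) = 0" "(\<integral>x. x\<^sup>2 \<partial>gamma1) = 1"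
  using integral_std_normal_distribution_moment_odd[of 1] std_normal_distribution_even_moments(1)[of 1]
  by (simp_all add: gamma1_def fact_numeral)


text \<open>The coordinates range over an arbitrary index set so that the passage to higher
  dimension can be an induction that inserts one coordinate at a time.\<close>

definition gamma_PiM :: "nat set \<Rightarrow> (nat \<Rightarrow> real) measure" where
  "gamma_PiM I = (\<Pi>\<^sub>M i\<in>I. gamma1)"

text \<open>A product measure is determined by its values on boxes; there both the density and the
  indicator are products over the coordinates, so the integral factors. The factor
  \<open>g i\<close> may vary with \<open>i\<close> because the means of \<open>gauss\<close>
  do.\<close>

lemma density_Rn_eq_PiM_density:
  fixes g :: "nat \<Rightarrow> real \<Rightarrow> real"
  assumes [measurable]: "\<And>i. g i \<in> borel_measurable borel" and nn: "\<And>i x. g i x \<ge> 0"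
    and prob: "\<And>i. prob_space (density lborel (g i))"
  shows "density (Rn n) (\<lambda>y. ennreal (\<Prod>i<n. g i (y i))) = (\<Pi>\<^sub>M i\<in>{..<n}. density lborel (g i))"
proof -
  interpret D: product_prob_space "\<lambda>i. density lborel (g i)" UNIV
    using prob by (auto simp: product_prob_space_def product_prob_space_axioms_def product_sigma_finite_def
        intro: prob_space_imp_sigma_finite)
  interpret L: product_sigma_finite "\<lambda>i::nat. lborel :: real measure"
    by (auto simp: product_sigma_finite_def intro: sigma_finite_lborel)
  show ?thesis
  proof (rule D.PiM_eqI)
    show "finite {..<n}" by simp
    show "sets (density (Rn n) (\<lambda>y. ennreal (\<Prod>i<n. g i (y i)))) = sets (\<Pi>\<^sub>M i\<in>{..<n}. density lborel (g i))"
      by (simp add: Rn_def cong: sets_PiM_cong)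
    fix A assume A: "\<And>i. i \<in> {..<n} \<Longrightarrow> A i \<in> sets (density lborel (g i))"
    then have A' [measurable]: "\<And>i. i \<in> {..<n} \<Longrightarrow> A i \<in> sets borel" by simp
    have AP: "Pi\<^sub>E {..<n} A \<in> sets (\<Pi>\<^sub>M i\<in>{..<n}. lborel)"
      using A by (intro sets_PiM_I_finite) auto
    have "emeasure (density (Rn n) (\<lambda>y. ennreal (\<Prod>i<n. g i (y i)))) (Pi\<^sub>E {..<n} A)
        = (\<integral>\<^sup>+y. ennreal (\<Prod>i<n. g i (y i)) * indicator (Pi\<^sub>E {..<n} A) y \<partial>(\<Pi>\<^sub>M i\<in>{..<n}. lborel))"
      unfolding Rn_def by (rule emeasure_density[OF _ AP]) measurable
    also have "\<dots> = (\<integral>\<^sup>+y. (\<Prod>i<n. ennreal (g i (y i)) * indicator (A i) (y i)) \<partial>(\<Pi>\<^sub>M i\<in>{..<n}. lborel))"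
    proof (rule nn_integral_cong)
      fix y assume y: "y \<in> space (\<Pi>\<^sub>M i\<in>{..<n}. lborel :: real measure)"
      have "indicator (Pi\<^sub>E {..<n} A) y = (\<Prod>i<n. indicator (A i) (y i) :: ennreal)"
      proof (cases "y \<in> Pi\<^sub>E {..<n} A")
        case True
        then show ?thesis by (auto intro!: prod.neutral[symmetric] simp: PiE_iff)
      next
        case False
        then obtain i where "i < n" "y i \<notin> A i" using y by (auto simp: space_PiM PiE_iff)
        then have "(\<Prod>i<n. indicator (A i) (y i) :: ennreal) = 0"
          by (intro prod_zero) (auto intro!: bexI[of _ i])
        with False show ?thesis by simp
      qed
      then show "ennreal (\<Prod>i<n. g i (y i)) * indicator (Pi\<^sub>E {..<n} A) y
          = (\<Prod>i<n. ennreal (g i (y i)) * indicator (A i) (y i))"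
        by (simp add: prod.distrib prod_ennreal nn)
    qed
    also have "\<dots> = (\<Prod>i<n. \<integral>\<^sup>+x. ennreal (g i x) * indicator (A i) x \<partial>lborel)"
      by (rule L.product_nn_integral_prod) auto
    also have "\<dots> = (\<Prod>i<n. emeasure (density lborel (g i)) (A i))"
      by (intro prod.cong refl emeasure_density[symmetric]) auto
    finally show "emeasure (density (Rn n) (\<lambda>y. ennreal (\<Prod>i<n. g i (y i)))) (Pi\<^sub>E {..<n} A)
        = (\<Prod>i<n. emeasure (density lborel (g i)) (A i))" .
  qed
qed

lemma std_gauss_eq_gamma_PiM: "std_gauss n = gamma_PiM {..<n}"
proof -
  have "(1 / (2 * pi)) powr (real n / 2) * exp (- (\<Sum>i<n. (y i)\<^sup>2) / 2) = (\<Prod>i<n. std_normal_density (y i))"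
    for y :: "nat \<Rightarrow> real"
  proof -
    have "(\<Prod>i<n. std_normal_density (y i)) = (1 / sqrt (2 * pi)) ^ n * exp (\<Sum>i<n. - (y i)\<^sup>2 / 2)"
      unfolding std_normal_density_def prod.distrib prod_constant by (simp add: exp_sum)
    also have "(1 / sqrt (2 * pi)) ^ n = (1 / (2 * pi)) powr (real n / 2)"
      by (simp add: powr_half_sqrt[symmetric] powr_realpow[symmetric] powr_powr powr_divide)
    also have "(\<Sum>i<n. - (y i)\<^sup>2 / 2) = - (\<Sum>i<n. (y i)\<^sup>2) / 2"
      by (simp add: sum_divide_distrib sum_negf)
    finally show ?thesis by simp
  qed
  then show ?thesis
    unfolding std_gauss_def gamma_PiM_def gamma1_def
    by (simp only:) (rule density_Rn_eq_PiM_density, auto intro: prob_space_normal_density)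
qed

lemma gauss_eq_PiM:
  assumes p: "p > 0"
  shows "gauss n p q x = (\<Pi>\<^sub>M i\<in>{..<n}. density lborel (normal_density (- q * x i / p) (1 / sqrt p)))"
proof -
  have "(p / (2 * pi)) powr (real n / 2) * exp (- (\<Sum>i<n. (p * y i + q * x i)\<^sup>2) / (2 * p))
      = (\<Prod>i<n. normal_density (- q * x i / p) (1 / sqrt p) (y i))" for y :: "nat \<Rightarrow> real"
  proof -
    have "normal_density (- q * x i / p) (1 / sqrt p) (y i)
        = sqrt (p / (2 * pi)) * exp (- (p * y i + q * x i)\<^sup>2 / (2 * p))" for i
    proof -
      have "- (y i - - q * x i / p)\<^sup>2 / (2 * (1 / sqrt p)\<^sup>2) = - (p * y i + q * x i)\<^sup>2 / (2 * p)"
        using p by (simp add: power_divide field_simps power2_eq_square)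
      moreover have "1 / sqrt (2 * pi * (1 / sqrt p)\<^sup>2) = sqrt (p / (2 * pi))"
        using p by (simp add: power_divide real_sqrt_divide)
      ultimately show ?thesis unfolding normal_density_def by simp
    qed
    then have "(\<Prod>i<n. normal_density (- q * x i / p) (1 / sqrt p) (y i))
       = sqrt (p / (2 * pi)) ^ n * exp (\<Sum>i<n. - (p * y i + q * x i)\<^sup>2 / (2 * p))"
      by (simp add: prod.distrib exp_sum)
    also have "sqrt (p / (2 * pi)) ^ n = (p / (2 * pi)) powr (real n / 2)"
      using p by (simp add: powr_half_sqrt[symmetric] powr_realpow[symmetric] powr_powr)
    also have "(\<Sum>i<n. - (p * y i + q * x i)\<^sup>2 / (2 * p)) = - (\<Sum>i<n. (p * y i + q * x i)\<^sup>2) / (2 * p)"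
      by (simp add: sum_divide_distrib sum_negf)
    finally show ?thesis by simp
  qed
  then show ?thesis
    unfolding gauss_def
    by (simp only:) (rule density_Rn_eq_PiM_density, use p in \<open>auto intro: prob_space_normal_density\<close>)
qed

text \<open>The dependence on \<open>x\<close> moves from the measure into the argument:
  \<open>gauss n p q x\<close> is the law of -q x / p + z / sqrt p with \<open>z\<close> standard
  Gaussian. The double integral of the theorem thereby runs over two independent standard Gaussian
  vectors.\<close>

lemma gauss_eq_distr:
  assumes p: "p > 0"
  shows "gauss n p q x
    = distr (gamma_PiM {..<n}) (Rn n) (\<lambda>z. \<lambda>i\<in>{..<n}. - q * x i / p + z i / sqrt p)"
proof -
  let ?f = "\<lambda>i z. - q * x i / p + (1 / sqrt p) * z"
  let ?D = "\<lambda>i. density lborel (normal_density (- q * x i / p) (1 / sqrt p))"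
  interpret D: product_prob_space ?D UNIV
    using p by (auto simp: product_prob_space_def product_prob_space_axioms_def product_sigma_finite_def
        intro!: prob_space_imp_sigma_finite prob_space_normal_density)
  interpret G: product_prob_space "\<lambda>i::nat. gamma1" UNIV
    by (auto simp: product_prob_space_def product_prob_space_axioms_def product_sigma_finite_def
        intro!: prob_space_imp_sigma_finite prob_space_gamma1)
  have meas [measurable]: "(\<lambda>z. \<lambda>i\<in>{..<n}. ?f i (z i)) \<in> gamma_PiM {..<n} \<rightarrow>\<^sub>M Rn n"
    unfolding Rn_def gamma_PiM_def by measurable
  have "distr (gamma_PiM {..<n}) (Rn n) (\<lambda>z. \<lambda>i\<in>{..<n}. ?f i (z i)) = (\<Pi>\<^sub>M i\<in>{..<n}. ?D i)"
  proof (rule D.PiM_eqI)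
    show "sets (distr (gamma_PiM {..<n}) (Rn n) (\<lambda>z. \<lambda>i\<in>{..<n}. ?f i (z i))) = sets (\<Pi>\<^sub>M i\<in>{..<n}. ?D i)"
      by (simp add: Rn_def cong: sets_PiM_cong)
    fix A assume A: "\<And>i. i \<in> {..<n} \<Longrightarrow> A i \<in> sets (?D i)"
    have AP: "Pi\<^sub>E {..<n} A \<in> sets (Rn n)"
      using A unfolding Rn_def by (intro sets_PiM_I_finite) auto
    have "emeasure (distr (gamma_PiM {..<n}) (Rn n) (\<lambda>z. \<lambda>i\<in>{..<n}. ?f i (z i))) (Pi\<^sub>E {..<n} A)
      = emeasure (gamma_PiM {..<n}) (Pi\<^sub>E {..<n} (\<lambda>i. ?f i -` A i))"
      by (subst emeasure_distr[OF meas AP], rule arg_cong[where f="emeasure _"])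
         (auto simp: gamma_PiM_def space_PiM PiE_iff)
    also have "\<dots> = (\<Prod>i<n. emeasure gamma1 (?f i -` A i))"
      unfolding gamma_PiM_def
    proof (rule G.emeasure_PiM)
      fix i assume "i \<in> {..<n}"
      then have "?f i -` A i \<inter> space borel \<in> sets borel"
        using A by (intro measurable_sets[where M=borel and A=borel]) auto
      then show "?f i -` A i \<in> sets gamma1" by simp
    qed auto
    also have "\<dots> = (\<Prod>i<n. emeasure (?D i) (A i))"
    proof (rule prod.cong[OF refl])
      fix i assume i: "i \<in> {..<n}"
      have "?D i = distr gamma1 borel (?f i)"
        using p by (subst distr_gamma1_affine) auto
      then show "emeasure gamma1 (?f i -` A i) = emeasure (?D i) (A i)"
        using A[OF i] by (simp add: emeasure_distr)
    qed
    finally show "emeasure (distr (gamma_PiM {..<n}) (Rn n) (\<lambda>z. \<lambda>i\<in>{..<n}. ?f i (z i))) (Pi\<^sub>E {..<n} A)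
      = (\<Prod>i<n. emeasure (?D i) (A i))" .
  qed auto
  then show ?thesis
    using gauss_eq_PiM[OF p, of n q x] by simp
qed

section \<open>A small Gaussian step\<close>

abbreviation gamma2 :: "(real \<times> real) measure" where
  "gamma2 \<equiv> gamma1 \<Otimes>\<^sub>M gamma1"

section \<open>Moments of a pair of independent Gaussians\<close>

lemma gamma2_monomial:
  shows integrable_gamma2_monomial: "integrable gamma2 (\<lambda>w. fst w ^ j * snd w ^ k)"
    and integral_gamma2_monomial:
      "(\<integral>w. fst w ^ j * snd w ^ k \<partial>gamma2) = (\<integral>x. x ^ j \<partial>gamma1) * (\<integral>x. x ^ k \<partial>gamma1)"
proof -
  have "integrable gamma1 (\<lambda>x. \<bar>x ^ k\<bar>)" for k
    by (rule integrable_abs) simp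
  then show int: "integrable gamma2 (\<lambda>w. fst w ^ j * snd w ^ k)"
    by (intro gamma1_pair.Fubini_integrable) (auto simp: abs_mult)
  show "(\<integral>w. fst w ^ j * snd w ^ k \<partial>gamma2) = (\<integral>x. x ^ j \<partial>gamma1) * (\<integral>x. x ^ k \<partial>gamma1)"
    using gamma1_pair.integral_fst'[OF int] by simp
qed

lemma gamma2_moments:
  shows integrable_gamma2_fst_power: "integrable gamma2 (\<lambda>w. fst w ^ j)"
    and integrable_gamma2_snd_power: "integrable gamma2 (\<lambda>w. snd w ^ j)"
    and integrable_gamma2_mult: "integrable gamma2 (\<lambda>w. fst w * snd w)"
    and integral_gamma2_fst: "(\<integral>w. fst w \<partial>gamma2) = 0"
    and integral_gamma2_snd: "(\<integral>w. snd w \<partial>gamma2) = 0"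
    and integral_gamma2_fst_sq: "(\<integral>w. (fst w)\<^sup>2 \<partial>gamma2) = 1"
    and integral_gamma2_snd_sq: "(\<integral>w. (snd w)\<^sup>2 \<partial>gamma2) = 1"
    and integral_gamma2_mult: "(\<integral>w. fst w * snd w \<partial>gamma2) = 0"
  using integrable_gamma2_monomial[of j 0] integrable_gamma2_monomial[of 0 j] integrable_gamma2_monomial[of 1 1]
    integral_gamma2_monomial[of 1 0] integral_gamma2_monomial[of 0 1] integral_gamma2_monomial[of 2 0]
    integral_gamma2_monomial[of 0 2] integral_gamma2_monomial[of 1 1]
  by (simp_all add: gamma1_moments gamma1.prob_space[simplified])

text \<open>A single weight that is at least 1 and dominates both coordinates. Every remainder of a
  short step, including the cubic one of the Taylor expansion, is at most a multiple of
  \<open>wt w ^ 3\<close>, which is integrable.\<close>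

definition wt :: "real \<times> real \<Rightarrow> real" where
  "wt w = 1 + (fst w)\<^sup>2 + (snd w)\<^sup>2"

lemma wt_ge_1: "wt w \<ge> 1" and wt_ge_fst: "\<bar>fst w\<bar> \<le> wt w" and wt_ge_snd: "\<bar>snd w\<bar> \<le> wt w"
proof -
  have *: "\<bar>t\<bar> \<le> 1 + t\<^sup>2" for t :: real
  proof -
    have "0 \<le> (\<bar>t\<bar> - 1)\<^sup>2 + t\<^sup>2 + 1" by (intro add_nonneg_nonneg) auto
    then show ?thesis by (simp add: power2_eq_square algebra_simps)
  qed
  show "wt w \<ge> 1" by (simp add: wt_def)
  show "\<bar>fst w\<bar> \<le> wt w" "\<bar>snd w\<bar> \<le> wt w"
    using *[of "fst w"] *[of "snd w"] unfolding wt_def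
    by (smt (verit) zero_le_power2)+
qed

lemma integrable_wt: "integrable gamma2 wt" and integral_wt: "integral\<^sup>L gamma2 wt = 3"
proof -
  have "integrable gamma2 (\<lambda>w. 1 + (fst w)\<^sup>2 + (snd w)\<^sup>2)"
    by (intro Bochner_Integration.integrable_add integrable_gamma2_fst_power integrable_gamma2_snd_power) simp
  then show "integrable gamma2 wt" by (simp add: wt_def[abs_def])
  show "integral\<^sup>L gamma2 wt = 3"
    unfolding wt_def[abs_def]
    by (simp add: integrable_gamma2_fst_power integrable_gamma2_snd_power integral_gamma2_fst_sq
        integral_gamma2_snd_sq gamma1_pair.prob_space[simplified])
qed

lemma integrable_wt_cube: "integrable gamma2 (\<lambda>w. wt w ^ 3)"
proof -
  have "wt w ^ 3 = 1 + fst w ^ 6 + snd w ^ 6 + 3 * fst w ^ 2 + 3 * snd w ^ 2 + 3 * fst w ^ 4 + 3 * snd w ^ 4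
      + 3 * (fst w ^ 4 * snd w ^ 2) + 3 * (fst w ^ 2 * snd w ^ 4) + 6 * (fst w ^ 2 * snd w ^ 2)" for w
    unfolding wt_def by algebra
  then show ?thesis
    by (simp only:) (intro Bochner_Integration.integrable_add Bochner_Integration.integrable_mult_right
      integrable_gamma2_fst_power integrable_gamma2_snd_power integrable_gamma2_monomial, simp)
qed

lemma measurable_continuous_on_compose:
  assumes "continuous_on S h" "F \<in> borel_measurable M" "\<And>x. x \<in> space M \<Longrightarrow> F x \<in> S"
  shows "(\<lambda>x. h (F x)) \<in> borel_measurable M"
proof -
  have "F \<in> M \<rightarrow>\<^sub>M restrict_space borel S"
    using assms(2,3) by (intro measurable_restrict_space2) auto
  from measurable_compose[OF this borel_measurable_continuous_on_restrict[OF assms(1)]]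
  show ?thesis .
qed

lemma integrable_interval:
  fixes f :: "_ \<Rightarrow> real"
  assumes "finite_measure M" "f \<in> borel_measurable M" "\<And>x. x \<in> space M \<Longrightarrow> f x \<in> {a..b}"
  shows "integrable M f"
proof (rule finite_measure.integrable_const_bound[OF assms(1) _ assms(2)])
  show "AE x in M. norm (f x) \<le> \<bar>a\<bar> + \<bar>b\<bar>" using assms(3) by (intro AE_I2) force
qed

lemma integral_interval:
  fixes f :: "_ \<Rightarrow> real"
  assumes "prob_space M" "f \<in> borel_measurable M" "\<And>x. x \<in> space M \<Longrightarrow> f x \<in> {a..b}"
  shows "integral\<^sup>L M f \<in> {a..b}"
proof -
  interpret prob_space M by fact
  have "integrable M f" by (rule integrable_interval[OF finite_measure_axioms assms(2,3)])
  then show ?thesis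
    using assms(3) integral_ge_const[of f a] integral_le_const[of f b] by auto
qed

text \<open>Unlike second differentiability, this bound passes to averages of translates with the same constant \<open>L\<close>.\<close>

definition smooth_map :: "real \<Rightarrow> (real \<Rightarrow> real) \<Rightarrow> (real \<Rightarrow> real) \<Rightarrow> bool" where
  "smooth_map L f f' \<longleftrightarrow> f \<in> borel_measurable borel \<and> f' \<in> borel_measurable borel \<and>
     (\<forall>x. \<bar>f' x\<bar> \<le> L) \<and> (\<forall>x y. \<bar>f (x + y) - f x - f' x * y\<bar> \<le> L * y\<^sup>2)"

lemma borel_measurable_vec_lambda:
  fixes f :: "'i::finite \<Rightarrow> 'a \<Rightarrow> real"
  assumes "\<And>i. f i \<in> borel_measurable M"
  shows "(\<lambda>x. \<chi> i. f i x) \<in> borel_measurable M"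
proof (rule borel_measurable_euclidean_space[THEN iffD2], rule ballI)
  fix b :: "real^'i" assume "b \<in> Basis"
  then obtain i where "b = axis i 1" by (auto simp: Basis_vec_def)
  then show "(\<lambda>x. (\<chi> i. f i x) \<bullet> b) \<in> borel_measurable M"
    using assms[of i] by (simp add: inner_axis)
qed

text \<open>
  \<open>G\<close> and \<open>Q\<close> are the gradient and the Hessian of \<open>Psi\<close>. The \<open>i\<close>-th function is evaluated at \<open>c$i * x + d$i * z\<close>, so
  \<open>ellip\<close> says that the Hessian times the covariance matrix \<open>c$i * c$j + d$i * d$j\<close>, entrywise, is positive semidefinite.
\<close>

locale gaussian_jensen =
  fixes Psi :: "real^'i::finite \<Rightarrow> real" and G :: "real^'i \<Rightarrow> real^'i"
    and Q :: "real^'i \<Rightarrow> real^'i \<Rightarrow> real^'i \<Rightarrow> real"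
    and l u c d :: "real^'i" and B :: real
  assumes cont: "continuous_on (cbox l u) Psi"
    and taylor: "\<And>e. e > 0 \<Longrightarrow> \<exists>K. \<forall>p\<in>cbox l u. \<forall>q\<in>cbox l u.
      Psi p + G p \<bullet> (q - p) + Q p (q - p) (q - p) / 2 - e * norm (q - p) ^ 2 - K * norm (q - p) ^ 3 \<le> Psi q"
    and bilin: "\<And>p. p \<in> cbox l u \<Longrightarrow> bilinear (Q p)"
    and bound: "\<And>p v w. p \<in> cbox l u \<Longrightarrow> \<bar>Q p v w\<bar> \<le> B * norm v * norm w"
    and ellip: "\<And>p r. p \<in> cbox l u \<Longrightarrow>
      0 \<le> Q p (\<chi> i. c$i * r$i) (\<chi> i. c$i * r$i) + Q p (\<chi> i. d$i * r$i) (\<chi> i. d$i * r$i)"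
    and c_nz: "\<And>i. c$i \<noteq> 0"
begin

lemma mem_cbox_iff: "v \<in> cbox l u \<longleftrightarrow> (\<forall>i. v$i \<in> {l$i..u$i})"
  by (auto simp: mem_box_cart)

lemma Psi_bounded: obtains C where "C \<ge> 0" "\<And>p. p \<in> cbox l u \<Longrightarrow> \<bar>Psi p\<bar> \<le> C"
proof -
  have "bounded (Psi ` cbox l u)"
    by (intro compact_imp_bounded compact_continuous_image cont compact_cbox)
  then obtain C where "\<forall>x\<in>Psi ` cbox l u. norm x \<le> C"
    unfolding bounded_iff by blast
  then have "\<And>p. p \<in> cbox l u \<Longrightarrow> \<bar>Psi p\<bar> \<le> \<bar>C\<bar>" by fastforce
  then show ?thesis by (intro that[of "\<bar>C\<bar>"]) auto
qed

definition lin :: "'i \<Rightarrow> real \<times> real \<Rightarrow> real" where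
  "lin i w = c$i * fst w + d$i * snd w"

lemma measurable_lin [measurable]: "lin i \<in> borel_measurable gamma2"
  unfolding lin_def[abs_def] by measurable

lemma measurable_Psi:
  assumes "\<And>i. f i \<in> borel_measurable M" "\<And>i x. x \<in> space M \<Longrightarrow> f i x \<in> {l$i..u$i}"
  shows "(\<lambda>x. Psi (\<chi> i. f i x)) \<in> borel_measurable M"
  by (rule measurable_continuous_on_compose[OF cont borel_measurable_vec_lambda])
     (use assms in \<open>auto simp: mem_cbox_iff\<close>)

lemma integrable_Psi:
  assumes "finite_measure M"
    and "\<And>i. f i \<in> borel_measurable M" "\<And>i x. x \<in> space M \<Longrightarrow> f i x \<in> {l$i..u$i}"
  shows "integrable M (\<lambda>x. Psi (\<chi> i. f i x))"
proof -
  obtain C where C: "\<And>p. p \<in> cbox l u \<Longrightarrow> \<bar>Psi p\<bar> \<le> C" using Psi_bounded by metis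
  show ?thesis
    by (rule finite_measure.integrable_const_bound[OF assms(1), where B=C])
       (use assms in \<open>auto intro!: AE_I2 C measurable_Psi simp: mem_cbox_iff simp del: atLeastAtMost_iff\<close>)
qed

lemma B_nonneg:
  assumes "p \<in> cbox l u"
  shows "B \<ge> 0"
proof -
  let ?v = "axis undefined 1 :: real^'i"
  have "0 \<le> \<bar>Q p ?v ?v\<bar>" by simp
  also have "\<dots> \<le> B * norm ?v * norm ?v" by (rule bound[OF assms])
  finally show ?thesis by (simp add: norm_axis_1)
qed

text \<open>Expand by bilinearity and bound the three terms containing \<open>\<rho>\<close>. The
  two cross terms are estimated separately, so the form may be asymmetric.\<close>

lemma quadratic_perturbation:
  assumes "p \<in> cbox l u" "norm \<rho> \<le> s" "norm V \<le> t"
  shows "Q p V V - B * (2 * s * t + s\<^sup>2) \<le> Q p (V + \<rho>) (V + \<rho>)"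
proof -
  have [simp]: "Q p (x + y) z = Q p x z + Q p y z" "Q p z (x + y) = Q p z x + Q p z y" for x y z
    using bilin[OF assms(1)] by (auto intro: bilinear_ladd bilinear_radd)
  have B: "B \<ge> 0" using B_nonneg assms(1) .
  have *: "\<bar>Q p v w\<bar> \<le> B * (x * y)" if "norm v \<le> x" "norm w \<le> y" for v w x y
  proof -
    have "norm v * norm w \<le> x * y" using that by (intro mult_mono) (auto intro: order_trans[OF norm_ge_zero])
    then show ?thesis using bound[OF assms(1), of v w] B
      by (smt (verit, best) mult.assoc mult_left_mono)
  qed
  have "\<bar>Q p V \<rho>\<bar> \<le> B * (t * s)" "\<bar>Q p \<rho> V\<bar> \<le> B * (s * t)" "\<bar>Q p \<rho> \<rho>\<bar> \<le> B * (s * s)"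
    by (intro * assms)+
  then show ?thesis by (simp add: algebra_simps power2_eq_square)
qed


text \<open>\<open>Psi\<close> is expanded at the mean \<open>m\<close> of the vector
  \<open>F\<close>, not at the starting value \<open>p\<close>, so the gradient term integrates to
  exactly 0. The deviation \<open>F w - m\<close> is a linear part \<open>V w\<close> of size sqrt h
  plus a remainder of order h. The quadratic term of \<open>V\<close> averages to h/2 times the left
  side of \<open>ellip\<close>, hence is nonnegative, and all other terms are below e * h. The bound
  \<open>h0\<close> is chosen before \<open>f\<close> and \<open>x\<close>; this uniformity is what
  permits iteration.\<close>

lemma small_gaussian_step:
  assumes L: "L \<ge> 0" and e: "e > 0"
  obtains h0 where "h0 > 0" "\<And>h f f' x. \<lbrakk>0 < h; h < h0; \<And>i. smooth_map L (f i) (f' i);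
      \<And>i t. f i t \<in> {l$i..u$i}\<rbrakk> \<Longrightarrow>
    Psi (\<chi> i. \<integral>w. f i (x$i + sqrt h * lin i w) \<partial>gamma2) - e * h
      \<le> (\<integral>w. Psi (\<chi> i. f i (x$i + sqrt h * lin i w)) \<partial>gamma2)"
proof -
  define k where "k = norm c + norm d"
  define n where "n = real CARD('i)"
  \<comment> \<open>\<open>C1\<close> bounds the nonlinear part of \<open>F w - m\<close> and
    \<open>C2\<close> the linear part. In 8 = 2 + 6, the 2 comes from the remainder at
    \<open>w\<close> (\<open>rem1\<close>) and the 6 from its integral (\<open>rem2\<close>), as
    \<open>wt\<close> has mean 3; the factor \<open>n\<close> comes from estimating the norm by the
    sum of the components.\<close>
  define C1 where "C1 = n * (8 * L * k\<^sup>2)"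
  define C2 where "C2 = 2 * n * (k * L)"
  define C3 where "C3 = C1 + C2"
  define W where "W = (\<integral>w. wt w ^ 3 \<partial>gamma2)"
  have k: "k \<ge> 0" "\<bar>c$i\<bar> \<le> k" "\<bar>d$i\<bar> \<le> k" for i
    using component_le_norm_cart[of c i] component_le_norm_cart[of d i] norm_ge_zero[of c] norm_ge_zero[of d]
    unfolding k_def by linarith+
  have n: "n \<ge> 0" by (simp add: n_def)
  have C: "C1 \<ge> 0" "C2 \<ge> 0" "C3 \<ge> 0" using k n L by (simp_all add: C1_def C2_def C3_def)
  have W: "W \<ge> 0" unfolding W_def
    by (intro integral_nonneg_AE AE_I2 zero_le_power order_trans[OF _ wt_ge_1]) simp
  \<comment> \<open>The budget e * h is halved: this choice keeps the quadratic Taylor error below e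
    * h / 2, and \<open>h0\<close> does the same for the terms of order h * sqrt h.\<close>
  define e' where "e' = e / (2 * (C3\<^sup>2 * W + 1))"
  have e': "e' > 0" using e W by (simp add: e'_def add_nonneg_pos)
  have e'W: "e' * C3\<^sup>2 * W \<le> e / 2"
  proof -
    have "e' * C3\<^sup>2 * W = e / 2 * (C3\<^sup>2 * W / (C3\<^sup>2 * W + 1))"
      by (simp add: e'_def field_simps)
    also have "\<dots> \<le> e / 2 * 1"
      using e W by (intro mult_left_mono) (auto simp: divide_le_eq_1 add_nonneg_pos intro: add_pos_nonneg)
    finally show ?thesis by simp
  qed
  from taylor[OF e'] obtain K where K: "\<And>p q. p \<in> cbox l u \<Longrightarrow> q \<in> cbox l u \<Longrightarrow>
      Psi p + G p \<bullet> (q - p) + Q p (q - p) (q - p) / 2 - e' * norm (q - p) ^ 2 - K * norm (q - p) ^ 3 \<le> Psi q"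
    by blast
  \<comment> \<open>\<open>C5\<close> collects what is of order s * h with s = sqrt h: the terms by
    which \<open>Q m\<close> changes between \<open>V w\<close> and \<open>F w - m\<close>, and the
    cubic Taylor error. In \<open>h0\<close> the second bound gives s * C5 * W \<le> e / 2, while
    the bound 1 gives h \<le> s.\<close>
  define C5 where "C5 = \<bar>B\<bar> * (2 * C1 * C2 + C1\<^sup>2) + \<bar>K\<bar> * C3 ^ 3"
  have C5: "C5 \<ge> 0" using C by (simp add: C5_def)
  define h0 where "h0 = min 1 ((e / (2 * (C5 * W + 1)))\<^sup>2)"
  have h0: "h0 > 0" using e W C5 by (auto simp: h0_def add_nonneg_pos add_nonneg_eq_0_iff)
  show thesis
  proof (rule that[OF h0])
    fix h :: real and f f' :: "'i \<Rightarrow> real \<Rightarrow> real" and x :: "real^'i"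
    assume h: "0 < h" "h < h0" and sm: "\<And>i. smooth_map L (f i) (f' i)" and fI: "\<And>i t. f i t \<in> {l$i..u$i}"
    have [measurable]: "f i \<in> borel_measurable borel" for i using sm by (simp add: smooth_map_def)
    have h1: "h < 1" using h by (simp add: h0_def)
    define s where "s = sqrt h"
    have s: "s > 0" "s < 1" "h = s\<^sup>2" using h h1 by (auto simp: s_def)
    have sle: "s \<le> e / (2 * (C5 * W + 1))"
    proof -
      have "s\<^sup>2 \<le> (e / (2 * (C5 * W + 1)))\<^sup>2" using h s by (simp add: h0_def)
      then show ?thesis by (rule power2_le_imp_le) (use e W C5 in simp)
    qed
    define p where "p = (\<chi> i. f i (x$i))"
    define r where "r = (\<chi> i. f' i (x$i))"
    define A where "A = (\<chi> i. c$i * r$i)"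
    define D where "D = (\<chi> i. d$i * r$i)"
    define F where "F w = (\<chi> i. f i (x$i + s * lin i w))" for w
    define m where "m = (\<chi> i. \<integral>w. f i (x$i + s * lin i w) \<partial>gamma2)"
    define V where "V w = s *\<^sub>R (fst w *\<^sub>R A + snd w *\<^sub>R D)" for w
    have Fint: "integrable gamma2 (\<lambda>w. f i (x$i + s * lin i w))" for i
      using fI by (intro integrable_interval[where a="l$i" and b="u$i"]) (auto intro: gamma1_pair.finite_measure_axioms)
    have mbox: "m \<in> cbox l u"
      unfolding mem_cbox_iff m_def using fI
      by (auto simp del: atLeastAtMost_iff intro!: integral_interval gamma1_pair.prob_space_axioms)
    have Fbox: "F w \<in> cbox l u" for w
      using fI by (simp add: mem_cbox_iff F_def)
    have Vi: "V w $ i = f' i (x$i) * (s * lin i w)" for w i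
      by (simp add: V_def A_def D_def r_def lin_def algebra_simps)
    have lin2: "(lin i w)\<^sup>2 \<le> 2 * k\<^sup>2 * wt w" for i w
    proof -
      have "(lin i w)\<^sup>2 \<le> 2 * (c$i * fst w)\<^sup>2 + 2 * (d$i * snd w)\<^sup>2"
        unfolding lin_def using sum_squares_bound[of "c$i * fst w" "d$i * snd w"] by (simp add: power2_sum)
      also have "\<dots> \<le> 2 * (k\<^sup>2 * (fst w)\<^sup>2) + 2 * (k\<^sup>2 * (snd w)\<^sup>2)"
      proof -
        have "(c$i)\<^sup>2 \<le> k\<^sup>2" "(d$i)\<^sup>2 \<le> k\<^sup>2"
          using power_mono[OF k(2)[of i], of 2] power_mono[OF k(3)[of i], of 2] by simp_all
        then show ?thesis
          unfolding power_mult_distrib by (intro add_mono mult_left_mono mult_right_mono) auto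
      qed
      also have "\<dots> \<le> 2 * k\<^sup>2 * wt w" by (simp add: wt_def algebra_simps)
      finally show ?thesis .
    qed
    have rem1: "\<bar>f i (x$i + s * lin i w) - p$i - V w $ i\<bar> \<le> 2 * L * k\<^sup>2 * h * wt w" for i w
    proof -
      have "\<bar>f i (x$i + s * lin i w) - p$i - V w $ i\<bar> \<le> L * (s * lin i w)\<^sup>2"
        using sm unfolding Vi p_def smooth_map_def by simp
      also have "\<dots> \<le> L * (s\<^sup>2 * (2 * k\<^sup>2 * wt w))"
        unfolding power_mult_distrib using lin2[of i w] L by (intro mult_left_mono) auto
      finally show ?thesis using s by (simp add: algebra_simps)
    qed
    have lin_int: "integrable gamma2 (\<lambda>w. V w $ i)" "(\<integral>w. V w $ i \<partial>gamma2) = 0" for i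
    proof -
      have "V w $ i = s * A$i * fst w + s * D$i * snd w" for w
        by (simp add: V_def algebra_simps)
      then show "integrable gamma2 (\<lambda>w. V w $ i)" "(\<integral>w. V w $ i \<partial>gamma2) = 0"
        using integrable_gamma2_fst_power[of 1] integrable_gamma2_snd_power[of 1]
        by (simp_all add: integral_gamma2_fst integral_gamma2_snd)
    qed
    have rem2: "\<bar>m$i - p$i\<bar> \<le> 6 * L * k\<^sup>2 * h" for i
    proof -
      have "m$i - p$i = (\<integral>w. f i (x$i + s * lin i w) - p$i - V w $ i \<partial>gamma2)"
        using Fint lin_int by (simp add: m_def gamma1_pair.prob_space[simplified])
      also have "\<bar>\<dots>\<bar> \<le> (\<integral>w. 2 * L * k\<^sup>2 * h * wt w \<partial>gamma2)"
        using rem1[of i] integrable_wt Fint lin_int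
        by (intro order_trans[OF integral_abs_bound] integral_mono) auto
      also have "\<dots> = 6 * L * k\<^sup>2 * h" using integral_wt by simp
      finally show ?thesis .
    qed
    have rho: "norm (F w - m - V w) \<le> C1 * h * wt w" for w
    proof -
      have "\<bar>(F w - m - V w) $ i\<bar> \<le> 8 * L * k\<^sup>2 * h * wt w" for i
      proof -
        have "(F w - m - V w) $ i = (f i (x$i + s * lin i w) - p$i - V w $ i) - (m$i - p$i)"
          by (simp add: F_def)
        then have "\<bar>(F w - m - V w) $ i\<bar> \<le> 2 * L * k\<^sup>2 * h * wt w + 6 * L * k\<^sup>2 * h * 1"
          using rem1[of i w] rem2[of i] by linarith
        also have "\<dots> \<le> 2 * L * k\<^sup>2 * h * wt w + 6 * L * k\<^sup>2 * h * wt w"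
          using wt_ge_1[of w] L h by (intro add_left_mono mult_left_mono) auto
        finally show ?thesis by (simp add: algebra_simps)
      qed
      then have "(\<Sum>i\<in>UNIV. \<bar>(F w - m - V w) $ i\<bar>) \<le> (\<Sum>i\<in>(UNIV::'i set). 8 * L * k\<^sup>2 * h * wt w)"
        by (intro sum_mono)
      then show ?thesis
        using norm_le_l1_cart[of "F w - m - V w"] by (simp add: C1_def n_def mult_ac)
    qed
    have AD: "norm A \<le> n * (k * L)" "norm D \<le> n * (k * L)"
    proof -
      have "\<bar>r$i\<bar> \<le> L" for i using sm by (simp add: r_def smooth_map_def)
      then have *: "\<bar>A$i\<bar> \<le> k * L" "\<bar>D$i\<bar> \<le> k * L" for i
        using k by (auto simp: A_def D_def abs_mult intro!: mult_mono)
      have "(\<Sum>i\<in>UNIV. \<bar>A$i\<bar>) \<le> (\<Sum>i\<in>(UNIV::'i set). k * L)" "(\<Sum>i\<in>UNIV. \<bar>D$i\<bar>) \<le> (\<Sum>i\<in>(UNIV::'i set). k * L)"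
        by (rule sum_mono, rule *)+
      then show "norm A \<le> n * (k * L)" "norm D \<le> n * (k * L)"
        using norm_le_l1_cart[of A] norm_le_l1_cart[of D] by (auto simp: n_def)
    qed
    have Vn: "norm (V w) \<le> s * C2 * wt w" for w
    proof -
      have "norm (fst w *\<^sub>R A + snd w *\<^sub>R D) \<le> \<bar>fst w\<bar> * norm A + \<bar>snd w\<bar> * norm D"
        by (rule norm_triangle_le) simp
      also have "\<dots> \<le> wt w * (n * (k * L)) + wt w * (n * (k * L))"
        using wt_ge_fst wt_ge_snd AD wt_ge_1[of w] by (intro add_mono mult_mono) auto
      also have "\<dots> = C2 * wt w" by (simp add: C2_def)
      finally show ?thesis using s by (simp add: V_def)
    qed
    have Fm: "norm (F w - m) \<le> s * (C3 * wt w)" for w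
    proof -
      have "norm (F w - m) \<le> norm (F w - m - V w) + norm (V w)"
        using norm_triangle_ineq[of "F w - m - V w" "V w"] by simp
      also have "\<dots> \<le> C1 * h * wt w + s * C2 * wt w" using rho[of w] Vn[of w] by linarith
      also have "C1 * h * wt w \<le> C1 * s * wt w"
        using s C wt_ge_1[of w] by (intro mult_left_mono mult_right_mono) (auto simp: power2_eq_square)
      finally show ?thesis by (simp add: C3_def algebra_simps)
    qed
    define q where "q w = h / 2 * ((fst w)\<^sup>2 * Q m A A + fst w * snd w * (Q m A D + Q m D A) + (snd w)\<^sup>2 * Q m D D)" for w
    have QV: "Q m (V w) (V w) / 2 = q w" for w
      using bilin[OF mbox] unfolding V_def q_def
      by (simp add: bilinear_ladd bilinear_radd bilinear_lmul bilinear_rmul s(3) power2_eq_square algebra_simps)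
    have B: "B \<ge> 0" using B_nonneg mbox .
    define E where "E = e' * C3\<^sup>2 * h + s * h * C5"
    have pw: "Psi m + G m \<bullet> (F w - m) + q w - E * wt w ^ 3 \<le> Psi (F w)" for w
    proof -
      have wt: "wt w \<ge> 0" "wt w ^ 2 \<le> wt w ^ 3" using wt_ge_1[of w] by (auto intro: power_increasing)
      have a: "Q m (F w - m) (F w - m) / 2 \<ge> q w - B * (2 * C1 * C2 + C1\<^sup>2) * (s * h) * wt w ^ 3"
      proof -
        have "Q m (V w) (V w) - B * (2 * (C1 * h * wt w) * (s * C2 * wt w) + (C1 * h * wt w)\<^sup>2)
          \<le> Q m (V w + (F w - m - V w)) (V w + (F w - m - V w))"
          by (rule quadratic_perturbation[OF mbox rho Vn])
        moreover have "B * (2 * (C1 * h * wt w) * (s * C2 * wt w) + (C1 * h * wt w)\<^sup>2)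
            \<le> B * ((2 * C1 * C2 + C1\<^sup>2) * (s * h) * wt w ^ 2)"
        proof (rule mult_left_mono[OF _ B])
          have "C1\<^sup>2 * wt w ^ 2 * h * h \<le> C1\<^sup>2 * wt w ^ 2 * h * s"
            using s h by (intro mult_left_mono) (auto simp: power2_eq_square)
          then show "2 * (C1 * h * wt w) * (s * C2 * wt w) + (C1 * h * wt w)\<^sup>2
             \<le> (2 * C1 * C2 + C1\<^sup>2) * (s * h) * wt w ^ 2"
            by (simp add: power2_eq_square algebra_simps)
        qed
        moreover have "B * ((2 * C1 * C2 + C1\<^sup>2) * (s * h) * wt w ^ 2) \<le> B * ((2 * C1 * C2 + C1\<^sup>2) * (s * h) * wt w ^ 3)"
          using B C s h wt by (intro mult_left_mono) auto
        moreover have "0 \<le> B * ((2 * C1 * C2 + C1\<^sup>2) * (s * h) * wt w ^ 3)"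
          using B C s h wt by auto
        ultimately show ?thesis using QV[of w] by (simp add: algebra_simps)
      qed
      have b: "e' * norm (F w - m) ^ 2 \<le> e' * C3\<^sup>2 * h * wt w ^ 3"
      proof -
        have "norm (F w - m) ^ 2 \<le> (s * (C3 * wt w)) ^ 2" by (intro power_mono Fm) auto
        also have "\<dots> = C3\<^sup>2 * h * wt w ^ 2" by (simp add: s(3) power_mult_distrib)
        also have "\<dots> \<le> C3\<^sup>2 * h * wt w ^ 3" using wt h by (intro mult_left_mono) auto
        finally have "e' * norm (F w - m) ^ 2 \<le> e' * (C3\<^sup>2 * h * wt w ^ 3)" using e' by (intro mult_left_mono) auto
        then show ?thesis by (simp add: mult_ac)
      qed
      have c: "K * norm (F w - m) ^ 3 \<le> \<bar>K\<bar> * C3 ^ 3 * (s * h) * wt w ^ 3"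
      proof -
        have "K * norm (F w - m) ^ 3 \<le> \<bar>K\<bar> * (s * (C3 * wt w)) ^ 3"
          using Fm[of w] by (intro mult_mono power_mono) auto
        also have "\<dots> = \<bar>K\<bar> * C3 ^ 3 * (s * h) * wt w ^ 3"
          by (simp add: s(3) power_mult_distrib power2_eq_square power3_eq_cube)
        finally show ?thesis .
      qed
      have "E * wt w ^ 3 = e' * C3\<^sup>2 * h * wt w ^ 3 + B * (2 * C1 * C2 + C1\<^sup>2) * (s * h) * wt w ^ 3
          + \<bar>K\<bar> * C3 ^ 3 * (s * h) * wt w ^ 3"
        using B by (simp add: E_def C5_def algebra_simps)
      with K[OF mbox Fbox[of w]] a b c show ?thesis by linarith
    qed
    have Gint: "integrable gamma2 (\<lambda>w. G m \<bullet> (F w - m))" "(\<integral>w. G m \<bullet> (F w - m) \<partial>gamma2) = 0"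
    proof -
      have eq: "G m \<bullet> (F w - m) = (\<Sum>i\<in>UNIV. G m $ i * (f i (x$i + s * lin i w) - m$i))" for w
        by (simp add: inner_vec_def F_def)
      show "integrable gamma2 (\<lambda>w. G m \<bullet> (F w - m))"
        unfolding eq using Fint by auto
      show "(\<integral>w. G m \<bullet> (F w - m) \<partial>gamma2) = 0"
        unfolding eq using Fint by (simp add: gamma1_pair.prob_space[simplified]) (simp add: m_def)
    qed
    have qint: "integrable gamma2 q" "integral\<^sup>L gamma2 q = h / 2 * (Q m A A + Q m D D)"
      unfolding q_def[abs_def]
      using integrable_gamma2_fst_power integrable_gamma2_snd_power integrable_gamma2_mult
      by (auto simp: integral_gamma2_fst_sq integral_gamma2_snd_sq integral_gamma2_mult)
    have "0 \<le> Q m A A + Q m D D" unfolding A_def D_def by (rule ellip[OF mbox])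
    then have "0 \<le> h / 2 * (Q m A A + Q m D D)" using h by simp
    then have "Psi m - E * W \<le> (\<integral>w. Psi m + G m \<bullet> (F w - m) + q w - E * wt w ^ 3 \<partial>gamma2)"
      using Gint qint integrable_wt_cube by (simp add: W_def gamma1_pair.prob_space[simplified])
    also have "\<dots> \<le> (\<integral>w. Psi (F w) \<partial>gamma2)"
    proof (rule integral_mono[OF _ _ pw])
      show "integrable gamma2 (\<lambda>w. Psi m + G m \<bullet> (F w - m) + q w - E * wt w ^ 3)"
        using Gint qint integrable_wt_cube by auto
      show "integrable gamma2 (\<lambda>w. Psi (F w))"
        unfolding F_def using fI
        by (intro integrable_Psi gamma1_pair.finite_measure_axioms) (auto simp del: atLeastAtMost_iff)
    qed
    finally have main: "Psi m - E * W \<le> (\<integral>w. Psi (F w) \<partial>gamma2)" .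
    have "s * (C5 * W) \<le> e / 2"
    proof -
      have "s * (C5 * W) \<le> e / (2 * (C5 * W + 1)) * (C5 * W)"
        using sle C5 W by (intro mult_right_mono) auto
      also have "\<dots> = e / 2 * (C5 * W / (C5 * W + 1))" by simp
      also have "\<dots> \<le> e / 2 * 1"
        using e W C5 by (intro mult_left_mono) (auto simp: divide_le_eq_1 add_nonneg_pos)
      finally show ?thesis by simp
    qed
    then have "(e' * C3\<^sup>2 * W + s * (C5 * W)) * h \<le> e * h"
      using e'W h by (intro mult_right_mono) auto
    then have "E * W \<le> e * h" by (simp add: E_def algebra_simps)
    with main show "Psi (\<chi> i. \<integral>w. f i (x$i + sqrt h * lin i w) \<partial>gamma2) - e * h
      \<le> (\<integral>w. Psi (\<chi> i. f i (x$i + sqrt h * lin i w)) \<partial>gamma2)"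
      unfolding m_def F_def s_def by simp
  qed
qed

end

section \<open>Convolution of Gaussian pairs and approximation by smooth functions\<close>

lemma integrable_gamma2_bounded:
  fixes F :: "real \<times> real \<Rightarrow> real"
  assumes "F \<in> borel_measurable gamma2" "\<And>w. \<bar>F w\<bar> \<le> B"
  shows "integrable gamma2 F"
  by (rule gamma1_pair.integrable_const_bound[where B=B]) (use assms in auto)

text \<open>After exchanging the two middle integrals, the one-dimensional convolution applies in
  each coordinate separately. This composes Gaussian steps: the squares of the step sizes
  add.\<close>

lemma gamma2_convolution:
  fixes F :: "real \<times> real \<Rightarrow> real"
  assumes [measurable]: "F \<in> borel_measurable gamma2" and B: "\<And>w. \<bar>F w\<bar> \<le> B"
  shows "(\<integral>w. (\<integral>w'. F (s * fst w + t * fst w', s * snd w + t * snd w') \<partial>gamma2) \<partial>gamma2)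
    = (\<integral>w. F (sqrt (s\<^sup>2 + t\<^sup>2) * fst w, sqrt (s\<^sup>2 + t\<^sup>2) * snd w) \<partial>gamma2)"
proof -
  let ?r = "sqrt (s\<^sup>2 + t\<^sup>2)"
  \<comment> \<open>This holds without integrability, because a non-integrable function has integral
    0 by convention and \<open>B\<close> is nonnegative.\<close>
  have Bi: "\<bar>integral\<^sup>L gamma1 h\<bar> \<le> B" if "\<And>x. \<bar>h x\<bar> \<le> B" for h :: "real \<Rightarrow> real"
  proof -
    have "\<bar>integral\<^sup>L gamma1 h\<bar> \<le> (\<integral>x. B \<partial>gamma1)"
    proof (cases "integrable gamma1 h")
      case True
      then show ?thesis using that by (intro order_trans[OF integral_abs_bound] integral_mono) auto
    next
      case False
      then show ?thesis using order_trans[OF abs_ge_zero that] by (simp add: not_integrable_integral_eq gamma1.prob_space[simplified])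
    qed
    then show ?thesis by (simp add: gamma1.prob_space[simplified])
  qed
  have "(\<integral>w. (\<integral>w'. F (s * fst w + t * fst w', s * snd w + t * snd w') \<partial>gamma2) \<partial>gamma2)
    = (\<integral>w. (\<integral>x'. (\<integral>z'. F (s * fst w + t * x', s * snd w + t * z') \<partial>gamma1) \<partial>gamma1) \<partial>gamma2)"
    by (intro Bochner_Integration.integral_cong refl, subst gamma1_pair.integral_fst'[symmetric])
       (auto intro!: integrable_gamma2_bounded B)
  also have "\<dots> = (\<integral>x. (\<integral>z. (\<integral>x'. (\<integral>z'. F (s * x + t * x', s * z + t * z') \<partial>gamma1) \<partial>gamma1) \<partial>gamma1) \<partial>gamma1)"
    by (subst gamma1_pair.integral_fst'[symmetric])
       (auto intro!: integrable_gamma2_bounded Bi B)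
  also have "\<dots> = (\<integral>x. (\<integral>x'. (\<integral>z. (\<integral>z'. F (s * x + t * x', s * z + t * z') \<partial>gamma1) \<partial>gamma1) \<partial>gamma1) \<partial>gamma1)"
    by (intro Bochner_Integration.integral_cong refl gamma1_pair.Fubini_integral integrable_gamma2_bounded)
       (auto simp: split_beta intro!: Bi B)
  also have "\<dots> = (\<integral>x. (\<integral>x'. (\<integral>z. F (s * x + t * x', ?r * z) \<partial>gamma1) \<partial>gamma1) \<partial>gamma1)"
    by (intro Bochner_Integration.integral_cong refl gamma1_convolution) (auto intro: B)
  also have "\<dots> = (\<integral>x. (\<integral>z. F (?r * x, ?r * z) \<partial>gamma1) \<partial>gamma1)"
    by (rule gamma1_convolution[where F="\<lambda>u. \<integral>z. F (u, ?r * z) \<partial>gamma1"]) (auto intro!: Bi B)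
  also have "\<dots> = (\<integral>w. F (?r * fst w, ?r * snd w) \<partial>gamma2)"
    by (subst gamma1_pair.integral_fst'[symmetric]) (auto intro!: integrable_gamma2_bounded B)
  finally show ?thesis .
qed

text \<open>Average twice over a window of length \<open>\<eta>\<close>. The first average is
  Lipschitz, so the second has a Lipschitz derivative, which gives the quadratic bound of
  \<open>smooth_map\<close>. By the mean value theorem each average at \<open>x\<close> is a value
  of the averaged function within distance \<open>\<eta>\<close>; hence the range stays in
  \<open>{a..b}\<close> and the total displacement is at most 2 * \<eta>.\<close>

lemma smooth_approximation:
  fixes f :: "real \<Rightarrow> real"
  assumes cont: "continuous_on UNIV f" and I: "\<And>x. f x \<in> {a..b}" and \<eta>: "\<eta> > 0"
  shows "\<exists>g g' L. smooth_map L g g' \<and> (\<forall>x. g x \<in> {a..b}) \<and> (\<forall>x. \<exists>y. \<bar>y - x\<bar> \<le> 2 * \<eta> \<and> g x = f y)"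
proof -
  have anti: "\<exists>F. \<forall>x. (F has_real_derivative h x) (at x)" if "continuous_on UNIV h" for h :: "real \<Rightarrow> real"
  proof -
    have "\<And>x. isCont h x" using that by (simp add: continuous_on_eq_continuous_at)
    then obtain F where "\<And>x. (F has_vector_derivative h x) (at x)"
      using einterval_antiderivative[of "-\<infinity>" "\<infinity>" h] by auto
    then show ?thesis by (auto simp: has_real_derivative_iff_has_vector_derivative)
  qed
  have avg: "\<exists>g. (\<forall>x. (g has_real_derivative (h (x + \<eta>) - h x) / \<eta>) (at x))
      \<and> (\<forall>x. \<exists>y. \<bar>y - x\<bar> \<le> \<eta> \<and> g x = h y)" if h: "continuous_on UNIV h" for h :: "real \<Rightarrow> real"
  proof -
    obtain F where F: "\<And>x. (F has_real_derivative h x) (at x)" using anti[OF h] by auto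
    show ?thesis
    proof (intro exI[of _ "\<lambda>x. (F (x + \<eta>) - F x) / \<eta>"] conjI allI)
      fix x
      have *: "((\<lambda>x. F (x + \<eta>)) has_real_derivative h (x + \<eta>)) (at x)"
        using F[of "x + \<eta>"] by (simp add: DERIV_shift)
      show "((\<lambda>x. (F (x + \<eta>) - F x) / \<eta>) has_real_derivative (h (x + \<eta>) - h x) / \<eta>) (at x)"
        by (intro DERIV_cdivide DERIV_diff * F)
      obtain y where "x < y" "y < x + \<eta>" "F (x + \<eta>) - F x = (x + \<eta> - x) * h y"
        using MVT2[of x "x + \<eta>" F h] F \<eta> by auto
      then show "\<exists>y. \<bar>y - x\<bar> \<le> \<eta> \<and> (F (x + \<eta>) - F x) / \<eta> = h y"
        using \<eta> by (intro exI[of _ y]) auto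
    qed
  qed
  obtain g where g: "\<And>x. (g has_real_derivative (f (x + \<eta>) - f x) / \<eta>) (at x)"
      "\<And>x. \<exists>y. \<bar>y - x\<bar> \<le> \<eta> \<and> g x = f y"
    using avg[OF cont] by auto
  have gc: "continuous_on UNIV g"
    using g(1) by (auto intro!: continuous_at_imp_continuous_on DERIV_isCont)
  obtain k where k: "\<And>x. (k has_real_derivative (g (x + \<eta>) - g x) / \<eta>) (at x)"
      "\<And>x. \<exists>y. \<bar>y - x\<bar> \<le> \<eta> \<and> k x = g y"
    using avg[OF gc] by auto
  define k' where "k' x = (g (x + \<eta>) - g x) / \<eta>" for x
  have kc: "continuous_on UNIV k"
    using k(1) by (auto intro!: continuous_at_imp_continuous_on DERIV_isCont)
  have k'c: "continuous_on UNIV k'"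
    unfolding k'_def using \<eta> by (intro continuous_intros continuous_on_compose2[OF gc]) auto
  have gI: "g x \<in> {a..b}" for x using g(2)[of x] I by metis
  have kf: "\<exists>y. \<bar>y - x\<bar> \<le> 2 * \<eta> \<and> k x = f y" for x
  proof -
    obtain y where y: "\<bar>y - x\<bar> \<le> \<eta>" "k x = g y" using k(2) by blast
    obtain y' where "\<bar>y' - y\<bar> \<le> \<eta>" "g y = f y'" using g(2) by blast
    with y show ?thesis by (intro exI[of _ y']) auto
  qed
  have df: "\<bar>f x - f y\<bar> \<le> b - a" "\<bar>g x - g y\<bar> \<le> b - a" for x y
    using I[of x] I[of y] gI[of x] gI[of y] by auto
  have glip: "\<bar>g (x + y) - g x\<bar> \<le> (b - a) / \<eta> * \<bar>y\<bar>" for x y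
  proof -
    have *: "\<bar>g v - g u\<bar> \<le> (b - a) / \<eta> * \<bar>v - u\<bar>" if uv: "u < v" for u v
    proof -
      obtain w where w: "g v - g u = (v - u) * ((f (w + \<eta>) - f w) / \<eta>)"
        using MVT2[OF uv, of g "\<lambda>w. (f (w + \<eta>) - f w) / \<eta>"] g(1) by blast
      have "\<bar>(f (w + \<eta>) - f w) / \<eta>\<bar> \<le> (b - a) / \<eta>"
        using df \<eta> by (simp add: abs_divide divide_right_mono)
      then show ?thesis unfolding w abs_mult using uv
        by (subst mult.commute) (intro mult_right_mono, auto)
    qed
    show ?thesis using *[of x "x + y"] *[of "x + y" x] by (cases y "0::real" rule: linorder_cases) auto
  qed
  \<comment> \<open>The first summand bounds \<open>k'\<close>; the second is a Lipschitz constant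
    of \<open>k'\<close>, namely twice that of \<open>g\<close> divided by the window
    length.\<close>
  define L where "L = (b - a) / \<eta> + 2 * ((b - a) / \<eta>) / \<eta>"
  have ba: "b - a \<ge> 0" using df(1)[of 0 0] by simp
  have "smooth_map L k k'"
    unfolding smooth_map_def
  proof (intro conjI allI)
    show "k \<in> borel_measurable borel" "k' \<in> borel_measurable borel"
      using kc k'c by (auto intro: borel_measurable_continuous_onI)
    fix x
    have "\<bar>k' x\<bar> \<le> (b - a) / \<eta>"
      unfolding k'_def using df \<eta> by (simp add: abs_divide divide_right_mono)
    also have "\<dots> \<le> L" using ba \<eta> by (simp add: L_def)
    finally show "\<bar>k' x\<bar> \<le> L" .
    have k'lip: "\<bar>k' (x + y) - k' x\<bar> \<le> 2 * ((b - a) / \<eta>) / \<eta> * \<bar>y\<bar>" for x y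
    proof -
      have "k' (x + y) - k' x = ((g (x + \<eta> + y) - g (x + \<eta>)) - (g (x + y) - g x)) / \<eta>"
        by (simp add: k'_def diff_divide_distrib add_ac)
      also have "\<bar>\<dots>\<bar> \<le> (2 * ((b - a) / \<eta> * \<bar>y\<bar>)) / \<eta>"
        unfolding abs_divide using glip[of "x + \<eta>" y] glip[of x y] \<eta>
        by (simp only: abs_of_pos) (intro divide_right_mono, linarith, simp)
      finally show ?thesis by (simp add: algebra_simps)
    qed
    fix y
    show "\<bar>k (x + y) - k x - k' x * y\<bar> \<le> L * y\<^sup>2"
    proof (cases "y = 0")
      case False
      have "\<exists>w. \<bar>w\<bar> \<le> \<bar>y\<bar> \<and> k (x + y) - k x = y * k' (x + w)"
      proof (cases "y > 0")
        case True
        then obtain w where "x < w" "w < x + y" "k (x + y) - k x = (x + y - x) * k' w"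
          using MVT2[of x "x + y" k k'] k(1) by (auto simp: k'_def)
        then show ?thesis by (intro exI[of _ "w - x"]) auto
      next
        case f: False
        then obtain w where "x + y < w" "w < x" "k x - k (x + y) = (x - (x + y)) * k' w"
          using MVT2[of "x + y" x k k'] k(1) False by (auto simp: k'_def)
        then show ?thesis by (intro exI[of _ "w - x"]) auto
      qed
      then obtain w where w: "\<bar>w\<bar> \<le> \<bar>y\<bar>" "k (x + y) - k x = y * k' (x + w)" by blast
      have "\<bar>k (x + y) - k x - k' x * y\<bar> = \<bar>k' (x + w) - k' x\<bar> * \<bar>y\<bar>"
        unfolding w(2) by (simp add: abs_mult[symmetric] algebra_simps)
      also have "\<dots> \<le> (2 * ((b - a) / \<eta>) / \<eta> * \<bar>y\<bar>) * \<bar>y\<bar>"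
        using ba \<eta> w(1) by (intro mult_right_mono order_trans[OF k'lip] mult_left_mono) auto
      also have "\<dots> = 2 * ((b - a) / \<eta>) / \<eta> * y\<^sup>2" by (simp add: power2_eq_square)
      also have "\<dots> \<le> L * y\<^sup>2" using ba \<eta> by (intro mult_right_mono) (auto simp: L_def)
      finally show ?thesis .
    qed simp
  qed
  moreover have "k x \<in> {a..b}" for x using kf[of x] I by metis
  ultimately show ?thesis using kf by blast
qed

text \<open>A Lebesgue measurable function is an almost everywhere limit of continuous ones.
  Clamping these to \<open>{a..b}\<close> keeps continuity and does not move the limit, whose values
  already lie there.\<close>

lemma borel_measurable_continuous_approximation:
  fixes f :: "real \<Rightarrow> real"
  assumes "f \<in> borel_measurable borel" and I: "\<And>x. f x \<in> {a..b}"
  obtains g where "\<And>m::nat. continuous_on UNIV (g m)" "\<And>m x. g m x \<in> {a..b}"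
    "AE x in lborel. (\<lambda>m. g m x) \<longlonglongrightarrow> f x"
proof -
  have "f \<in> borel_measurable (lebesgue_on UNIV)"
    unfolding lebesgue_on_UNIV_eq by (rule measurable_completion) (use assms(1) in simp)
  then have "f measurable_on UNIV"
    using measurable_on_iff_borel_measurable[of UNIV f] by simp
  then obtain N g where N: "negligible N" "\<And>m::nat. continuous_on UNIV (g m)"
    "\<And>x. x \<notin> N \<Longrightarrow> (\<lambda>m. g m x) \<longlonglongrightarrow> f x"
    unfolding measurable_on_def by auto
  show ?thesis
  proof (rule that[of "\<lambda>m x. max a (min b (g m x))"])
    show "continuous_on UNIV (\<lambda>x. max a (min b (g m x)))" for m
      by (intro continuous_intros N)
    show "max a (min b (g m x)) \<in> {a..b}" for m x using I[of x] by auto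
    have "(\<lambda>m. max a (min b (g m x))) \<longlonglongrightarrow> f x" if "x \<notin> N" for x
    proof -
      have "(\<lambda>m. max a (min b (g m x))) \<longlonglongrightarrow> max a (min b (f x))"
        by (intro tendsto_intros N that)
      then show ?thesis using I[of x] by (simp add: max_def min_def split: if_splits)
    qed
    moreover have "AE x in lebesgue. x \<notin> N"
      using N(1) by (auto simp: negligible_iff_null_sets intro: AE_not_in)
    then have "AE x in lborel. x \<notin> N" by (simp add: AE_completion_iff)
    ultimately show "AE x in lborel. (\<lambda>m. max a (min b (g m x))) \<longlonglongrightarrow> f x" by (auto elim: AE_mp)
  qed
qed

section \<open>Iterating the step and passing to measurable functions\<close>

context gaussian_jensen begin

lemma integral_lin:
  assumes [measurable]: "F \<in> borel_measurable borel" and "\<And>x. \<bar>F x\<bar> \<le> B'"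
  shows "(\<integral>w. F (lin i w) \<partial>gamma2) = (\<integral>t. (F (sqrt ((c$i)\<^sup>2 + (d$i)\<^sup>2) * t) :: real) \<partial>gamma1)"
proof -
  have "(\<integral>w. F (lin i w) \<partial>gamma2) = (\<integral>x. (\<integral>z. F (c$i * x + d$i * z) \<partial>gamma1) \<partial>gamma1)"
    by (subst gamma1_pair.integral_fst'[symmetric])
       (use assms in \<open>auto intro!: integrable_gamma2_bounded simp: lin_def\<close>)
  also have "\<dots> = (\<integral>t. F (sqrt ((c$i)\<^sup>2 + (d$i)\<^sup>2) * t) \<partial>gamma1)"
    by (rule gamma1_convolution) (use assms in auto)
  finally show ?thesis .
qed

text \<open>Since \<open>c$i\<close> is nonzero, \<open>lin i\<close> is Gaussian with positive
  variance. Its law has a Lebesgue density, so Lebesgue null sets do not matter.\<close>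

lemma AE_lin:
  assumes "AE t in lborel. P t"
  shows "AE w in gamma2. P (lin i w)"
proof -
  have pos: "(c$i)\<^sup>2 + (d$i)\<^sup>2 > 0" using c_nz[of i] by (simp add: sum_power2_gt_zero_iff)
  have "distr gamma2 borel (lin i) = distr gamma2 borel (\<lambda>(x, z). c$i * x + d$i * z)"
    by (rule distr_cong) (auto simp: lin_def split_beta)
  also have "\<dots> = distr gamma1 borel (\<lambda>z. 0 + sqrt ((c$i)\<^sup>2 + (d$i)\<^sup>2) * z)"
    unfolding distr_pair_gamma1 by simp
  also have "\<dots> = density lborel (normal_density 0 (sqrt ((c$i)\<^sup>2 + (d$i)\<^sup>2)))"
    by (rule distr_gamma1_affine) (use pos in simp)
  finally have eq: "distr gamma2 borel (lin i) = density lborel (normal_density 0 (sqrt ((c$i)\<^sup>2 + (d$i)\<^sup>2)))" .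
  have "AE t in distr gamma2 borel (lin i). P t"
    unfolding eq by (subst AE_density) (use assms in auto)
  then show ?thesis by (rule AE_distrD[rotated]) measurable
qed

text \<open>Induction on the number of steps, for all functions at once. The last step is absorbed
  by replacing each \<open>f i\<close> with its Gaussian average \<open>g i\<close>; this has the
  same constant \<open>L\<close> and the same range, so the same \<open>h0\<close> still serves. The
  induction hypothesis for \<open>g\<close> and the short step for \<open>f\<close>, applied at the
  random point reached by then, add their errors.\<close>

lemma iterated_step:
  assumes L: "L \<ge> 0" and e: "e > 0"
  obtains h0 where "h0 > 0" "\<And>h f f' x m. \<lbrakk>0 < h; h < h0; \<And>i. smooth_map L (f i) (f' i);
      \<And>i t. f i t \<in> {l$i..u$i}\<rbrakk> \<Longrightarrow>
    Psi (\<chi> i. \<integral>w. f i (x$i + sqrt (real m * h) * lin i w) \<partial>gamma2) - real m * (e * h)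
      \<le> (\<integral>w. Psi (\<chi> i. f i (x$i + sqrt (real m * h) * lin i w)) \<partial>gamma2)"
proof -
  obtain h0 where h0: "h0 > 0" and h0_ineq: "\<And>h f f' x. \<lbrakk>0 < h; h < h0; \<And>i. smooth_map L (f i) (f' i);
    \<And>i t. f i t \<in> {l$i..u$i}\<rbrakk> \<Longrightarrow>
    Psi (\<chi> i. \<integral>w. f i (x$i + sqrt h * lin i w) \<partial>gamma2) - e * h
      \<le> (\<integral>w. Psi (\<chi> i. f i (x$i + sqrt h * lin i w)) \<partial>gamma2)"
    by (rule small_gaussian_step[OF L e]) blast
  obtain C where C: "C \<ge> 0" "\<And>p. p \<in> cbox l u \<Longrightarrow> \<bar>Psi p\<bar> \<le> C" by (rule Psi_bounded) blast
  show thesis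
  proof (rule that[OF h0])
    fix h f f' x m
    assume h: "0 < h" "h < h0" and "\<And>i. smooth_map L (f i) (f' i)" "\<And>i t. f i t \<in> {l$i..u$i}"
    then show "Psi (\<chi> i. \<integral>w. f i (x$i + sqrt (real m * h) * lin i w) \<partial>gamma2) - real m * (e * h)
      \<le> (\<integral>w. Psi (\<chi> i. f i (x$i + sqrt (real m * h) * lin i w)) \<partial>gamma2)"
    proof (induction m arbitrary: f f')
      case 0
      show ?case by (simp add: gamma1_pair.prob_space[simplified])
    next
      case (Suc m)
      note sm = Suc.prems(3) and fI = Suc.prems(4)
      have [measurable]: "f i \<in> borel_measurable borel" "f' i \<in> borel_measurable borel" for i
        using sm by (auto simp: smooth_map_def)
      define s where "s = sqrt (real m * h)"
      define t where "t = sqrt h"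
      have r: "sqrt (s\<^sup>2 + t\<^sup>2) = sqrt (real (Suc m) * h)" using h by (simp add: s_def t_def algebra_simps)
      have lin2: "lin i (s * fst w + t * fst w', s * snd w + t * snd w') = s * lin i w + t * lin i w'" for i w w'
        by (simp add: lin_def algebra_simps)
      have linr: "lin i (r * fst w, r * snd w) = r * lin i w" for i w r
        by (simp add: lin_def algebra_simps)
      define g where "g i y = (\<integral>w. f i (y + t * lin i w) \<partial>gamma2)" for i y
      define g' where "g' i y = (\<integral>w. f' i (y + t * lin i w) \<partial>gamma2)" for i y
      have [measurable]: "g i \<in> borel_measurable borel" "g' i \<in> borel_measurable borel" for i
        unfolding g_def[abs_def] g'_def[abs_def] by measurable
      have f'b: "\<bar>f' i y\<bar> \<le> L" for i y using sm by (simp add: smooth_map_def)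
      have fint: "integrable gamma2 (\<lambda>w. f i (y + t * lin i w))" for i y
        using fI by (intro integrable_interval[where a="l$i" and b="u$i"])
          (auto intro: gamma1_pair.finite_measure_axioms simp del: atLeastAtMost_iff)
      have f'int: "integrable gamma2 (\<lambda>w. f' i (y + t * lin i w))" for i y
        by (rule integrable_gamma2_bounded[where B=L]) (auto intro: f'b)
      have int_le: "\<bar>\<integral>w. F w \<partial>gamma2\<bar> \<le> K" if "integrable gamma2 F" "\<And>w. \<bar>F w\<bar> \<le> K" for F and K :: real
      proof -
        have "\<bar>\<integral>w. F w \<partial>gamma2\<bar> \<le> (\<integral>w. K \<partial>gamma2)"
          using that by (intro order_trans[OF integral_abs_bound] integral_mono) auto
        then show ?thesis by (simp add: gamma1_pair.prob_space[simplified])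
      qed
      have gsm: "smooth_map L (g i) (g' i)" for i
        unfolding smooth_map_def
      proof (intro conjI allI)
        show "\<bar>g' i y\<bar> \<le> L" for y unfolding g'_def by (intro int_le f'int f'b)
        show "\<bar>g i (y + z) - g i y - g' i y * z\<bar> \<le> L * z\<^sup>2" for y z
        proof -
          have "g i (y + z) - g i y - g' i y * z
            = (\<integral>w. f i (y + t * lin i w + z) - f i (y + t * lin i w) - f' i (y + t * lin i w) * z \<partial>gamma2)"
            unfolding g_def g'_def using fint[of i "y + z"] fint[of i y] f'int[of i y] by (simp add: add_ac)
          also have "\<bar>\<dots>\<bar> \<le> L * z\<^sup>2"
          proof (rule int_le)
            show "integrable gamma2 (\<lambda>w. f i (y + t * lin i w + z) - f i (y + t * lin i w) - f' i (y + t * lin i w) * z)"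
              using fint[of i "y + z"] fint[of i y] f'int[of i y] by (simp add: add_ac)
            show "\<bar>f i (y + t * lin i w + z) - f i (y + t * lin i w) - f' i (y + t * lin i w) * z\<bar> \<le> L * z\<^sup>2" for w
              using sm[of i] by (simp add: smooth_map_def)
          qed
          finally show ?thesis .
        qed
      qed measurable
      have gI: "g i y \<in> {l$i..u$i}" for i y
        unfolding g_def using fI
        by (intro integral_interval gamma1_pair.prob_space_axioms) (auto simp del: atLeastAtMost_iff)
      have cv: "(\<integral>w. g i (x$i + s * lin i w) \<partial>gamma2) = (\<integral>w. f i (x$i + sqrt (real (Suc m) * h) * lin i w) \<partial>gamma2)" for i
      proof -
        have b: "\<bar>f i y\<bar> \<le> \<bar>l$i\<bar> + \<bar>u$i\<bar>" for y using fI[of i y] by auto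
        show ?thesis
          using gamma2_convolution[of "\<lambda>w. f i (x$i + lin i w)" _ s t, OF _ b]
          unfolding g_def r lin2 linr by (simp add: add_ac)
      qed
      have fbox: "(\<chi> i. f i (y i)) \<in> cbox l u" for y using fI by (simp add: mem_cbox_iff)
      have Pm: "(\<lambda>w. Psi (\<chi> i. f i (x$i + lin i w))) \<in> borel_measurable gamma2"
        using fI by (intro measurable_Psi) (auto simp del: atLeastAtMost_iff)
      have cvP: "(\<integral>w. (\<integral>w'. Psi (\<chi> i. f i (x$i + s * lin i w + t * lin i w')) \<partial>gamma2) \<partial>gamma2)
          = (\<integral>w. Psi (\<chi> i. f i (x$i + sqrt (real (Suc m) * h) * lin i w)) \<partial>gamma2)"
        using gamma2_convolution[of "\<lambda>w. Psi (\<chi> i. f i (x$i + lin i w))" _ s t, OF Pm C(2)[OF fbox]]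
        unfolding r lin2 linr by (simp add: add_ac)
      have "Psi (\<chi> i. \<integral>w. g i (x$i + s * lin i w) \<partial>gamma2) - real m * (e * h)
          \<le> (\<integral>w. Psi (\<chi> i. g i (x$i + s * lin i w)) \<partial>gamma2)"
        using Suc.IH[OF h gsm gI] unfolding s_def .
      moreover have "(\<integral>w. Psi (\<chi> i. g i (x$i + s * lin i w)) - e * h \<partial>gamma2)
          \<le> (\<integral>w. (\<integral>w'. Psi (\<chi> i. f i (x$i + s * lin i w + t * lin i w')) \<partial>gamma2) \<partial>gamma2)"
      proof (rule integral_mono)
        show "integrable gamma2 (\<lambda>w. Psi (\<chi> i. g i (x$i + s * lin i w)) - e * h)"
          using gI by (intro Bochner_Integration.integrable_diff integrable_Psi gamma1_pair.finite_measure_axioms)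
            (auto simp del: atLeastAtMost_iff)
        have "(\<lambda>(w, w'). Psi (\<chi> i. f i (x$i + s * lin i w + t * lin i w'))) \<in> borel_measurable (gamma2 \<Otimes>\<^sub>M gamma2)"
          unfolding split_beta using fI by (intro measurable_Psi) (auto simp del: atLeastAtMost_iff)
        then have "(\<lambda>w. \<integral>w'. Psi (\<chi> i. f i (x$i + s * lin i w + t * lin i w')) \<partial>gamma2) \<in> borel_measurable gamma2"
          by (rule gamma1_pair.borel_measurable_lebesgue_integral)
        then show "integrable gamma2 (\<lambda>w. \<integral>w'. Psi (\<chi> i. f i (x$i + s * lin i w + t * lin i w')) \<partial>gamma2)"
          using fI by (intro integrable_gamma2_bounded[where B=C] int_le integrable_Psi gamma1_pair.finite_measure_axioms C fbox)
            (auto simp del: atLeastAtMost_iff)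
        show "Psi (\<chi> i. g i (x$i + s * lin i w)) - e * h
          \<le> (\<integral>w'. Psi (\<chi> i. f i (x$i + s * lin i w + t * lin i w')) \<partial>gamma2)" for w
          using h0_ineq[OF h sm fI, of "\<chi> i. x$i + s * lin i w"] unfolding g_def t_def by simp
      qed
      moreover have "(\<integral>w. Psi (\<chi> i. g i (x$i + s * lin i w)) - e * h \<partial>gamma2)
          = (\<integral>w. Psi (\<chi> i. g i (x$i + s * lin i w)) \<partial>gamma2) - e * h"
      proof -
        have "integrable gamma2 (\<lambda>w. Psi (\<chi> i. g i (x$i + s * lin i w)))"
          using gI by (intro integrable_Psi gamma1_pair.finite_measure_axioms)
            (auto simp del: atLeastAtMost_iff)
        then show ?thesis by (simp add: gamma1_pair.prob_space[simplified])
      qed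
      ultimately show "Psi (\<chi> i. \<integral>w. f i (x$i + sqrt (real (Suc m) * h) * lin i w) \<partial>gamma2) - real (Suc m) * (e * h)
        \<le> (\<integral>w. Psi (\<chi> i. f i (x$i + sqrt (real (Suc m) * h) * lin i w)) \<partial>gamma2)"
        unfolding cv cvP by (simp add: algebra_simps)
    qed
  qed
qed

text \<open>Start at 0 and make m steps of length h = 1 / m below \<open>h0\<close>: the total time
  is 1 and the m errors e * h add up to e, which is arbitrary.\<close>

lemma jensen_smooth:
  assumes sm: "\<And>i. smooth_map L (f i) (f' i)" and fI: "\<And>i t. f i t \<in> {l$i..u$i}"
  shows "Psi (\<chi> i. \<integral>w. f i (lin i w) \<partial>gamma2) \<le> (\<integral>w. Psi (\<chi> i. f i (lin i w)) \<partial>gamma2)"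
proof (rule field_le_epsilon)
  fix e :: real assume e: "e > 0"
  have L: "L \<ge> 0" using sm[of undefined] abs_ge_zero order_trans unfolding smooth_map_def by blast
  obtain h0 where h0: "h0 > 0" and it: "\<And>h m. 0 < h \<Longrightarrow> h < h0 \<Longrightarrow>
    Psi (\<chi> i. \<integral>w. f i (0$i + sqrt (real m * h) * lin i w) \<partial>gamma2) - real m * (e * h)
      \<le> (\<integral>w. Psi (\<chi> i. f i (0$i + sqrt (real m * h) * lin i w)) \<partial>gamma2)"
  proof (rule iterated_step[OF L e])
    fix h0
    assume "h0 > 0" and *: "\<And>h f f' x m. \<lbrakk>0 < h; h < h0; \<And>i. smooth_map L (f i) (f' i);
      \<And>i t. f i t \<in> {l$i..u$i}\<rbrakk> \<Longrightarrow>
    Psi (\<chi> i. \<integral>w. f i (x$i + sqrt (real m * h) * lin i w) \<partial>gamma2) - real m * (e * h)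
      \<le> (\<integral>w. Psi (\<chi> i. f i (x$i + sqrt (real m * h) * lin i w)) \<partial>gamma2)"
    show thesis by (rule that[OF \<open>h0 > 0\<close> *[OF _ _ sm fI]])
  qed
  obtain m :: nat where m: "m > 0" "inverse (real m) < h0" using ex_inverse_of_nat_less[OF h0] by blast
  have "real m * (e * inverse (real m)) = e" using m by simp
  with it[of "inverse (real m)" m] m
  have "Psi (\<chi> i. \<integral>w. f i (lin i w) \<partial>gamma2) - e \<le> (\<integral>w. Psi (\<chi> i. f i (lin i w)) \<partial>gamma2)"
    by (simp del: mult_eq_0_iff)
  then show "Psi (\<chi> i. \<integral>w. f i (lin i w) \<partial>gamma2) \<le> (\<integral>w. Psi (\<chi> i. f i (lin i w)) \<partial>gamma2) + e"
    by linarith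
qed

text \<open>Both sides pass to the limit by dominated convergence: all values lie in the compact
  box, on which \<open>Psi\<close> is continuous and bounded. Almost everywhere convergence on the
  line suffices because of \<open>AE_lin\<close>.\<close>

lemma jensen_limit:
  assumes [measurable]: "\<And>m i. g m i \<in> borel_measurable borel" "\<And>i. f i \<in> borel_measurable borel"
    and gI: "\<And>m i t. g (m::nat) i t \<in> {l$i..u$i}" and fI: "\<And>i t. f i t \<in> {l$i..u$i}"
    and lim: "\<And>i. AE t in lborel. (\<lambda>m. g m i t) \<longlonglongrightarrow> f i t"
    and ineq: "\<And>m. Psi (\<chi> i. \<integral>w. g m i (lin i w) \<partial>gamma2) \<le> (\<integral>w. Psi (\<chi> i. g m i (lin i w)) \<partial>gamma2)"
  shows "Psi (\<chi> i. \<integral>w. f i (lin i w) \<partial>gamma2) \<le> (\<integral>w. Psi (\<chi> i. f i (lin i w)) \<partial>gamma2)"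
proof (rule LIMSEQ_le)
  obtain C where C: "C \<ge> 0" "\<And>p. p \<in> cbox l u \<Longrightarrow> \<bar>Psi p\<bar> \<le> C" using Psi_bounded by metis
  have lim': "AE w in gamma2. (\<lambda>m. g m i (lin i w)) \<longlonglongrightarrow> f i (lin i w)" for i
    by (rule AE_lin[OF lim])
  have Psi_lim: "(\<lambda>m. Psi (a m)) \<longlonglongrightarrow> Psi b"
    if "\<And>m. a m \<in> cbox l u" "b \<in> cbox l u" "a \<longlonglongrightarrow> b" for a b
    using continuous_on_tendsto_compose[OF cont that(3,2)] that(1) by simp
  show "(\<lambda>m. Psi (\<chi> i. \<integral>w. g m i (lin i w) \<partial>gamma2)) \<longlonglongrightarrow> Psi (\<chi> i. \<integral>w. f i (lin i w) \<partial>gamma2)"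
  proof (rule Psi_lim)
    show "(\<chi> i. \<integral>w. g m i (lin i w) \<partial>gamma2) \<in> cbox l u" "(\<chi> i. \<integral>w. f i (lin i w) \<partial>gamma2) \<in> cbox l u" for m
      using gI fI by (auto simp: mem_cbox_iff simp del: atLeastAtMost_iff intro!: integral_interval gamma1_pair.prob_space_axioms)
    show "(\<lambda>m. \<chi> i. \<integral>w. g m i (lin i w) \<partial>gamma2) \<longlonglongrightarrow> (\<chi> i. \<integral>w. f i (lin i w) \<partial>gamma2)"
    proof (rule vec_tendstoI, simp)
      fix i
      show "(\<lambda>m. \<integral>w. g m i (lin i w) \<partial>gamma2) \<longlonglongrightarrow> (\<integral>w. f i (lin i w) \<partial>gamma2)"
      proof (rule integral_dominated_convergence[where w="\<lambda>_. \<bar>l$i\<bar> + \<bar>u$i\<bar>"])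
        show "AE w in gamma2. norm (g m i (lin i w)) \<le> \<bar>l$i\<bar> + \<bar>u$i\<bar>" for m
          using gI[of m i] by (intro AE_I2) (simp, smt (verit))
      qed (auto intro: lim')
    qed
  qed
  show "(\<lambda>m. \<integral>w. Psi (\<chi> i. g m i (lin i w)) \<partial>gamma2) \<longlonglongrightarrow> (\<integral>w. Psi (\<chi> i. f i (lin i w)) \<partial>gamma2)"
  proof (rule integral_dominated_convergence[where w="\<lambda>_. C"])
    show "(\<lambda>w. Psi (\<chi> i. f i (lin i w))) \<in> borel_measurable gamma2"
      "\<And>m. (\<lambda>w. Psi (\<chi> i. g m i (lin i w))) \<in> borel_measurable gamma2"
      using gI fI by (auto intro!: measurable_Psi simp del: atLeastAtMost_iff)
    show "AE w in gamma2. norm (Psi (\<chi> i. g m i (lin i w))) \<le> C" for m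
      using gI by (auto intro!: AE_I2 C simp: mem_cbox_iff simp del: atLeastAtMost_iff)
    have "AE w in gamma2. \<forall>i\<in>UNIV. (\<lambda>m. g m i (lin i w)) \<longlonglongrightarrow> f i (lin i w)"
      by (rule AE_finite_allI) (auto intro: lim')
    then show "AE w in gamma2. (\<lambda>m. Psi (\<chi> i. g m i (lin i w))) \<longlonglongrightarrow> Psi (\<chi> i. f i (lin i w))"
    proof (rule AE_mp, intro AE_I2 impI)
      fix w assume "\<forall>i\<in>UNIV. (\<lambda>m. g m i (lin i w)) \<longlonglongrightarrow> f i (lin i w)"
      then show "(\<lambda>m. Psi (\<chi> i. g m i (lin i w))) \<longlonglongrightarrow> Psi (\<chi> i. f i (lin i w))"
        using gI fI by (intro Psi_lim vec_tendstoI) (auto simp: mem_cbox_iff simp del: atLeastAtMost_iff)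
    qed
  qed simp
  show "\<exists>N. \<forall>m\<ge>N. Psi (\<chi> i. \<integral>w. g m i (lin i w) \<partial>gamma2) \<le> (\<integral>w. Psi (\<chi> i. g m i (lin i w)) \<partial>gamma2)"
    using ineq by blast
qed

text \<open>With averaging windows of length 1 / (m + 1), the approximant at \<open>t\<close> is a
  value of \<open>f i\<close> at a point within 2 / (m + 1) of \<open>t\<close>, so continuity gives
  convergence at every point.\<close>

lemma jensen_continuous:
  assumes fc: "\<And>i. continuous_on UNIV (f i)" and fI: "\<And>i t. f i t \<in> {l$i..u$i}"
  shows "Psi (\<chi> i. \<integral>w. f i (lin i w) \<partial>gamma2) \<le> (\<integral>w. Psi (\<chi> i. f i (lin i w)) \<partial>gamma2)"
proof -
  define P where "P m i g \<longleftrightarrow> (\<exists>g' L. smooth_map L g g') \<and> (\<forall>x. g x \<in> {l$i..u$i}) \<and>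
      (\<forall>x. \<exists>y. \<bar>y - x\<bar> \<le> 2 * inverse (real (Suc m)) \<and> g x = f i y)" for m :: nat and i g
  have "\<exists>g. P m i g" for m i
    using smooth_approximation[OF fc fI, of "inverse (real (Suc m))" i] unfolding P_def by auto
  then obtain g where "\<And>m i. P m i (g m i)" by metis
  then have sm: "\<And>m i. \<exists>g' L. smooth_map L (g m i) g'"
    and gI: "\<And>m i x. g m i x \<in> {l$i..u$i}"
    and gf: "\<And>m i x. \<exists>y. \<bar>y - x\<bar> \<le> 2 * inverse (real (Suc m)) \<and> g m i x = f i y"
    unfolding P_def by auto
  show ?thesis
  proof (rule jensen_limit[where g=g])
    show "g m i \<in> borel_measurable borel" for m i using sm by (auto simp: smooth_map_def)
    show "f i \<in> borel_measurable borel" for i using fc by (rule borel_measurable_continuous_onI)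
    show "AE t in lborel. (\<lambda>m. g m i t) \<longlonglongrightarrow> f i t" for i
    proof (rule AE_I2)
      fix t
      obtain y where y: "\<And>m. \<bar>y m - t\<bar> \<le> 2 * inverse (real (Suc m))" "\<And>m. g m i t = f i (y m)"
        using gf[of t _ i] by metis
      have "(\<lambda>m. y m - t) \<longlonglongrightarrow> 0"
      proof (rule Lim_null_comparison)
        show "\<forall>\<^sub>F m in sequentially. norm (y m - t) \<le> 2 * inverse (real (Suc m))" using y by simp
        show "(\<lambda>m. 2 * inverse (real (Suc m))) \<longlonglongrightarrow> 0"
          using tendsto_mult[OF tendsto_const LIMSEQ_inverse_real_of_nat, of 2] by simp
      qed
      then have "y \<longlonglongrightarrow> t" by (rule LIM_zero_cancel)
      then show "(\<lambda>m. g m i t) \<longlonglongrightarrow> f i t"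
        unfolding y(2) using continuous_on_tendsto_compose[OF fc] by simp
    qed
    show "Psi (\<chi> i. \<integral>w. g m i (lin i w) \<partial>gamma2) \<le> (\<integral>w. Psi (\<chi> i. g m i (lin i w)) \<partial>gamma2)" for m
    proof -
      obtain g' where "\<And>i. \<exists>L. smooth_map L (g m i) (g' i)" using sm by metis
      then obtain L where L: "\<And>i. smooth_map (L i) (g m i) (g' i)" by metis
      \<comment> \<open>\<open>jensen_smooth\<close> wants one constant for all components; the sum
        over the finite index type dominates each of them.\<close>
      define K where "K = (\<Sum>i\<in>UNIV. \<bar>L i\<bar>)"
      have "smooth_map K (g m i) (g' i)" for i
      proof -
        have "L i \<le> \<bar>L i\<bar>" by simp
        also have "\<dots> \<le> K" unfolding K_def by (rule member_le_sum) auto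
        finally have "L i \<le> K" .
        then have "L i * y\<^sup>2 \<le> K * y\<^sup>2" for y by (intro mult_right_mono) auto
        with \<open>L i \<le> K\<close> show ?thesis
          using L[of i] unfolding smooth_map_def by (meson order_trans)
      qed
      from jensen_smooth[OF this gI] show ?thesis .
    qed
  qed (fact gI fI)+
qed

lemma jensen_1d:
  assumes fm: "\<And>i. f i \<in> borel_measurable borel" and fI: "\<And>i t. f i t \<in> {l$i..u$i}"
  shows "Psi (\<chi> i. \<integral>w. f i (lin i w) \<partial>gamma2) \<le> (\<integral>w. Psi (\<chi> i. f i (lin i w)) \<partial>gamma2)"
proof -
  have "\<exists>g. (\<forall>m::nat. continuous_on UNIV (g m)) \<and> (\<forall>m x. g m x \<in> {l$i..u$i}) \<and>
      (AE x in lborel. (\<lambda>m. g m x) \<longlonglongrightarrow> f i x)" for i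
    using borel_measurable_continuous_approximation[OF fm fI] by metis
  then obtain g where g: "\<And>i m. continuous_on UNIV (g i (m::nat))" "\<And>i m x. g i m x \<in> {l$i..u$i}"
      "\<And>i. AE x in lborel. (\<lambda>m. g i m x) \<longlonglongrightarrow> f i x"
    by metis
  show ?thesis
  proof (rule jensen_limit[where g="\<lambda>m i. g i m"])
    show "g i m \<in> borel_measurable borel" for m i using g(1) by (rule borel_measurable_continuous_onI)
    show "Psi (\<chi> i. \<integral>w. g i m (lin i w) \<partial>gamma2) \<le> (\<integral>w. Psi (\<chi> i. g i m (lin i w)) \<partial>gamma2)" for m
      by (rule jensen_continuous) (fact g)+
  qed (fact g fm fI)+
qed

end

section \<open>Product measures\<close>

lemma sets_gamma_PiM [measurable_cong]: "sets (gamma_PiM I) = sets (\<Pi>\<^sub>M i\<in>I. borel)"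
  unfolding gamma_PiM_def by (rule sets_PiM_cong) auto

lemma space_gamma_PiM: "space (gamma_PiM I) = (\<Pi>\<^sub>E i\<in>I. UNIV)"
  by (simp add: gamma_PiM_def space_PiM)

lemma prob_space_gamma_PiM: "prob_space (gamma_PiM I)"
  unfolding gamma_PiM_def by (rule prob_space_PiM) (rule prob_space_gamma1)

lemma pair_prob_spaceI: "prob_space M \<Longrightarrow> prob_space N \<Longrightarrow> pair_prob_space M N"
  by (simp add: pair_prob_space_def pair_sigma_finite_def prob_space_imp_sigma_finite)

lemma integrable_prob_bounded:
  fixes F :: "'a \<Rightarrow> real"
  assumes "prob_space M" "F \<in> borel_measurable M" "\<And>x. x \<in> space M \<Longrightarrow> \<bar>F x\<bar> \<le> B"
  shows "integrable M F"
proof -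
  interpret prob_space M by fact
  show ?thesis by (rule integrable_const_bound[where B=B]) (use assms in auto)
qed

lemma abs_integral_prob_bounded:
  fixes F :: "'a \<Rightarrow> real"
  assumes "prob_space M" "F \<in> borel_measurable M" "\<And>x. x \<in> space M \<Longrightarrow> \<bar>F x\<bar> \<le> B"
  shows "\<bar>integral\<^sup>L M F\<bar> \<le> B"
proof -
  have "F x \<in> {-B..B}" if "x \<in> space M" for x using assms(3)[OF that] by auto
  from integral_interval[OF assms(1,2) this] show ?thesis by auto
qed

lemma integral_gamma_PiM_insert:
  fixes F :: "(nat \<Rightarrow> real) \<Rightarrow> real"
  assumes "finite I" "j \<notin> I" and "F \<in> borel_measurable (gamma_PiM (insert j I))"
    and "\<And>y. y \<in> space (gamma_PiM (insert j I)) \<Longrightarrow> \<bar>F y\<bar> \<le> B"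
  shows "(\<integral>y. F y \<partial>gamma_PiM (insert j I)) = (\<integral>y. (\<integral>t. F (y(j := t)) \<partial>gamma1) \<partial>gamma_PiM I)"
proof -
  interpret product_sigma_finite "\<lambda>_::nat. gamma1"
    by (simp add: product_sigma_finite_def prob_space_imp_sigma_finite prob_space_gamma1)
  show ?thesis
    using integrable_prob_bounded[OF prob_space_gamma_PiM assms(3,4)] assms(1,2)
    unfolding gamma_PiM_def by (intro product_integral_insert) auto
qed

lemma measurable_restrict_lin:
  assumes "a \<in> M \<rightarrow>\<^sub>M gamma_PiM I" "b \<in> M \<rightarrow>\<^sub>M gamma_PiM I"
  shows "(\<lambda>p. \<lambda>j\<in>I. c * a p j + d * b p j) \<in> M \<rightarrow>\<^sub>M gamma_PiM I"
proof -
  have "(\<lambda>p. h p j) \<in> borel_measurable M" if "h \<in> M \<rightarrow>\<^sub>M gamma_PiM I" "j \<in> I" for h j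
    using measurable_compose[OF that(1), of "\<lambda>y. y j" borel] that(2)
    by (simp add: measurable_component_singleton cong: measurable_cong_sets[OF sets_gamma_PiM refl])
  with assms show ?thesis
    unfolding gamma_PiM_def
    by (intro measurable_restrict) (simp add: measurable_def[of M gamma1] measurable_def[of M borel, symmetric] del: atLeastAtMost_iff)
qed

lemma measurable_fun_upd_gamma_PiM:
  assumes "f \<in> M \<rightarrow>\<^sub>M gamma_PiM I" "h \<in> borel_measurable M"
  shows "(\<lambda>p. (f p)(j := h p)) \<in> M \<rightarrow>\<^sub>M gamma_PiM (insert j I)"
  using assms unfolding gamma_PiM_def by (intro measurable_fun_upd[where J=I]) auto

lemma measurable_integral_prob:
  fixes f :: "'a \<Rightarrow> 'b \<Rightarrow> real"
  assumes "prob_space M" "(\<lambda>p. f (fst p) (snd p)) \<in> borel_measurable (N \<Otimes>\<^sub>M M)"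
  shows "(\<lambda>x. \<integral>y. f x y \<partial>M) \<in> borel_measurable N"
proof -
  interpret prob_space M by fact
  show ?thesis using assms(2) by (intro borel_measurable_lebesgue_integral) (simp add: split_beta)
qed

lemma Fubini_prob_bounded:
  fixes f :: "'a \<Rightarrow> 'b \<Rightarrow> real"
  assumes "prob_space M" "prob_space N" "(\<lambda>p. f (fst p) (snd p)) \<in> borel_measurable (M \<Otimes>\<^sub>M N)"
    and "\<And>x y. x \<in> space M \<Longrightarrow> y \<in> space N \<Longrightarrow> \<bar>f x y\<bar> \<le> B"
  shows "(\<integral>y. (\<integral>x. f x y \<partial>M) \<partial>N) = (\<integral>x. (\<integral>y. f x y \<partial>N) \<partial>M)"
proof -
  interpret pair_prob_space M N by (rule pair_prob_spaceI) fact+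
  have "integrable (M \<Otimes>\<^sub>M N) (\<lambda>p. f (fst p) (snd p))"
    using assms by (intro integrable_prob_bounded[where B=B] prob_space_axioms) (auto simp: space_pair_measure)
  then show ?thesis by (intro Fubini_integral) (simp add: case_prod_unfold)
qed

context gaussian_jensen begin

text \<open>The standard deviation of \<open>c$i * x + d$i * z\<close>. Each component has a mean
  that depends on its own law only, so one Gaussian vector scaled by \<open>sd i\<close> describes
  all the means on the left of \<open>jensen\<close>.\<close>

definition sd :: "'i \<Rightarrow> real" where
  "sd i = sqrt ((c$i)\<^sup>2 + (d$i)\<^sup>2)"

lemma measurable_Psi_lin:
  assumes "\<And>i. f i \<in> borel_measurable (gamma_PiM I)"
    and "\<And>i y. y \<in> space (gamma_PiM I) \<Longrightarrow> f i y \<in> {l$i..u$i}"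
    and "x \<in> M \<rightarrow>\<^sub>M gamma_PiM I" "z \<in> M \<rightarrow>\<^sub>M gamma_PiM I"
  shows "(\<lambda>p. Psi (\<chi> i. f i (\<lambda>k\<in>I. c$i * x p k + d$i * z p k))) \<in> borel_measurable M"
proof (rule measurable_Psi)
  show "(\<lambda>p. f i (\<lambda>k\<in>I. c$i * x p k + d$i * z p k)) \<in> borel_measurable M" for i
    by (rule measurable_compose[OF measurable_restrict_lin[OF assms(3,4)] assms(1)])
  show "f i (\<lambda>k\<in>I. c$i * x p k + d$i * z p k) \<in> {l$i..u$i}" for i p
    by (rule assms(2)) (simp add: space_gamma_PiM)
qed

text \<open>With all coordinates but \<open>j\<close> frozen, \<open>jensen_1d\<close> bounds
  \<open>Psi\<close> of the functions averaged over coordinate \<open>j\<close> by the average of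
  \<open>Psi\<close> over that coordinate. The averaged functions are measurable on the remaining
  coordinates and keep their ranges, so the induction hypothesis applies to them. What is left is
  Fubini, with \<open>Psi\<close> bounded.\<close>

theorem jensen:
  assumes "finite I"
    and "\<And>i. f i \<in> borel_measurable (gamma_PiM I)"
    and "\<And>i y. y \<in> space (gamma_PiM I) \<Longrightarrow> f i y \<in> {l$i..u$i}"
  shows "Psi (\<chi> i. \<integral>y. f i (\<lambda>j\<in>I. sd i * y j) \<partial>gamma_PiM I)
    \<le> (\<integral>x. (\<integral>z. Psi (\<chi> i. f i (\<lambda>j\<in>I. c$i * x j + d$i * z j)) \<partial>gamma_PiM I) \<partial>gamma_PiM I)"
  using assms
proof (induction I arbitrary: f rule: finite_induct)
  case empty
  interpret E: prob_space "gamma_PiM {}" by (rule prob_space_gamma_PiM)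
  show ?case by (simp add: E.prob_space)
next
  case (insert j I)
  note fI = insert.prems(2)
  let ?G = "gamma_PiM I" and ?G' = "gamma_PiM (insert j I)"
  obtain C where C: "C \<ge> 0" "\<And>p. p \<in> cbox l u \<Longrightarrow> \<bar>Psi p\<bar> \<le> C" by (rule Psi_bounded) blast
  note prob = prob_space_gamma_PiM prob_space_gamma1
  define X where "X i x z = (\<lambda>k\<in>I. c$i * x k + d$i * z k)" for i and x z :: "nat \<Rightarrow> real"
  define S where "S x z = Psi (\<chi> i. f i (\<lambda>k\<in>insert j I. c$i * x k + d$i * z k))" for x z :: "nat \<Rightarrow> real"
  have S: "S (x(j := s)) (z(j := t)) = Psi (\<chi> i. f i ((X i x z)(j := lin i (s, t))))" for x z s t
  proof -
    have "(\<lambda>k\<in>insert j I. c$i * (x(j := s)) k + d$i * (z(j := t)) k) = (X i x z)(j := lin i (s, t))" for i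
      using insert.hyps by (auto simp: X_def lin_def restrict_def)
    then show ?thesis unfolding S_def by simp
  qed
  have Xsp: "X i x z \<in> space ?G" for i x z by (simp add: X_def space_gamma_PiM)
  have usp: "y(j := t) \<in> space ?G'" if "y \<in> space ?G" for y t
    using that by (auto simp: space_gamma_PiM PiE_iff extensional_def)
  have rsp: "(\<lambda>k\<in>J. h k) \<in> space (gamma_PiM J)" for J and h :: "nat \<Rightarrow> real" by (simp add: space_gamma_PiM)
  have Sb: "\<bar>S x z\<bar> \<le> C" for x z
    unfolding S_def by (intro C) (simp add: mem_cbox_iff fI[OF rsp] del: atLeastAtMost_iff)
  define SS where "SS x z = (\<integral>s. (\<integral>t. S (x(j := s)) (z(j := t)) \<partial>gamma1) \<partial>gamma1)" for x z
  \<comment> \<open>The average over coordinate \<open>j\<close> of both Gaussian vectors: since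
    \<open>lin i\<close> has the law of \<open>sd i * t\<close>, one variable is enough, and
    \<open>g\<close> does not depend on where the other coordinates come from.\<close>
  define g where "g i y = (\<integral>t. f i (y(j := sd i * t)) \<partial>gamma1)" for i y
  have gm: "g i \<in> borel_measurable ?G" for i
    unfolding g_def[abs_def]
    by (intro measurable_integral_prob prob measurable_compose[OF _ insert.prems(1)] measurable_fun_upd_gamma_PiM) auto
  have fm: "(\<lambda>t. f i (y(j := h t))) \<in> borel_measurable gamma1" if "y \<in> space ?G" "h \<in> borel_measurable borel" for i y h
    using that by (intro measurable_compose[OF _ insert.prems(1)] measurable_fun_upd_gamma_PiM) auto
  have gI: "g i y \<in> {l$i..u$i}" if "y \<in> space ?G" for i y
    unfolding g_def using that by (intro integral_interval prob fI usp fm) auto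
  have ineq: "Psi (\<chi> i. g i (X i x z)) \<le> SS x z" for x z
  proof -
    have h: "(\<lambda>t. f i ((X i x z)(j := t))) \<in> borel_measurable borel" for i
      using fm[OF Xsp, of "\<lambda>t. t"] by simp
    have hI: "f i ((X i x z)(j := t)) \<in> {l$i..u$i}" for i t by (rule fI[OF usp[OF Xsp]])
    have b: "\<bar>f i ((X i x z)(j := t))\<bar> \<le> \<bar>l$i\<bar> + \<bar>u$i\<bar>" for i t using hI[of i t] by auto
    have "(\<chi> i. g i (X i x z)) = (\<chi> i. \<integral>w. f i ((X i x z)(j := lin i w)) \<partial>gamma2)"
      unfolding g_def sd_def using integral_lin[OF h b] by simp
    also have "Psi \<dots> \<le> (\<integral>w. Psi (\<chi> i. f i ((X i x z)(j := lin i w))) \<partial>gamma2)"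
      by (rule jensen_1d[OF h hI])
    also have "\<dots> = SS x z"
      unfolding S SS_def
    proof (subst gamma1_pair.integral_fst'[symmetric])
      show "integrable gamma2 (\<lambda>w. Psi (\<chi> i. f i ((X i x z)(j := lin i w))))"
        by (intro integrable_Psi gamma1_pair.finite_measure_axioms hI measurable_compose[OF _ h] measurable_lin)
    qed simp
    finally show ?thesis .
  qed
  have XSm: "(\<lambda>p. Psi (\<chi> i. g i (X i (fst p) (snd p)))) \<in> borel_measurable (?G \<Otimes>\<^sub>M ?G)"
    unfolding X_def by (intro measurable_Psi_lin gm gI) auto
  have XSm1: "(\<lambda>z. Psi (\<chi> i. g i (X i x z))) \<in> borel_measurable ?G" if "x \<in> space ?G" for x
    unfolding X_def using that by (intro measurable_Psi_lin gm gI) auto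
  have XSb: "\<bar>Psi (\<chi> i. g i (X i x z))\<bar> \<le> C" for x z
    by (intro C) (simp add: mem_cbox_iff gI[OF Xsp] del: atLeastAtMost_iff)
  note upd = measurable_fun_upd_gamma_PiM
  \<comment> \<open>The \<open>j\<close>-th coordinates \<open>s\<close> of \<open>x\<close> and
    \<open>t\<close> of \<open>z\<close> are split off. The order x, s, z, t obtained in this way is
    then changed to x, z, s, t.\<close>
  have S_int: "(\<integral>x. (\<integral>z. S x z \<partial>?G') \<partial>?G') = (\<integral>x. (\<integral>s. (\<integral>z. S (x(j := s)) z \<partial>?G') \<partial>gamma1) \<partial>?G)"
  proof (rule integral_gamma_PiM_insert[OF insert.hyps])
    show "(\<lambda>x. \<integral>z. S x z \<partial>?G') \<in> borel_measurable ?G'"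
      unfolding S_def by (intro measurable_integral_prob prob measurable_Psi_lin insert.prems fI) auto
    show "\<bar>\<integral>z. S x z \<partial>?G'\<bar> \<le> C" if "x \<in> space ?G'" for x
      using Sb that unfolding S_def
      by (intro abs_integral_prob_bounded prob measurable_Psi_lin insert.prems fI) auto
  qed
  also have "\<dots> = (\<integral>x. (\<integral>s. (\<integral>z. (\<integral>t. S (x(j := s)) (z(j := t)) \<partial>gamma1) \<partial>?G) \<partial>gamma1) \<partial>?G)"
  proof (rule Bochner_Integration.integral_cong[OF refl], rule Bochner_Integration.integral_cong[OF refl])
    fix x s assume "x \<in> space ?G"
    then have "x(j := s) \<in> space ?G'" by (rule usp)
    then show "(\<integral>z. S (x(j := s)) z \<partial>?G') = (\<integral>z. (\<integral>t. S (x(j := s)) (z(j := t)) \<partial>gamma1) \<partial>?G)"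
      using Sb unfolding S_def
      by (intro integral_gamma_PiM_insert[OF insert.hyps] measurable_Psi_lin insert.prems fI measurable_const)
        (auto simp del: fun_upd_apply)
  qed
  also have "\<dots> = (\<integral>x. (\<integral>z. SS x z \<partial>?G) \<partial>?G)"
    unfolding SS_def
  proof (rule Bochner_Integration.integral_cong[OF refl], rule Fubini_prob_bounded[OF prob])
    fix x assume x: "x \<in> space ?G"
    show "(\<lambda>p. \<integral>t. S (x(j := snd p)) ((fst p)(j := t)) \<partial>gamma1) \<in> borel_measurable (?G \<Otimes>\<^sub>M gamma1)"
      unfolding S_def using x
      by (intro measurable_integral_prob prob measurable_Psi_lin insert.prems fI upd) auto
    show "\<bar>\<integral>t. S (x(j := s)) (z(j := t)) \<partial>gamma1\<bar> \<le> C" if "z \<in> space ?G" for z s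
      using Sb x that usp[OF x] unfolding S_def
      by (intro abs_integral_prob_bounded prob measurable_Psi_lin insert.prems fI upd) auto
  qed
  finally have eq: "(\<integral>x. (\<integral>z. S x z \<partial>?G') \<partial>?G') = (\<integral>x. (\<integral>z. SS x z \<partial>?G) \<partial>?G)" .
  have SSb: "\<bar>SS x z\<bar> \<le> C" if "x \<in> space ?G" "z \<in> space ?G" for x z
    unfolding SS_def using Sb that usp unfolding S_def
    by (intro abs_integral_prob_bounded measurable_integral_prob prob measurable_Psi_lin insert.prems fI upd) auto
  have SSm: "(\<lambda>p. SS (fst p) (snd p)) \<in> borel_measurable (?G \<Otimes>\<^sub>M ?G)"
    unfolding SS_def S_def
    by (intro measurable_integral_prob prob measurable_Psi_lin insert.prems fI upd) auto
  have SSm1: "(\<lambda>z. SS x z) \<in> borel_measurable ?G" if "x \<in> space ?G" for x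
    unfolding SS_def S_def using that
    by (intro measurable_integral_prob prob measurable_Psi_lin insert.prems fI upd) auto
  have "Psi (\<chi> i. \<integral>y. g i (\<lambda>k\<in>I. sd i * y k) \<partial>?G) \<le> (\<integral>x. (\<integral>z. Psi (\<chi> i. g i (X i x z)) \<partial>?G) \<partial>?G)"
    unfolding X_def by (rule insert.IH[OF gm gI])
  also have "\<dots> \<le> (\<integral>x. (\<integral>z. SS x z \<partial>?G) \<partial>?G)"
  proof (intro integral_mono integrable_prob_bounded[where B=C] prob ineq)
    show "(\<lambda>x. \<integral>z. Psi (\<chi> i. g i (X i x z)) \<partial>?G) \<in> borel_measurable ?G"
      by (rule measurable_integral_prob[OF prob(1) XSm])
    show "(\<lambda>x. \<integral>z. SS x z \<partial>?G) \<in> borel_measurable ?G"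
      by (rule measurable_integral_prob[OF prob(1) SSm])
    fix x assume x: "x \<in> space ?G"
    show "\<bar>\<integral>z. Psi (\<chi> i. g i (X i x z)) \<partial>?G\<bar> \<le> C" "\<bar>\<integral>z. SS x z \<partial>?G\<bar> \<le> C"
      using XSb SSb x XSm1 SSm1 by (auto intro!: abs_integral_prob_bounded prob)
  qed (use XSm1 SSm1 XSb SSb in auto)
  also have "(\<lambda>i. \<integral>y. g i (\<lambda>k\<in>I. sd i * y k) \<partial>?G) = (\<lambda>i. \<integral>y. f i (\<lambda>k\<in>insert j I. sd i * y k) \<partial>?G')"
  proof
    fix i
    have scale: "(\<lambda>y. \<lambda>k\<in>insert j I. sd i * y k) \<in> ?G' \<rightarrow>\<^sub>M ?G'"
      using measurable_restrict_lin[of "\<lambda>y. y" ?G' "insert j I" "\<lambda>y. y" "sd i" 0] by simp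
    have b: "\<bar>f i (\<lambda>k\<in>insert j I. sd i * y k)\<bar> \<le> \<bar>l$i\<bar> + \<bar>u$i\<bar>" for y
    proof -
      have *: "\<bar>v\<bar> \<le> \<bar>p\<bar> + \<bar>q\<bar>" if "v \<in> {p..q}" for v p q :: real using that by auto
      show ?thesis by (rule *[OF fI[OF rsp]])
    qed
    have "(\<lambda>k\<in>insert j I. sd i * (y(j := t)) k) = (\<lambda>k\<in>I. sd i * y k)(j := sd i * t)" for y t
      using insert.hyps by (auto simp: restrict_def)
    then show "(\<integral>y. g i (\<lambda>k\<in>I. sd i * y k) \<partial>?G) = (\<integral>y. f i (\<lambda>k\<in>insert j I. sd i * y k) \<partial>?G')"
      using integral_gamma_PiM_insert[OF insert.hyps measurable_compose[OF scale insert.prems(1)] b]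
      unfolding g_def by simp
  qed
  finally show ?case
    unfolding eq[symmetric] S_def .
qed

end

section \<open>Taylor expansion on a box\<close>

text \<open>Uniform continuity handles points at distance below r, and boundedness the others, where
  dist p q / r is at least 1. Applied to second derivatives, the two summands become the quadratic
  and the cubic error of the Taylor expansion.\<close>

lemma continuous_on_compact_affine_modulus:
  fixes F :: "'a::metric_space \<Rightarrow> real"
  assumes "continuous_on S F" "compact S" "e > 0"
  shows "\<exists>K\<ge>0. \<forall>p\<in>S. \<forall>q\<in>S. \<bar>F q - F p\<bar> \<le> e + K * dist p q"
proof -
  from compact_uniformly_continuous[OF assms(1,2)] assms(3)
  obtain r where r: "r > 0" "\<And>p q. p \<in> S \<Longrightarrow> q \<in> S \<Longrightarrow> dist q p < r \<Longrightarrow> dist (F q) (F p) < e"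
    unfolding uniformly_continuous_on_def by metis
  have "bounded (F ` S)" using assms by (intro compact_imp_bounded compact_continuous_image)
  then obtain C where C: "\<And>p. p \<in> S \<Longrightarrow> \<bar>F p\<bar> \<le> C" by (auto simp: bounded_iff)
  show ?thesis
  proof (intro exI[of _ "2 * \<bar>C\<bar> / r"] conjI ballI)
    fix p q assume pq: "p \<in> S" "q \<in> S"
    show "\<bar>F q - F p\<bar> \<le> e + 2 * \<bar>C\<bar> / r * dist p q"
    proof (cases "dist q p < r")
      case True
      then have "\<bar>F q - F p\<bar> < e" using r(2)[OF pq] by (simp add: dist_real_def)
      also have "e \<le> e + 2 * \<bar>C\<bar> / r * dist p q" using r by simp
      finally show ?thesis by simp
    next
      case False
      have "\<bar>F q - F p\<bar> \<le> 2 * \<bar>C\<bar> * 1" using C[OF pq(1)] C[OF pq(2)] by auto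
      also have "\<dots> \<le> 2 * \<bar>C\<bar> * (dist p q / r)"
        using False r by (intro mult_left_mono) (auto simp: dist_commute)
      finally show ?thesis using assms(3) by simp
    qed
  qed (use r in auto)
qed

text \<open>The endpoints may come in either order; the distance bound on \<open>\<xi>\<close> is
  what the modulus of continuity is later fed with.\<close>

lemma MVT_within:
  fixes \<phi> :: "real \<Rightarrow> real"
  assumes "\<And>t. t \<in> {l..u} \<Longrightarrow> (\<phi> has_real_derivative \<phi>' t) (at t within {l..u})"
    and "x \<in> {l..u}" "y \<in> {l..u}"
  shows "\<exists>\<xi>\<in>{l..u}. \<bar>\<xi> - x\<bar> \<le> \<bar>y - x\<bar> \<and> \<phi> y = \<phi> x + \<phi>' \<xi> * (y - x)"
proof -
  have *: "\<exists>\<xi>\<in>{a<..<b}. \<phi> b - \<phi> a = \<phi>' \<xi> * (b - a)" if "a < b" "{a..b} \<subseteq> {l..u}" for a b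
  proof (rule mvt_simple[OF that(1), where f'="\<lambda>t. (*) (\<phi>' t)"])
    fix t assume "a \<le> t" "t \<le> b"
    then have "t \<in> {a..b}" by simp
    then have "(\<phi> has_real_derivative \<phi>' t) (at t within {a..b})"
      using assms(1)[of t] that(2) by (blast intro: has_field_derivative_subset)
    then show "(\<phi> has_derivative (*) (\<phi>' t)) (at t within {a..b})"
      by (simp add: has_field_derivative_def)
  qed
  show ?thesis
  proof (cases x y rule: linorder_cases)
    case less
    with *[of x y] assms obtain \<xi> where "\<xi> \<in> {x<..<y}" "\<phi> y - \<phi> x = \<phi>' \<xi> * (y - x)" by auto
    with assms show ?thesis by (intro bexI[of _ \<xi>]) auto
  next
    case greater
    with *[of y x] assms obtain \<xi> where "\<xi> \<in> {y<..<x}" "\<phi> x - \<phi> y = \<phi>' \<xi> * (x - y)" by auto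
    with assms show ?thesis by (intro bexI[of _ \<xi>]) (auto simp: algebra_simps)
  qed (use assms in auto)
qed

text \<open>\<open>A\<close> is chosen so that \<open>\<psi>\<close> vanishes at both
  \<open>x\<close> and \<open>y\<close>. The derivative of \<open>\<psi>\<close> is (2 * A -
  \<phi>'' t) * (y - t), and the second factor is nonzero strictly between them, so the mean value
  theorem forces 2 * A = \<phi>'' \<xi>.\<close>

lemma Taylor2_within:
  fixes \<phi> :: "real \<Rightarrow> real"
  assumes d1: "\<And>t. t \<in> {l..u} \<Longrightarrow> (\<phi> has_real_derivative \<phi>' t) (at t within {l..u})"
    and d2: "\<And>t. t \<in> {l..u} \<Longrightarrow> (\<phi>' has_real_derivative \<phi>'' t) (at t within {l..u})"
    and xy: "x \<in> {l..u}" "y \<in> {l..u}"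
  shows "\<exists>\<xi>\<in>{l..u}. \<bar>\<xi> - x\<bar> \<le> \<bar>y - x\<bar> \<and> \<phi> y = \<phi> x + \<phi>' x * (y - x) + \<phi>'' \<xi> / 2 * (y - x)\<^sup>2"
proof (cases "x = y")
  case False
  define A where "A = (\<phi> y - \<phi> x - \<phi>' x * (y - x)) / (y - x)\<^sup>2"
  define \<psi> where "\<psi> t = \<phi> y - \<phi> t - \<phi>' t * (y - t) - A * (y - t)\<^sup>2" for t
  have eq: "\<psi> x = 0" "\<psi> y = 0" using False by (simp_all add: \<psi>_def A_def)
  have d: "(\<psi> has_real_derivative (2 * A - \<phi>'' t) * (y - t)) (at t within {l..u})" if "t \<in> {l..u}" for t
    unfolding \<psi>_def[abs_def] using d1[OF that] d2[OF that]
    by (auto intro!: derivative_eq_intros simp: algebra_simps)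
  have *: "\<exists>\<xi>\<in>{a<..<b}. \<psi> b - \<psi> a = (2 * A - \<phi>'' \<xi>) * (y - \<xi>) * (b - a)" if "a < b" "{a..b} \<subseteq> {l..u}" for a b
  proof (rule mvt_simple[OF that(1), where f'="\<lambda>t. (*) ((2 * A - \<phi>'' t) * (y - t))"])
    fix t assume "a \<le> t" "t \<le> b"
    then have "t \<in> {a..b}" by simp
    then have "(\<psi> has_real_derivative (2 * A - \<phi>'' t) * (y - t)) (at t within {a..b})"
      using d[of t] that(2) by (blast intro: has_field_derivative_subset)
    then show "(\<psi> has_derivative (*) ((2 * A - \<phi>'' t) * (y - t))) (at t within {a..b})"
      by (simp add: has_field_derivative_def)
  qed
  have "\<exists>\<xi>\<in>{min x y<..<max x y}. 2 * A = \<phi>'' \<xi>"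
    using *[of x y] *[of y x] xy False eq by (cases "x < y") (auto simp: min_def max_def)
  then obtain \<xi> where \<xi>: "\<xi> \<in> {min x y<..<max x y}" "2 * A = \<phi>'' \<xi>" by blast
  have "\<phi> y = \<phi> x + \<phi>' x * (y - x) + A * (y - x)\<^sup>2" using False by (simp add: A_def)
  also have "A = \<phi>'' \<xi> / 2" using \<xi>(2) by simp
  finally show ?thesis using \<xi>(1) xy
    by (intro bexI[of _ \<xi>] conjI) (auto simp: min_def max_def split: if_splits)
qed (use xy in auto)

text \<open>
  Moving along the three axes in turn uses every mixed derivative in one order only, so that the
  symmetry of the mixed derivatives is not needed.
\<close>

lemma Taylor2_box3:
  fixes P P1 P2 P3 P11 P12 P13 P22 P23 P33 :: "real \<Rightarrow> real \<Rightarrow> real \<Rightarrow> real"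
    and a1 b1 a2 b2 a3 b3 :: real
  defines "Box \<equiv> {a1..b1} \<times> {a2..b2} \<times> {a3..b3}"
  assumes d1: "\<And>u v w. (u, v, w) \<in> Box \<Longrightarrow> ((\<lambda>u. P u v w) has_real_derivative P1 u v w) (at u within {a1..b1})"
    and d2: "\<And>u v w. (u, v, w) \<in> Box \<Longrightarrow> ((\<lambda>v. P u v w) has_real_derivative P2 u v w) (at v within {a2..b2})"
    and d3: "\<And>u v w. (u, v, w) \<in> Box \<Longrightarrow> ((\<lambda>w. P u v w) has_real_derivative P3 u v w) (at w within {a3..b3})"
    and d11: "\<And>u v w. (u, v, w) \<in> Box \<Longrightarrow> ((\<lambda>u. P1 u v w) has_real_derivative P11 u v w) (at u within {a1..b1})"
    and d12: "\<And>u v w. (u, v, w) \<in> Box \<Longrightarrow> ((\<lambda>v. P1 u v w) has_real_derivative P12 u v w) (at v within {a2..b2})"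
    and d13: "\<And>u v w. (u, v, w) \<in> Box \<Longrightarrow> ((\<lambda>w. P1 u v w) has_real_derivative P13 u v w) (at w within {a3..b3})"
    and d22: "\<And>u v w. (u, v, w) \<in> Box \<Longrightarrow> ((\<lambda>v. P2 u v w) has_real_derivative P22 u v w) (at v within {a2..b2})"
    and d23: "\<And>u v w. (u, v, w) \<in> Box \<Longrightarrow> ((\<lambda>w. P2 u v w) has_real_derivative P23 u v w) (at w within {a3..b3})"
    and d33: "\<And>u v w. (u, v, w) \<in> Box \<Longrightarrow> ((\<lambda>w. P3 u v w) has_real_derivative P33 u v w) (at w within {a3..b3})"
    and cont: "\<And>F. F \<in> {P11, P12, P13, P22, P23, P33} \<Longrightarrow> continuous_on Box (\<lambda>(u, v, w). F u v w)"
    and e: "e > 0"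
  shows "\<exists>K. \<forall>u v w u' v' w'. (u, v, w) \<in> Box \<longrightarrow> (u', v', w') \<in> Box \<longrightarrow>
    (let x = u' - u; y = v' - v; z = w' - w; n = sqrt (x\<^sup>2 + y\<^sup>2 + z\<^sup>2) in
      P u v w + (P1 u v w * x + P2 u v w * y + P3 u v w * z)
      + (P11 u v w * x\<^sup>2 + P22 u v w * y\<^sup>2 + P33 u v w * z\<^sup>2
         + 2 * P12 u v w * (x * y) + 2 * P13 u v w * (x * z) + 2 * P23 u v w * (y * z)) / 2
      - e * n ^ 2 - K * n ^ 3 \<le> P u' v' w')"
proof -
  let ?Fs = "{P11, P12, P13, P22, P23, P33}"
  have cpt: "compact Box" unfolding Box_def by (intro compact_Times compact_Icc)
  \<comment> \<open>Six second derivatives are replaced by their values at the base point: the three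
    pure ones, with factor 1/2, and the three mixed ones. This costs 3/2 + 3 = 9/2 errors
    \<open>E * n\<^sup>2\<close>, which 5 covers.\<close>
  define e' where "e' = e / 5"
  have e': "e' > 0" using e by (simp add: e'_def)
  have "\<exists>K\<ge>0. \<forall>p\<in>Box. \<forall>q\<in>Box. \<bar>(\<lambda>(u, v, w). F u v w) q - (\<lambda>(u, v, w). F u v w) p\<bar> \<le> e' + K * dist p q"
    if "F \<in> ?Fs" for F
    by (rule continuous_on_compact_affine_modulus[OF cont[OF that] cpt e'])
  then obtain k where k: "\<And>F p q. F \<in> ?Fs \<Longrightarrow> p \<in> Box \<Longrightarrow> q \<in> Box \<Longrightarrow>
      \<bar>(\<lambda>(u, v, w). F u v w) q - (\<lambda>(u, v, w). F u v w) p\<bar> \<le> e' + k F * dist p q" and k0: "\<And>F. F \<in> ?Fs \<Longrightarrow> k F \<ge> 0"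
    by metis
  define K where "K = k P11 + k P12 + k P13 + k P22 + k P23 + k P33"
  have kK: "0 \<le> k F \<and> k F \<le> K" if "F \<in> ?Fs" for F
    using k0[of P11] k0[of P12] k0[of P13] k0[of P22] k0[of P23] k0[of P33] that
    by (auto simp: K_def)
  show ?thesis
    unfolding Let_def
  proof (intro exI[of _ "5 * K"] allI impI)
    fix u v w u' v' w'
    assume p: "(u, v, w) \<in> Box" and q: "(u', v', w') \<in> Box"
    define x y z where "x = u' - u" and "y = v' - v" and "z = w' - w"
    define n where "n = sqrt (x\<^sup>2 + y\<^sup>2 + z\<^sup>2)"
    have n: "n \<ge> 0" "\<bar>x\<bar> \<le> n" "\<bar>y\<bar> \<le> n" "\<bar>z\<bar> \<le> n"
      unfolding n_def by (auto intro!: real_le_rsqrt)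
    have mod: "\<bar>F r s t - F u v w\<bar> \<le> e' + K * n"
      if F: "F \<in> ?Fs" and rst: "(r, s, t) \<in> Box" "\<bar>r - u\<bar> \<le> \<bar>x\<bar>" "\<bar>s - v\<bar> \<le> \<bar>y\<bar>" "\<bar>t - w\<bar> \<le> \<bar>z\<bar>" for F r s t
    proof -
      have "dist (u, v, w) (r, s, t) = sqrt ((r - u)\<^sup>2 + (s - v)\<^sup>2 + (t - w)\<^sup>2)"
        by (simp add: dist_Pair_Pair dist_real_def power2_commute)
      also have "\<dots> \<le> n"
        unfolding n_def using rst(2-4) by (intro real_sqrt_le_mono add_mono) (auto simp: abs_le_square_iff)
      finally have d: "dist (u, v, w) (r, s, t) \<le> n" .
      have "\<bar>F r s t - F u v w\<bar> \<le> e' + k F * dist (u, v, w) (r, s, t)"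
        using k[OF F p rst(1)] by simp
      also have "k F * dist (u, v, w) (r, s, t) \<le> K * n"
        using kK[OF F] d by (intro mult_mono) auto
      finally show ?thesis by simp
    qed
    have bx: "u \<in> {a1..b1}" "v \<in> {a2..b2}" "w \<in> {a3..b3}" "u' \<in> {a1..b1}" "v' \<in> {a2..b2}" "w' \<in> {a3..b3}"
      using p q by (auto simp: Box_def)
    have mem: "(r, s, t) \<in> Box \<longleftrightarrow> r \<in> {a1..b1} \<and> s \<in> {a2..b2} \<and> t \<in> {a3..b3}" for r s t
      by (simp add: Box_def)
    obtain c1 where c1: "c1 \<in> {a1..b1}" "\<bar>c1 - u\<bar> \<le> \<bar>x\<bar>"
      "P u' v' w' = P u v' w' + P1 u v' w' * x + P11 c1 v' w' / 2 * x\<^sup>2"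
      using Taylor2_within[of a1 b1 "\<lambda>u. P u v' w'" "\<lambda>u. P1 u v' w'" "\<lambda>u. P11 u v' w'" u u'] d1 d11 bx
      unfolding mem x_def by blast
    obtain c2 where c2: "c2 \<in> {a2..b2}" "\<bar>c2 - v\<bar> \<le> \<bar>y\<bar>"
      "P u v' w' = P u v w' + P2 u v w' * y + P22 u c2 w' / 2 * y\<^sup>2"
      using Taylor2_within[of a2 b2 "\<lambda>v. P u v w'" "\<lambda>v. P2 u v w'" "\<lambda>v. P22 u v w'" v v'] d2 d22 bx
      unfolding mem y_def by blast
    obtain c3 where c3: "c3 \<in> {a3..b3}" "\<bar>c3 - w\<bar> \<le> \<bar>z\<bar>"
      "P u v w' = P u v w + P3 u v w * z + P33 u v c3 / 2 * z\<^sup>2"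
      using Taylor2_within[of a3 b3 "\<lambda>w. P u v w" "\<lambda>w. P3 u v w" "\<lambda>w. P33 u v w" w w'] d3 d33 bx
      unfolding mem z_def by blast
    \<comment> \<open>The expansions above leave \<open>P1\<close> at (u, v', w') and
      \<open>P2\<close> at (u, v, w'). Bringing them back to the base point, \<open>P1\<close>
      across two axes and \<open>P2\<close> across one, produces the three mixed terms.\<close>
    obtain c4 where c4: "c4 \<in> {a2..b2}" "\<bar>c4 - v\<bar> \<le> \<bar>y\<bar>" "P1 u v' w' = P1 u v w' + P12 u c4 w' * y"
      using MVT_within[of a2 b2 "\<lambda>v. P1 u v w'" "\<lambda>v. P12 u v w'" v v'] d12 bx
      unfolding mem y_def by blast
    obtain c5 where c5: "c5 \<in> {a3..b3}" "\<bar>c5 - w\<bar> \<le> \<bar>z\<bar>" "P1 u v w' = P1 u v w + P13 u v c5 * z"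
      using MVT_within[of a3 b3 "\<lambda>w. P1 u v w" "\<lambda>w. P13 u v w" w w'] d13 bx
      unfolding mem z_def by blast
    obtain c6 where c6: "c6 \<in> {a3..b3}" "\<bar>c6 - w\<bar> \<le> \<bar>z\<bar>" "P2 u v w' = P2 u v w + P23 u v c6 * z"
      using MVT_within[of a3 b3 "\<lambda>w. P2 u v w" "\<lambda>w. P23 u v w" w w'] d23 bx
      unfolding mem z_def by blast
    define E where "E = e' + K * n"
    have le: "\<bar>u' - u\<bar> \<le> \<bar>x\<bar>" "\<bar>v' - v\<bar> \<le> \<bar>y\<bar>" "\<bar>w' - w\<bar> \<le> \<bar>z\<bar>"
      by (simp_all add: x_def y_def z_def)
    have m1: "\<bar>P11 c1 v' w' - P11 u v w\<bar> \<le> E"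
      unfolding E_def by (rule mod) (use bx le c1(1,2) in \<open>simp_all add: mem\<close>)
    have m2: "\<bar>P22 u c2 w' - P22 u v w\<bar> \<le> E"
      unfolding E_def by (rule mod) (use bx le c2(1,2) in \<open>simp_all add: mem\<close>)
    have m3: "\<bar>P33 u v c3 - P33 u v w\<bar> \<le> E"
      unfolding E_def by (rule mod) (use bx le c3(1,2) in \<open>simp_all add: mem\<close>)
    have m4: "\<bar>P12 u c4 w' - P12 u v w\<bar> \<le> E"
      unfolding E_def by (rule mod) (use bx le c4(1,2) in \<open>simp_all add: mem\<close>)
    have m5: "\<bar>P13 u v c5 - P13 u v w\<bar> \<le> E"
      unfolding E_def by (rule mod) (use bx le c5(1,2) in \<open>simp_all add: mem\<close>)
    have m6: "\<bar>P23 u v c6 - P23 u v w\<bar> \<le> E"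
      unfolding E_def by (rule mod) (use bx le c6(1,2) in \<open>simp_all add: mem\<close>)
    have prod: "f * s \<ge> g * s - E * n\<^sup>2" if "\<bar>f - g\<bar> \<le> E" "\<bar>s\<bar> \<le> n\<^sup>2" for f g s
    proof -
      have "\<bar>(f - g) * s\<bar> \<le> E * n\<^sup>2" unfolding abs_mult using that by (intro mult_mono) auto
      then show ?thesis by (simp add: algebra_simps abs_le_iff)
    qed
    have ab: "\<bar>s * t\<bar> \<le> n * n" if "\<bar>s\<bar> \<le> n" "\<bar>t\<bar> \<le> n" for s t
      unfolding abs_mult by (intro mult_mono that n) auto
    have sz: "\<bar>x\<^sup>2\<bar> \<le> n\<^sup>2" "\<bar>y\<^sup>2\<bar> \<le> n\<^sup>2" "\<bar>z\<^sup>2\<bar> \<le> n\<^sup>2" "\<bar>x * y\<bar> \<le> n\<^sup>2" "\<bar>x * z\<bar> \<le> n\<^sup>2" "\<bar>y * z\<bar> \<le> n\<^sup>2"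
      unfolding power2_eq_square by (intro ab n)+
    have arith: "X' = X + g + (a' + b' + c') / 2 + d' + k' + f' \<Longrightarrow> 0 \<le> r \<Longrightarrow> 5 * r = s + t \<Longrightarrow>
        a - r \<le> a' \<Longrightarrow> b - r \<le> b' \<Longrightarrow> c - r \<le> c' \<Longrightarrow> d - r \<le> d' \<Longrightarrow> k - r \<le> k' \<Longrightarrow> f - r \<le> f' \<Longrightarrow>
        X + g + (a + b + c + 2 * d + 2 * k + 2 * f) / 2 - s - t \<le> X'"
      for X X' g a a' b b' c c' d d' k k' f f' r s t :: real
      by argo
    have "P u' v' w' = P u v w + (P1 u v w * x + P2 u v w * y + P3 u v w * z)
      + (P11 c1 v' w' * x\<^sup>2 + P22 u c2 w' * y\<^sup>2 + P33 u v c3 * z\<^sup>2) / 2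
      + P12 u c4 w' * (x * y) + P13 u v c5 * (x * z) + P23 u v c6 * (y * z)"
      unfolding c1(3) c2(3) c3(3) c4(3) c5(3) c6(3) by (simp add: field_simps)
    moreover have "E * n\<^sup>2 \<ge> 0" using e' n kK[of P11] by (simp add: E_def)
    moreover have "5 * (E * n\<^sup>2) = e * n ^ 2 + 5 * K * n ^ 3"
      by (simp add: E_def e'_def field_simps power2_eq_square power3_eq_cube)
    ultimately show "P u v w + (P1 u v w * (u' - u) + P2 u v w * (v' - v) + P3 u v w * (w' - w))
      + (P11 u v w * (u' - u)\<^sup>2 + P22 u v w * (v' - v)\<^sup>2 + P33 u v w * (w' - w)\<^sup>2
         + 2 * P12 u v w * ((u' - u) * (v' - v)) + 2 * P13 u v w * ((u' - u) * (w' - w)) + 2 * P23 u v w * ((v' - v) * (w' - w))) / 2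
      - e * sqrt ((u' - u)\<^sup>2 + (v' - v)\<^sup>2 + (w' - w)\<^sup>2) ^ 2 - 5 * K * sqrt ((u' - u)\<^sup>2 + (v' - v)\<^sup>2 + (w' - w)\<^sup>2) ^ 3 \<le> P u' v' w'"
      unfolding x_def[symmetric] y_def[symmetric] z_def[symmetric] n_def[symmetric]
      using prod[OF m1 sz(1)] prod[OF m2 sz(2)] prod[OF m3 sz(3)] prod[OF m4 sz(4)] prod[OF m5 sz(5)] prod[OF m6 sz(6)]
      unfolding mult.assoc[of 2] mult.assoc[of 5] by (rule arith)
  qed
qed

section \<open>The second order condition\<close>

text \<open>
  With \<open>L = S / a - \<kappa> * T / b\<close> and \<open>m = \<kappa> * T / b\<close> one has \<open>S = a * (L + m)\<close>, \<open>T = \<kappa> * b * m\<close> and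
  \<open>S + T = a * L + \<sigma> * m\<close>: the hypothesis on the second derivatives controls the form on the line \<open>L = 0\<close>,
  and the terms carrying \<open>\<rho>\<close> and \<open>N\<close> absorb the rest.
\<close>

lemma quadratic_form_nonneg:
  fixes a b \<kappa> \<sigma> A C D K \<rho> N p S T :: real
  assumes ab: "a > 0" "b > 0" and \<kappa>: "\<kappa>\<^sup>2 = 1" and \<sigma>: "a + \<kappa> * b = \<sigma>" "\<sigma>\<^sup>2 = 1"
    and K: "\<bar>A\<bar> \<le> K" "\<bar>C\<bar> \<le> K" "\<bar>D\<bar> \<le> K"
    and cond: "0 \<le> a\<^sup>2 * A + 2 * \<kappa> * a * b * C + b\<^sup>2 * D"
    and p: "p > 0" and \<rho>: "\<rho> \<ge> 0"
    and k1: "k1 = 2 * K * (a\<^sup>2 + a * b)"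
    and big1: "\<rho> / 4 \<ge> 8 * K / p"
    and big2: "N \<ge> 2 * p * (k1 + 8 * K / p + \<rho> * a\<^sup>2)"
    and big3: "\<rho> * N / (2 * p) \<ge> k1\<^sup>2"
  shows "0 \<le> A * S\<^sup>2 + 2 * C * (S * T) + D * T\<^sup>2 + \<rho> * (S + T)\<^sup>2
    + (A * (S / a)\<^sup>2 - 2 * C * \<kappa> * ((S / a) * (T / b)) + D * (T / b)\<^sup>2) / p
    + N / p * (S / a - \<kappa> * (T / b))\<^sup>2"
proof -
  define L where "L = S / a - \<kappa> * (T / b)"
  define m where "m = \<kappa> * (T / b)"
  have T: "T = \<kappa> * b * m" using ab \<kappa> by (simp add: m_def power2_eq_square)
  have S: "S = a * (L + m)" using ab by (simp add: L_def m_def)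
  have K0: "K \<ge> 0" using K(1) by linarith
  have ST: "S + T = a * L + \<sigma> * m" unfolding S T using \<sigma>(1) by (simp add: algebra_simps) (metis distrib_left mult.commute mult.left_commute)
  have q1: "A * S\<^sup>2 + 2 * C * (S * T) + D * T\<^sup>2
    = m\<^sup>2 * (a\<^sup>2 * A + 2 * \<kappa> * a * b * C + b\<^sup>2 * D) + L * m * (2 * a\<^sup>2 * A + 2 * \<kappa> * a * b * C) + a\<^sup>2 * A * L\<^sup>2"
    unfolding S T power_mult_distrib \<kappa> by (simp add: power2_eq_square algebra_simps)
  have pp: "\<bar>x * y\<bar> \<le> K * \<bar>y\<bar>" if "\<bar>x\<bar> \<le> K" for x y
    unfolding abs_mult using that by (intro mult_right_mono) auto
  have k1nn: "k1 \<ge> 0" unfolding k1 using K0 ab by simp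
  have \<kappa>1: "\<bar>\<kappa>\<bar> = 1" using \<kappa> by (simp add: power2_eq_1_iff) auto
  have c1: "\<bar>2 * a\<^sup>2 * A + 2 * \<kappa> * a * b * C\<bar> \<le> k1"
  proof -
    have "\<bar>A * (2 * a\<^sup>2)\<bar> \<le> K * (2 * a\<^sup>2)" "\<bar>C * (2 * \<kappa> * a * b)\<bar> \<le> K * (2 * a * b)"
      using pp[OF K(1), of "2 * a\<^sup>2"] pp[OF K(2), of "2 * \<kappa> * a * b"] ab \<kappa>1 by (simp_all add: abs_mult)
    then show ?thesis unfolding k1 by (simp add: algebra_simps)
  qed
  \<comment> \<open>The coefficient of m^2 is nonnegative by \<open>cond\<close> and is dropped.
    Everything else contains \<open>L\<close>, with coefficients at most \<open>k1\<close>.\<close>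
  have l1: "A * S\<^sup>2 + 2 * C * (S * T) + D * T\<^sup>2 \<ge> - k1 * \<bar>L * m\<bar> - k1 * L\<^sup>2"
  proof -
    have "0 \<le> m\<^sup>2 * (a\<^sup>2 * A + 2 * \<kappa> * a * b * C + b\<^sup>2 * D)" using cond by simp
    moreover have "\<bar>L * m * (2 * a\<^sup>2 * A + 2 * \<kappa> * a * b * C)\<bar> \<le> \<bar>L * m\<bar> * k1"
      using c1 by (subst abs_mult) (intro mult_left_mono, auto)
    moreover have "\<bar>a\<^sup>2 * A * L\<^sup>2\<bar> \<le> k1 * L\<^sup>2"
    proof -
      have "\<bar>A * a\<^sup>2\<bar> \<le> K * a\<^sup>2" using pp[OF K(1), of "a\<^sup>2"] by simp
      also have "\<dots> \<le> k1" unfolding k1 using K0 ab by (simp add: algebra_simps)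
      finally have "\<bar>a\<^sup>2 * A\<bar> \<le> k1" by (simp add: mult.commute)
      then show ?thesis by (subst abs_mult) (simp add: mult_right_mono)
    qed
    ultimately show ?thesis unfolding q1 by (simp add: mult.commute abs_le_iff)
  qed
  \<comment> \<open>The three terms are at most 2, 3 and 1 times K * (L^2 + m^2), 6 in all; 8 leaves
    room.\<close>
  have l2: "A * (S / a)\<^sup>2 - 2 * C * \<kappa> * ((S / a) * (T / b)) + D * (T / b)\<^sup>2 \<ge> - (8 * K) * (L\<^sup>2 + m\<^sup>2)"
  proof -
    have Sa: "S / a = L + m" and Tb: "T / b = \<kappa> * m" using S T ab by simp_all
    have eq: "A * (S / a)\<^sup>2 - 2 * C * \<kappa> * ((S / a) * (T / b)) + D * (T / b)\<^sup>2
      = A * (L + m)\<^sup>2 - C * (2 * ((L + m) * m)) + D * m\<^sup>2"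
    proof -
      have "2 * C * \<kappa> * ((L + m) * (\<kappa> * m)) = \<kappa>\<^sup>2 * (C * (2 * ((L + m) * m)))"
        by (simp only: power2_eq_square mult_ac)
      then show ?thesis unfolding Sa Tb power_mult_distrib \<kappa> by simp
    qed
    have "\<bar>2 * ((L + m) * m)\<bar> \<le> 3 * (L\<^sup>2 + m\<^sup>2)"
    proof -
      have "3 * (L\<^sup>2 + m\<^sup>2) - 2 * ((L + m) * m) = 2 * L\<^sup>2 + (L - m)\<^sup>2"
        "3 * (L\<^sup>2 + m\<^sup>2) + 2 * ((L + m) * m) = 2 * L\<^sup>2 + 4 * m\<^sup>2 + (L + m)\<^sup>2"
        by (simp_all add: power2_eq_square algebra_simps)
      moreover have "0 \<le> 2 * L\<^sup>2 + (L - m)\<^sup>2" "0 \<le> 2 * L\<^sup>2 + 4 * m\<^sup>2 + (L + m)\<^sup>2" by simp_all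
      ultimately show ?thesis by linarith
    qed
    moreover have "(L + m)\<^sup>2 \<le> 2 * (L\<^sup>2 + m\<^sup>2)"
      using zero_le_power2[of "L - m"] by (simp add: power2_eq_square algebra_simps)
    ultimately have "K * \<bar>(L + m)\<^sup>2\<bar> \<le> K * (2 * (L\<^sup>2 + m\<^sup>2))" "K * \<bar>2 * ((L + m) * m)\<bar> \<le> K * (3 * (L\<^sup>2 + m\<^sup>2))"
      "K * \<bar>m\<^sup>2\<bar> \<le> K * (L\<^sup>2 + m\<^sup>2)"
      using K0 by (auto intro!: mult_left_mono)
    moreover have "0 \<le> K * (L\<^sup>2 + m\<^sup>2)" using K0 by simp
    ultimately show ?thesis
      unfolding eq using pp[OF K(1), of "(L + m)\<^sup>2"] pp[OF K(2), of "2 * ((L + m) * m)"] pp[OF K(3), of "m\<^sup>2"]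
      by (simp only: abs_le_iff mult.assoc[of K, symmetric] mult.commute[of K]) (simp add: algebra_simps)
  qed
  \<comment> \<open>Because \<open>\<sigma>\<^sup>2 = 1\<close>, the line L = 0 is transversal to S
    + T = 0, so this square controls m^2 up to a multiple of L^2.\<close>
  have l3: "(S + T)\<^sup>2 \<ge> m\<^sup>2 / 2 - a\<^sup>2 * L\<^sup>2"
  proof -
    have "0 \<le> (2 * (a * L) + \<sigma> * m)\<^sup>2 / 2" by simp
    also have "\<dots> = (S + T)\<^sup>2 - (\<sigma> * m)\<^sup>2 / 2 + (a * L)\<^sup>2"
      unfolding ST by (simp add: power2_eq_square field_simps)
    finally show ?thesis unfolding power_mult_distrib \<sigma>(2) by simp
  qed
  have Npos: "N \<ge> 0"
  proof -
    have "0 \<le> 2 * p * (k1 + 8 * K / p + \<rho> * a\<^sup>2)" using p K0 k1nn \<rho> by simp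
    with big2 show ?thesis by linarith
  qed
  define X where "X = A * S\<^sup>2 + 2 * C * (S * T) + D * T\<^sup>2"
  define Y where "Y = A * (S / a)\<^sup>2 - 2 * C * \<kappa> * ((S / a) * (T / b)) + D * (T / b)\<^sup>2"
  have Y: "Y / p \<ge> - (8 * K / p) * L\<^sup>2 - (8 * K / p) * m\<^sup>2"
    using divide_right_mono[OF l2[folded Y_def], of p] p by (simp add: field_simps)
  have M: "\<rho> * (S + T)\<^sup>2 \<ge> \<rho> / 2 * m\<^sup>2 - \<rho> * a\<^sup>2 * L\<^sup>2"
    using mult_left_mono[OF l3 \<rho>] by (simp add: algebra_simps)
  have NL: "N / p * L\<^sup>2 \<ge> N / (2 * p) * L\<^sup>2 + (k1 + 8 * K / p + \<rho> * a\<^sup>2) * L\<^sup>2"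
  proof -
    have "N / (2 * p) \<ge> k1 + 8 * K / p + \<rho> * a\<^sup>2" using big2 p by (simp add: field_simps)
    then have "N / (2 * p) * L\<^sup>2 \<ge> (k1 + 8 * K / p + \<rho> * a\<^sup>2) * L\<^sup>2" by (intro mult_right_mono) auto
    moreover have "N / p * L\<^sup>2 = N / (2 * p) * L\<^sup>2 + N / (2 * p) * L\<^sup>2" by (simp add: field_simps)
    ultimately show ?thesis by linarith
  qed
  have mm: "(\<rho> / 4) * m\<^sup>2 \<ge> 8 * K / p * m\<^sup>2" using big1 by (intro mult_right_mono) auto
  \<comment> \<open>Of the available \<open>\<rho> / 2 * m\<^sup>2\<close>, one half has paid for
    the 1 / p perturbation (\<open>mm\<close>). The other half, together with the half of
    \<open>N / p * L\<^sup>2\<close> left over in \<open>NL\<close>, absorbs the mixed term by the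
    arithmetic-geometric mean inequality; \<open>big3\<close> is the condition for this.\<close>
  have "k1 * \<bar>L * m\<bar> \<le> (\<rho> / 4) * m\<^sup>2 + N / (2 * p) * L\<^sup>2"
  proof -
    define s where "s = sqrt (\<rho> / 4)"
    define t where "t = sqrt (N / (2 * p))"
    have st: "s\<^sup>2 = \<rho> / 4" "t\<^sup>2 = N / (2 * p)" "s \<ge> 0" "t \<ge> 0" using \<rho> Npos p by (simp_all add: s_def t_def)
    have "(2 * s * t)\<^sup>2 = \<rho> * N / (2 * p)" unfolding power_mult_distrib st by simp
    with big3 have "k1\<^sup>2 \<le> (2 * s * t)\<^sup>2" by (simp only:)
    moreover have "0 \<le> 2 * s * t" using st(3,4) by simp
    ultimately have "k1 \<le> 2 * s * t" by (rule power2_le_imp_le)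
    then have "k1 * \<bar>L * m\<bar> \<le> 2 * s * t * \<bar>L * m\<bar>" by (intro mult_right_mono) auto
    also have "\<dots> \<le> (s * \<bar>m\<bar>)\<^sup>2 + (t * \<bar>L\<bar>)\<^sup>2"
      using sum_squares_bound[of "s * \<bar>m\<bar>" "t * \<bar>L\<bar>"] by (simp add: abs_mult algebra_simps)
    finally show ?thesis by (simp add: power_mult_distrib st)
  qed
  moreover have "(k1 + 8 * K / p + \<rho> * a\<^sup>2) * L\<^sup>2 = k1 * L\<^sup>2 + 8 * K / p * L\<^sup>2 + \<rho> * a\<^sup>2 * L\<^sup>2"
    by (simp add: algebra_simps)
  moreover have "\<rho> / 2 * m\<^sup>2 = \<rho> / 4 * m\<^sup>2 + \<rho> / 4 * m\<^sup>2" by simp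
  ultimately have "0 \<le> X + \<rho> * (S + T)\<^sup>2 + Y / p + N / p * L\<^sup>2"
    using l1[folded X_def] Y M NL mm by linarith
  then show ?thesis unfolding X_def Y_def L_def .
qed

text \<open>In the variables \<open>S\<close>, \<open>T\<close>, \<open>U\<close> the common factor
  \<open>\<mu>\<close> comes out. The third variable occurs only in the first bracket, since the
  third function does not involve \<open>z\<close>; completing the square in \<open>U\<close> turns
  the coefficient R - 1 of (S + T)^2 into R - 1 - (R - R / (s + 1)) = \<rho>. The second bracket
  yields the terms with 1 / p, among them the square that vanishes for L = 0.\<close>

lemma hessian_form_nonneg:
  fixes a b e1 e2 h w X Y XX XY YY \<mu> R s p K x1 x2 r3 :: real
  assumes ab: "a > 0" "b > 0" and e: "e1\<^sup>2 = 1" "e2\<^sup>2 = 1" and ae: "1 - a\<^sup>2 - b\<^sup>2 = 2 * (e1 * e2) * a * b"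
    and h: "h > 0" and w: "w > 0" and XY: "X \<noteq> 0" "Y \<noteq> 0" and \<mu>: "\<mu> \<ge> 0" and R: "R > 0" and s: "s \<ge> 0" and p: "p > 0"
    and K: "\<bar>h * XX / X\<^sup>2\<bar> \<le> K" "\<bar>h * XY / (X * Y)\<bar> \<le> K" "\<bar>h * YY / Y\<^sup>2\<bar> \<le> K"
    and cond: "0 \<le> a\<^sup>2 * (XX / X\<^sup>2) + (1 - a\<^sup>2 - b\<^sup>2) * (XY / (X * Y)) + b\<^sup>2 * (YY / Y\<^sup>2)"
    and k1: "k1 = 2 * K * (a\<^sup>2 + a * b)" and \<rho>: "\<rho> = R / (s + 1) - 1" "\<rho> \<ge> 0"
    and big1: "\<rho> / 4 \<ge> 8 * K / p"
    and big2: "R - 1 \<ge> 2 * p * (k1 + 8 * K / p + \<rho> * a\<^sup>2)"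
    and big3: "\<rho> * (R - 1) / (2 * p) \<ge> k1\<^sup>2"
    and P: "P11 = \<mu> * ((R - 1) * X\<^sup>2 + h * XX)" "P12 = \<mu> * ((R - 1) * (X * Y) + h * XY)"
      "P22 = \<mu> * ((R - 1) * Y\<^sup>2 + h * YY)" "P13 = - \<mu> * s * h * X / w" "P23 = - \<mu> * s * h * Y / w"
      "P33 = \<mu> * s * (s + 1) * h\<^sup>2 / (R * w\<^sup>2)"
  shows "0 \<le> (P11 * x1\<^sup>2 + P22 * x2\<^sup>2 + P33 * r3\<^sup>2 + 2 * P12 * (x1 * x2) + 2 * P13 * (x1 * r3) + 2 * P23 * (x2 * r3))
    + (P11 * (x1\<^sup>2 / (a\<^sup>2 * p)) + P22 * (x2\<^sup>2 / (b\<^sup>2 * p)) - 2 * P12 * (e1 * e2 * (x1 * x2) / (a * b * p)))"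
proof -
  define \<kappa> where "\<kappa> = e1 * e2"
  define A C D where "A = h * XX / X\<^sup>2" and "C = h * XY / (X * Y)" and "D = h * YY / Y\<^sup>2"
  define S T U where "S = X * x1" and "T = Y * x2" and "U = h * r3 / w"
  have \<kappa>: "\<kappa>\<^sup>2 = 1" using e by (simp add: \<kappa>_def power_mult_distrib)
  \<comment> \<open>The relation \<open>ae\<close> is 1 = (a + \<kappa> * b)^2 in expanded form;
    this is where the hypothesis on \<open>a\<close> and \<open>b\<close> enters the quadratic
    form.\<close>
  have \<sigma>: "(a + \<kappa> * b)\<^sup>2 = 1"
  proof -
    have "(a + \<kappa> * b)\<^sup>2 = a\<^sup>2 + 2 * \<kappa> * a * b + \<kappa>\<^sup>2 * b\<^sup>2" by (simp add: power2_eq_square algebra_simps)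
    then show ?thesis using ae \<kappa> by (simp add: \<kappa>_def)
  qed
  have "0 \<le> h * (a\<^sup>2 * (XX / X\<^sup>2) + (1 - a\<^sup>2 - b\<^sup>2) * (XY / (X * Y)) + b\<^sup>2 * (YY / Y\<^sup>2))"
    using cond h by simp
  also have "\<dots> = a\<^sup>2 * A + 2 * \<kappa> * a * b * C + b\<^sup>2 * D"
    unfolding ae A_def C_def D_def \<kappa>_def by (simp add: algebra_simps)
  finally have cond': "0 \<le> a\<^sup>2 * A + 2 * \<kappa> * a * b * C + b\<^sup>2 * D" .
  define E where "E = A * S\<^sup>2 + 2 * C * (S * T) + D * T\<^sup>2 + \<rho> * (S + T)\<^sup>2
    + (A * (S / a)\<^sup>2 - 2 * C * \<kappa> * ((S / a) * (T / b)) + D * (T / b)\<^sup>2) / p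
    + (R - 1) / p * (S / a - \<kappa> * (T / b))\<^sup>2"
  have E: "0 \<le> E"
    unfolding E_def
    by (rule quadratic_form_nonneg[OF ab \<kappa> refl \<sigma> K[folded A_def C_def D_def] cond' p \<rho>(2) k1 big1 big2 big3])
  have AS: "h * XX * x1\<^sup>2 = A * S\<^sup>2" "h * XY * (x1 * x2) = C * (S * T)" "h * YY * x2\<^sup>2 = D * T\<^sup>2"
    using XY by (simp_all add: A_def C_def D_def S_def T_def power_mult_distrib)
  have P': "P11 * t * x1\<^sup>2 = \<mu> * t * ((R - 1) * S\<^sup>2 + A * S\<^sup>2)" "P22 * t * x2\<^sup>2 = \<mu> * t * ((R - 1) * T\<^sup>2 + D * T\<^sup>2)"
    "P12 * t * (x1 * x2) = \<mu> * t * ((R - 1) * (S * T) + C * (S * T))" for t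
    unfolding P AS[symmetric] by (simp_all add: S_def T_def power_mult_distrib algebra_simps)
  have P3: "P33 * r3\<^sup>2 = \<mu> * (s * (s + 1) / R * U\<^sup>2)" "P13 * (x1 * r3) = - \<mu> * (s * (U * S))" "P23 * (x2 * r3) = - \<mu> * (s * (U * T))"
    unfolding P U_def S_def T_def by (simp_all add: power_mult_distrib power_divide)
  have c: "P11 * x1\<^sup>2 + P22 * x2\<^sup>2 + P33 * r3\<^sup>2 + 2 * P12 * (x1 * x2) + 2 * P13 * (x1 * r3) + 2 * P23 * (x2 * r3)
     = \<mu> * (A * S\<^sup>2 + 2 * C * (S * T) + D * T\<^sup>2 + (R - 1) * (S + T)\<^sup>2 - 2 * s * U * (S + T) + s * (s + 1) / R * U\<^sup>2)"
    using P'[of 1] P3 by (simp add: algebra_simps power2_eq_square)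
  have d: "P11 * (x1\<^sup>2 / (a\<^sup>2 * p)) + P22 * (x2\<^sup>2 / (b\<^sup>2 * p)) - 2 * P12 * (e1 * e2 * (x1 * x2) / (a * b * p))
     = \<mu> * ((A * (S / a)\<^sup>2 - 2 * C * \<kappa> * ((S / a) * (T / b)) + D * (T / b)\<^sup>2) / p
    + (R - 1) / p * (S / a - \<kappa> * (T / b))\<^sup>2)"
  proof -
    have "(S / a - \<kappa> * (T / b))\<^sup>2 = S\<^sup>2 / a\<^sup>2 - 2 * \<kappa> * (S * T) / (a * b) + \<kappa>\<^sup>2 * T\<^sup>2 / b\<^sup>2"
      by (simp add: power2_diff power_mult_distrib power_divide)
    then have sq: "(S / a - \<kappa> * (T / b))\<^sup>2 = S\<^sup>2 / a\<^sup>2 - 2 * \<kappa> * (S * T) / (a * b) + T\<^sup>2 / b\<^sup>2"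
      unfolding \<kappa> by simp
    have "P11 * (x1\<^sup>2 / (a\<^sup>2 * p)) + P22 * (x2\<^sup>2 / (b\<^sup>2 * p)) - 2 * P12 * (e1 * e2 * (x1 * x2) / (a * b * p))
      = P11 * (1 / (a\<^sup>2 * p)) * x1\<^sup>2 + P22 * (1 / (b\<^sup>2 * p)) * x2\<^sup>2 - 2 * (P12 * (\<kappa> / (a * b * p)) * (x1 * x2))"
      by (simp add: \<kappa>_def)
    also have "\<dots> = \<mu> * ((A * (S / a)\<^sup>2 - 2 * C * \<kappa> * ((S / a) * (T / b)) + D * (T / b)\<^sup>2) / p
    + (R - 1) / p * (S / a - \<kappa> * (T / b))\<^sup>2)"
      unfolding P' sq by (simp add: divide_inverse power2_eq_square algebra_simps)
    finally show ?thesis .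
  qed
  have sq: "(R - 1) * (S + T)\<^sup>2 - 2 * s * U * (S + T) + s * (s + 1) / R * U\<^sup>2
     = \<rho> * (S + T)\<^sup>2 + s * (s + 1) / R * (U - R / (s + 1) * (S + T))\<^sup>2"
  proof -
    have "(r - 1) * r / R * (U - R / r * V)\<^sup>2 = (r - 1) * r / R * U\<^sup>2 - 2 * (r - 1) * U * V + (R - R / r) * V\<^sup>2"
      if "r > 0" for r V
      using that R by (simp add: power2_eq_square field_simps)
    from this[of "s + 1" "S + T"] s have "s * (s + 1) / R * (U - R / (s + 1) * (S + T))\<^sup>2
      = s * (s + 1) / R * U\<^sup>2 - 2 * s * U * (S + T) + (R - R / (s + 1)) * (S + T)\<^sup>2"
      by simp
    then show ?thesis unfolding \<rho>(1) by (simp add: algebra_simps)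
  qed
  have "0 \<le> \<mu> * (E + s * (s + 1) / R * (U - R / (s + 1) * (S + T))\<^sup>2)"
    using E \<mu> s R by simp
  also have "\<dots> = \<mu> * (A * S\<^sup>2 + 2 * C * (S * T) + D * T\<^sup>2 + ((R - 1) * (S + T)\<^sup>2 - 2 * s * U * (S + T) + s * (s + 1) / R * U\<^sup>2))
     + \<mu> * ((A * (S / a)\<^sup>2 - 2 * C * \<kappa> * ((S / a) * (T / b)) + D * (T / b)\<^sup>2) / p
    + (R - 1) / p * (S / a - \<kappa> * (T / b))\<^sup>2)"
    unfolding sq E_def by (simp only: distrib_left add_ac)
  finally show ?thesis unfolding c d by (simp only: add_ac add_diff_eq diff_add_eq)
qed

section \<open>How large R has to be\<close>

lemma eventually_powr_ge:
  fixes c M :: real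
  assumes "c > 0"
  shows "eventually (\<lambda>R. R powr c \<ge> M) at_top"
proof -
  have "M \<le> R powr c" if "R \<ge> (\<bar>M\<bar> + 1) powr (1 / c)" for R
  proof -
    have "M \<le> ((\<bar>M\<bar> + 1) powr (1 / c)) powr c" using assms by (simp add: powr_powr)
    also have "\<dots> \<le> R powr c" using that assms by (intro powr_mono2) auto
    finally show ?thesis .
  qed
  then show ?thesis unfolding eventually_at_top_linorder by blast
qed

text \<open>Since \<alpha> < 1, eventually R^\<alpha> \<le> R / 2, and then R^(\<alpha>-1) \<le>
  \<rho> \<le> 2. The first inequality compares R^(\<alpha>-1) with R^(-\<beta>), hence needs
  \<alpha> + \<beta> > 1; the second compares R with R^\<beta>, where \<beta> < 1 suffices; the
  third has left side at least R^(\<alpha>-\<beta>) / 4, which tends to infinity because \<alpha> >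
  \<beta>.\<close>

lemma eventually_large_parameter:
  fixes \<alpha> \<beta> K k1 a :: real
  assumes "1 > \<alpha>" "\<alpha> > \<beta>" "\<beta> > 0" "\<alpha> + \<beta> > 1" "K \<ge> 0" "k1 \<ge> 0"
  defines "\<rho> \<equiv> \<lambda>R. R powr \<alpha> / (R - R powr \<alpha>)"
  shows "eventually (\<lambda>R. R > 1 \<and> R - R powr \<alpha> > 1 \<and> \<rho> R / 4 \<ge> 8 * K / R powr \<beta>
    \<and> R - 1 \<ge> 2 * R powr \<beta> * (k1 + 8 * K / R powr \<beta> + \<rho> R * a\<^sup>2)
    \<and> \<rho> R * (R - 1) / (2 * R powr \<beta>) \<ge> k1\<^sup>2) at_top"
proof -
  have "eventually (\<lambda>R::real. R > 2) at_top" by (rule eventually_gt_at_top)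
  moreover have "eventually (\<lambda>R. R powr (1 - \<alpha>) \<ge> 2) at_top"
    "eventually (\<lambda>R. R powr (\<alpha> + \<beta> - 1) \<ge> 32 * K) at_top"
    "eventually (\<lambda>R. R powr (1 - \<beta>) \<ge> 2 * k1 + 16 * K + 4 * a\<^sup>2 + 1) at_top"
    "eventually (\<lambda>R. R powr (\<alpha> - \<beta>) \<ge> 4 * k1\<^sup>2) at_top"
    using assms(1-4) by (auto intro!: eventually_powr_ge)
  ultimately show ?thesis
  proof eventually_elim
    case (elim R)
    have R: "R > 1" using elim(1) by simp
    have half: "R - R powr \<alpha> \<ge> R / 2"
    proof -
      have "2 * R powr \<alpha> \<le> R powr (1 - \<alpha>) * R powr \<alpha>" using elim(2) by (intro mult_right_mono) auto
      also have "\<dots> = R" using R by (simp add: powr_add[symmetric])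
      finally show ?thesis by simp
    qed
    then have gap: "R - R powr \<alpha> > 1" using elim(1) by simp
    let ?b = "R powr \<beta>"
    have b: "?b \<ge> 1" using R assms by (simp add: ge_one_powr_ge_zero)
    have lower: "\<rho> R \<ge> R powr (\<alpha> - 1)"
    proof -
      have "R powr (\<alpha> - 1) = R powr \<alpha> / R" using R by (simp add: powr_diff)
      also have "\<dots> \<le> \<rho> R" unfolding \<rho>_def using R gap by (intro divide_left_mono) auto
      finally show ?thesis .
    qed
    have upper: "\<rho> R \<le> 2"
    proof -
      have "R powr \<alpha> \<le> R powr 1" using R assms by (intro powr_mono) auto
      then have "R powr \<alpha> \<le> 2 * (R - R powr \<alpha>)" using half R by simp
      then show ?thesis unfolding \<rho>_def using gap by (simp add: divide_le_eq)
    qed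
    have "8 * K / ?b \<le> \<rho> R / 4"
    proof -
      have "8 * K / ?b \<le> (R powr (\<alpha> + \<beta> - 1) / 4) / ?b"
        using elim(3) b by (intro divide_right_mono) auto
      also have "\<dots> = R powr (\<alpha> - 1) / 4"
        using R by (simp add: powr_diff powr_add)
      finally show ?thesis using lower by simp
    qed
    moreover have "2 * ?b * (k1 + 8 * K / ?b + \<rho> R * a\<^sup>2) \<le> R - 1"
    proof -
      have "2 * ?b * (k1 + 8 * K / ?b + \<rho> R * a\<^sup>2) = 2 * k1 * ?b + 16 * K + 2 * ?b * (\<rho> R * a\<^sup>2)"
        using R by (simp add: field_simps)
      also have "\<dots> \<le> 2 * k1 * ?b + 16 * K * ?b + 2 * ?b * (2 * a\<^sup>2)"
        using upper b assms(5) mult_left_mono[OF b, of "16 * K"]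
        by (intro add_mono mult_left_mono mult_right_mono) auto
      also have "\<dots> = (2 * k1 + 16 * K + 4 * a\<^sup>2 + 1) * ?b - ?b" by (simp add: algebra_simps)
      also have "\<dots> \<le> R powr (1 - \<beta>) * ?b - 1" using elim(4) b by (intro diff_mono mult_right_mono) auto
      also have "R powr (1 - \<beta>) * ?b = R" using R by (simp add: powr_add[symmetric])
      finally show ?thesis .
    qed
    moreover have "k1\<^sup>2 \<le> \<rho> R * (R - 1) / (2 * ?b)"
    proof -
      have "k1\<^sup>2 \<le> R powr (\<alpha> - \<beta>) / 4" using elim(5) by simp
      also have "\<dots> = R powr (\<alpha> - 1) * (R / 2) / (2 * ?b)"
        using R by (simp add: powr_diff)
      also have "\<dots> \<le> \<rho> R * (R - 1) / (2 * ?b)"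
        using lower elim(1) b order_trans[OF powr_ge_zero lower] by (intro divide_right_mono mult_mono) auto
      finally show ?thesis .
    qed
    ultimately show ?case using R gap by simp
  qed
qed

section \<open>The inequality for powers of H\<close>

lemma has_real_derivative_powr_comp:
  fixes f :: "real \<Rightarrow> real"
  assumes "(f has_real_derivative f') (at x within S)" "f x > 0"
  shows "((\<lambda>x. f x powr r) has_real_derivative r * f x powr (r - 1) * f') (at x within S)"
  using DERIV_chain2[OF has_real_derivative_powr[OF assms(2)] assms(1)] .

definition powr_kernel :: "(real \<Rightarrow> real \<Rightarrow> real) \<Rightarrow> real \<Rightarrow> real \<Rightarrow> real^3 \<Rightarrow> real" where
  "powr_kernel H R s v = H (v$1) (v$2) powr R * (v$3) powr (-s)"

text \<open>The two coefficient vectors belong to \<open>x\<close> and \<open>z\<close> in the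
  arguments of \<open>f\<close>, \<open>g\<close> and the third function. The last entries 1 and 0
  say that the third function is evaluated at \<open>x\<close> itself. Gradient, Hessian and bound
  are existential because only the Jensen inequality is used afterwards.\<close>

lemma gaussian_jensen_powr_kernel:
  fixes H Hx Hy Hxx Hxy Hyy :: "real \<Rightarrow> real \<Rightarrow> real"
    and l1 u1 l2 u2 a b e1 e2 R s p K \<kappa>0 \<kappa>1 k1 \<rho> :: real
  assumes dH1: "\<And>u v. u \<in> {l1..u1} \<Longrightarrow> v \<in> {l2..u2} \<Longrightarrow> ((\<lambda>u. H u v) has_real_derivative Hx u v) (at u within {l1..u1})"
    and dH2: "\<And>u v. u \<in> {l1..u1} \<Longrightarrow> v \<in> {l2..u2} \<Longrightarrow> ((\<lambda>v. H u v) has_real_derivative Hy u v) (at v within {l2..u2})"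
    and dHxx: "\<And>u v. u \<in> {l1..u1} \<Longrightarrow> v \<in> {l2..u2} \<Longrightarrow> ((\<lambda>u. Hx u v) has_real_derivative Hxx u v) (at u within {l1..u1})"
    and dHxy: "\<And>u v. u \<in> {l1..u1} \<Longrightarrow> v \<in> {l2..u2} \<Longrightarrow> ((\<lambda>v. Hx u v) has_real_derivative Hxy u v) (at v within {l2..u2})"
    and dHyy: "\<And>u v. u \<in> {l1..u1} \<Longrightarrow> v \<in> {l2..u2} \<Longrightarrow> ((\<lambda>v. Hy u v) has_real_derivative Hyy u v) (at v within {l2..u2})"
    and cont: "\<And>F. F \<in> {H, Hx, Hy, Hxx, Hxy, Hyy} \<Longrightarrow> continuous_on ({l1..u1} \<times> {l2..u2}) (\<lambda>(u, v). F u v)"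
    and pos: "\<And>u v. u \<in> {l1..u1} \<Longrightarrow> v \<in> {l2..u2} \<Longrightarrow> H u v > 0 \<and> Hx u v \<noteq> 0 \<and> Hy u v \<noteq> 0"
    and K: "\<And>u v. u \<in> {l1..u1} \<Longrightarrow> v \<in> {l2..u2} \<Longrightarrow> \<bar>H u v * Hxx u v / (Hx u v)\<^sup>2\<bar> \<le> K
      \<and> \<bar>H u v * Hxy u v / (Hx u v * Hy u v)\<bar> \<le> K \<and> \<bar>H u v * Hyy u v / (Hy u v)\<^sup>2\<bar> \<le> K"
    and cond: "\<And>u v. u \<in> {l1..u1} \<Longrightarrow> v \<in> {l2..u2} \<Longrightarrow>
      0 \<le> a\<^sup>2 * (Hxx u v / (Hx u v)\<^sup>2) + (1 - a\<^sup>2 - b\<^sup>2) * (Hxy u v / (Hx u v * Hy u v)) + b\<^sup>2 * (Hyy u v / (Hy u v)\<^sup>2)"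
    and ab: "a > 0" "b > 0" and e: "e1\<^sup>2 = 1" "e2\<^sup>2 = 1" and ae: "1 - a\<^sup>2 - b\<^sup>2 = 2 * (e1 * e2) * a * b"
    and R: "R > 0" and s: "s \<ge> 0" and p: "p > 0" and \<kappa>0: "\<kappa>0 > 0"
    and k1: "k1 = 2 * K * (a\<^sup>2 + a * b)" and \<rho>: "\<rho> = R / (s + 1) - 1" "\<rho> \<ge> 0"
    and big1: "\<rho> / 4 \<ge> 8 * K / p"
    and big2: "R - 1 \<ge> 2 * p * (k1 + 8 * K / p + \<rho> * a\<^sup>2)"
    and big3: "\<rho> * (R - 1) / (2 * p) \<ge> k1\<^sup>2"
  shows "\<exists>G Q B. gaussian_jensen (powr_kernel H R s) G Q (vector [l1, l2, \<kappa>0]) (vector [u1, u2, \<kappa>1])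
    (vector [e1, e2, 1]) (vector [- 1 / (a * sqrt p), 1 / (b * sqrt p), 0]) B"
proof -
  define P where "P u v w = H u v powr R * w powr (-s)" for u v w
  define P1 where "P1 u v w = R * H u v powr (R - 1) * Hx u v * w powr (-s)" for u v w
  define P2 where "P2 u v w = R * H u v powr (R - 1) * Hy u v * w powr (-s)" for u v w
  define P3 where "P3 u v w = H u v powr R * (- s * w powr (- s - 1))" for u v w
  define P11 where "P11 u v w = R * ((R - 1) * H u v powr (R - 1 - 1) * Hx u v * Hx u v + H u v powr (R - 1) * Hxx u v) * w powr (-s)" for u v w
  define P12 where "P12 u v w = R * ((R - 1) * H u v powr (R - 1 - 1) * Hy u v * Hx u v + H u v powr (R - 1) * Hxy u v) * w powr (-s)" for u v w
  define P22 where "P22 u v w = R * ((R - 1) * H u v powr (R - 1 - 1) * Hy u v * Hy u v + H u v powr (R - 1) * Hyy u v) * w powr (-s)" for u v w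
  define P13 where "P13 u v w = R * H u v powr (R - 1) * Hx u v * (- s * w powr (- s - 1))" for u v w
  define P23 where "P23 u v w = R * H u v powr (R - 1) * Hy u v * (- s * w powr (- s - 1))" for u v w
  define P33 where "P33 u v w = H u v powr R * (- s * ((- s - 1) * w powr (- s - 1 - 1)))" for u v w
  define Box where "Box = {l1..u1} \<times> {l2..u2} \<times> {\<kappa>0..\<kappa>1}"
  have mem: "(u, v, w) \<in> Box \<longleftrightarrow> u \<in> {l1..u1} \<and> v \<in> {l2..u2} \<and> w \<in> {\<kappa>0..\<kappa>1}" for u v w
    by (simp add: Box_def)
  have w_pos: "w > 0" if "(u, v, w) \<in> Box" for u v w using that \<kappa>0 by (simp add: mem)
  have dw: "((\<lambda>w. w powr r) has_real_derivative r * w powr (r - 1)) (at w within S)" if "w > 0" for w r S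
    using has_real_derivative_powr_comp[OF DERIV_ident that, of r S] by simp
  have cH: "continuous_on Box (\<lambda>q. F (fst q) (fst (snd q)))" if "F \<in> {H, Hx, Hy, Hxx, Hxy, Hyy}" for F
  proof -
    have "continuous_on Box ((\<lambda>(u, v). F u v) \<circ> (\<lambda>q. (fst q, fst (snd q))))"
      by (intro continuous_on_compose continuous_intros continuous_on_subset[OF cont[OF that]]) (auto simp: Box_def)
    then show ?thesis by (simp add: comp_def)
  qed
  note cH' = cH[of H, simplified] cH[of Hx, simplified] cH[of Hy, simplified] cH[of Hxx, simplified]
    cH[of Hxy, simplified] cH[of Hyy, simplified]
  have cP: "continuous_on Box (\<lambda>(u, v, w). F u v w)" if "F \<in> {P11, P12, P13, P22, P23, P33}" for F
  proof -
    have nz: "\<forall>q\<in>Box. H (fst q) (fst (snd q)) \<noteq> 0" "\<forall>q\<in>Box. snd (snd q) \<noteq> 0"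
      using pos \<kappa>0 by (fastforce simp: Box_def)+
    from that show ?thesis
      unfolding split_beta P11_def[abs_def] P12_def[abs_def] P13_def[abs_def] P22_def[abs_def] P23_def[abs_def] P33_def[abs_def]
      by (elim insertE emptyE; simp only:) (intro continuous_intros cH' nz)+
  qed
  have taylor: "\<exists>K. \<forall>u v w u' v' w'. (u, v, w) \<in> Box \<longrightarrow> (u', v', w') \<in> Box \<longrightarrow>
    (let x = u' - u; y = v' - v; z = w' - w; n = sqrt (x\<^sup>2 + y\<^sup>2 + z\<^sup>2) in
      P u v w + (P1 u v w * x + P2 u v w * y + P3 u v w * z)
      + (P11 u v w * x\<^sup>2 + P22 u v w * y\<^sup>2 + P33 u v w * z\<^sup>2
         + 2 * P12 u v w * (x * y) + 2 * P13 u v w * (x * z) + 2 * P23 u v w * (y * z)) / 2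
      - e * n ^ 2 - K * n ^ 3 \<le> P u' v' w')" if "e > 0" for e
    unfolding Box_def
  proof (rule Taylor2_box3[OF _ _ _ _ _ _ _ _ _ _ that], unfold Box_def[symmetric])
    fix u v w assume "(u, v, w) \<in> Box"
    then have B: "u \<in> {l1..u1}" "v \<in> {l2..u2}" and w: "w > 0" using w_pos by (auto simp: mem)
    have Hp: "H u v > 0" using pos B by simp
    note dR = has_real_derivative_powr_comp[OF dH1[OF B] Hp] has_real_derivative_powr_comp[OF dH2[OF B] Hp]
    show "((\<lambda>u. P u v w) has_real_derivative P1 u v w) (at u within {l1..u1})"
      unfolding P_def P1_def by (rule DERIV_cmult_right[OF dR(1)])
    show "((\<lambda>v. P u v w) has_real_derivative P2 u v w) (at v within {l2..u2})"
      unfolding P_def P2_def by (rule DERIV_cmult_right[OF dR(2)])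
    show "((\<lambda>w. P u v w) has_real_derivative P3 u v w) (at w within {\<kappa>0..\<kappa>1})"
      unfolding P_def P3_def by (intro DERIV_cmult dw w)
    show "((\<lambda>u. P1 u v w) has_real_derivative P11 u v w) (at u within {l1..u1})"
      unfolding P1_def P11_def
      by (rule DERIV_cong[OF DERIV_cmult_right[OF DERIV_mult[OF DERIV_cmult[OF dR(1)] dHxx[OF B]]]]) (simp add: algebra_simps)
    show "((\<lambda>v. P1 u v w) has_real_derivative P12 u v w) (at v within {l2..u2})"
      unfolding P1_def P12_def
      by (rule DERIV_cong[OF DERIV_cmult_right[OF DERIV_mult[OF DERIV_cmult[OF dR(2)] dHxy[OF B]]]]) (simp add: algebra_simps)
    show "((\<lambda>w. P1 u v w) has_real_derivative P13 u v w) (at w within {\<kappa>0..\<kappa>1})"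
      unfolding P1_def P13_def by (intro DERIV_cmult dw w)
    show "((\<lambda>v. P2 u v w) has_real_derivative P22 u v w) (at v within {l2..u2})"
      unfolding P2_def P22_def
      by (rule DERIV_cong[OF DERIV_cmult_right[OF DERIV_mult[OF DERIV_cmult[OF dR(2)] dHyy[OF B]]]]) (simp add: algebra_simps)
    show "((\<lambda>w. P2 u v w) has_real_derivative P23 u v w) (at w within {\<kappa>0..\<kappa>1})"
      unfolding P2_def P23_def by (intro DERIV_cmult dw w)
    show "((\<lambda>w. P3 u v w) has_real_derivative P33 u v w) (at w within {\<kappa>0..\<kappa>1})"
      unfolding P3_def P33_def by (intro DERIV_cmult dw w)
  qed (rule cP)
  have "\<exists>M. \<forall>q\<in>Box. \<bar>(\<lambda>(u, v, w). F u v w) q\<bar> \<le> M" if "F \<in> {P11, P12, P13, P22, P23, P33}" for F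
  proof -
    have "compact ((\<lambda>(u, v, w). F u v w) ` Box)"
      unfolding Box_def by (intro compact_continuous_image cP[OF that, unfolded Box_def] compact_Times compact_Icc)
    then obtain M where "\<forall>x\<in>(\<lambda>(u, v, w). F u v w) ` Box. norm x \<le> M"
      using compact_imp_bounded bounded_iff by metis
    then show ?thesis by auto
  qed
  then obtain M where M: "\<And>F q. F \<in> {P11, P12, P13, P22, P23, P33} \<Longrightarrow> q \<in> Box \<Longrightarrow> \<bar>(\<lambda>(u, v, w). F u v w) q\<bar> \<le> M F"
    by metis
  define B where "B = M P11 + M P22 + M P33 + 2 * M P12 + 2 * M P13 + 2 * M P23"
  define T where "T F v = F (v$1) (v$2) (v$3)" for F :: "real \<Rightarrow> real \<Rightarrow> real \<Rightarrow> real" and v :: "real^3"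
  define G where "G v = (vector [T P1 v, T P2 v, T P3 v] :: real^3)" for v
  define Q where "Q v x y = T P11 v * (x$1 * y$1) + T P22 v * (x$2 * y$2) + T P33 v * (x$3 * y$3)
      + T P12 v * (x$1 * y$2 + x$2 * y$1) + T P13 v * (x$1 * y$3 + x$3 * y$1) + T P23 v * (x$2 * y$3 + x$3 * y$2)"
    for v x y :: "real^3"
  have cb: "v \<in> cbox (vector [l1, l2, \<kappa>0]) (vector [u1, u2, \<kappa>1]) \<longleftrightarrow> (v$1, v$2, v$3) \<in> Box" for v :: "real^3"
    by (auto simp: mem mem_box_cart forall_3)
  have n3: "norm v = sqrt ((v$1)\<^sup>2 + (v$2)\<^sup>2 + (v$3)\<^sup>2)" for v :: "real^3"
    by (simp add: norm_vec_def L2_set_def sum_3)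
  have kern: "powr_kernel H R s v = T P v" for v by (simp add: powr_kernel_def T_def P_def)
  show ?thesis
  proof (intro exI[of _ G] exI[of _ Q] exI[of _ B], unfold_locales, unfold cb)
    have "continuous_on Box (\<lambda>(u, v, w). P u v w)"
    proof -
      have nz: "\<forall>q\<in>Box. H (fst q) (fst (snd q)) \<noteq> 0" "\<forall>q\<in>Box. snd (snd q) \<noteq> 0"
        using pos \<kappa>0 by (fastforce simp: Box_def)+
      show ?thesis unfolding split_beta P_def by (intro continuous_intros cH' nz)
    qed
    then have "continuous_on (cbox (vector [l1, l2, \<kappa>0]) (vector [u1, u2, \<kappa>1]))
        ((\<lambda>(u, v, w). P u v w) \<circ> (\<lambda>v :: real^3. (v$1, v$2, v$3)))"
      by (intro continuous_on_compose continuous_intros) (auto elim!: continuous_on_subset simp: cb)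
    then show "continuous_on (cbox (vector [l1, l2, \<kappa>0]) (vector [u1, u2, \<kappa>1])) (powr_kernel H R s)"
      by (simp add: comp_def kern[abs_def] T_def)
    show "\<exists>K. \<forall>p\<in>cbox (vector [l1, l2, \<kappa>0]) (vector [u1, u2, \<kappa>1]). \<forall>q\<in>cbox (vector [l1, l2, \<kappa>0]) (vector [u1, u2, \<kappa>1]).
        powr_kernel H R s p + G p \<bullet> (q - p) + Q p (q - p) (q - p) / 2 - e * norm (q - p) ^ 2 - K * norm (q - p) ^ 3
        \<le> powr_kernel H R s q" if "e > 0" for e
    proof -
      from taylor[OF that] obtain K where K: "\<And>u v w u' v' w'. (u, v, w) \<in> Box \<Longrightarrow> (u', v', w') \<in> Box \<Longrightarrow>
      (let x = u' - u; y = v' - v; z = w' - w; n = sqrt (x\<^sup>2 + y\<^sup>2 + z\<^sup>2) in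
      P u v w + (P1 u v w * x + P2 u v w * y + P3 u v w * z)
      + (P11 u v w * x\<^sup>2 + P22 u v w * y\<^sup>2 + P33 u v w * z\<^sup>2
         + 2 * P12 u v w * (x * y) + 2 * P13 u v w * (x * z) + 2 * P23 u v w * (y * z)) / 2
      - e * n ^ 2 - K * n ^ 3 \<le> P u' v' w')" by blast
      have G3: "G p \<bullet> x = T P1 p * x$1 + T P2 p * x$2 + T P3 p * x$3" for p x
        by (simp add: inner_vec_def sum_3 G_def)
      have Q3: "Q p x x = T P11 p * (x$1)\<^sup>2 + T P22 p * (x$2)\<^sup>2 + T P33 p * (x$3)\<^sup>2
         + 2 * T P12 p * (x$1 * x$2) + 2 * T P13 p * (x$1 * x$3) + 2 * T P23 p * (x$2 * x$3)" for p x
        by (simp add: Q_def power2_eq_square algebra_simps)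
      show ?thesis
      proof (intro exI[of _ K] ballI, unfold cb)
        fix p q :: "real^3" assume "(p$1, p$2, p$3) \<in> Box" "(q$1, q$2, q$3) \<in> Box"
        from K[OF this] show "powr_kernel H R s p + G p \<bullet> (q - p) + Q p (q - p) (q - p) / 2
          - e * norm (q - p) ^ 2 - K * norm (q - p) ^ 3 \<le> powr_kernel H R s q"
          unfolding kern G3 Q3 n3 Let_def T_def vector_minus_component .
      qed
    qed
    show "bilinear (Q p)" for p
      unfolding bilinear_def Q_def by (auto intro!: linearI simp: algebra_simps)
    show "\<bar>Q p v w\<bar> \<le> B * norm v * norm w" if "(p$1, p$2, p$3) \<in> Box" for p v w
    proof -
      have t: "\<bar>T F p * (v$i * w$j)\<bar> \<le> M F * (norm v * norm w)" if F: "F \<in> {P11, P12, P13, P22, P23, P33}" for F i j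
      proof -
        have "\<bar>v$i * w$j\<bar> \<le> norm v * norm w"
          unfolding abs_mult by (intro mult_mono component_le_norm_cart) auto
        then show ?thesis
          unfolding abs_mult[of "T F p"] using M[OF F \<open>(p$1, p$2, p$3) \<in> Box\<close>]
          by (intro mult_mono) (auto simp: T_def intro: order_trans[OF abs_ge_zero])
      qed
      have "B * norm v * norm w = M P11 * (norm v * norm w) + M P22 * (norm v * norm w) + M P33 * (norm v * norm w)
        + (M P12 * (norm v * norm w) + M P12 * (norm v * norm w)) + (M P13 * (norm v * norm w) + M P13 * (norm v * norm w))
        + (M P23 * (norm v * norm w) + M P23 * (norm v * norm w))"
        by (simp add: B_def algebra_simps)
      moreover have "P11 \<in> {P11, P12, P13, P22, P23, P33}" "P22 \<in> {P11, P12, P13, P22, P23, P33}"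
        "P33 \<in> {P11, P12, P13, P22, P23, P33}" "P12 \<in> {P11, P12, P13, P22, P23, P33}"
        "P13 \<in> {P11, P12, P13, P22, P23, P33}" "P23 \<in> {P11, P12, P13, P22, P23, P33}" by simp_all
      moreover note t[OF this(1), of 1 1] t[OF this(2), of 2 2] t[OF this(3), of 3 3] t[OF this(4), of 1 2] t[OF this(4), of 2 1]
        t[OF this(5), of 1 3] t[OF this(5), of 3 1] t[OF this(6), of 2 3] t[OF this(6), of 3 2]
      ultimately show ?thesis
        unfolding Q_def distrib_left abs_le_iff by (intro conjI; linarith)
    qed
    show "vector [e1, e2, 1] $ i \<noteq> (0::real)" for i :: 3
      using exhaust_3[of i] e by auto
    show "0 \<le> Q v (\<chi> i. vector [e1, e2, 1] $ i * r $ i) (\<chi> i. vector [e1, e2, 1] $ i * r $ i) +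
          Q v (\<chi> i. vector [- 1 / (a * sqrt p), 1 / (b * sqrt p), 0] $ i * r $ i)
           (\<chi> i. vector [- 1 / (a * sqrt p), 1 / (b * sqrt p), 0] $ i * r $ i)"
      if "(v$1, v$2, v$3) \<in> Box" for v r
    proof -
      let ?h = "H (v$1) (v$2)" and ?w = "v$3"
      have Bx: "v$1 \<in> {l1..u1}" "v$2 \<in> {l2..u2}" and w: "?w > 0" using that w_pos[OF that] by (auto simp: mem)
      have h: "?h > 0" and nz: "Hx (v$1) (v$2) \<noteq> 0" "Hy (v$1) (v$2) \<noteq> 0" using pos[OF Bx] by auto
      \<comment> \<open>This is R * H^(R-2) * w^(-s), the factor common to all second derivatives
        once they are written with \<open>H\<close> and \<open>w\<close> cleared as in
        \<open>hessian_form_nonneg\<close>.\<close>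
      define \<mu> where "\<mu> = R * ?h powr R / ?h\<^sup>2 * ?w powr (-s)"
      have hp: "?h powr (R - 1) = ?h powr R / ?h" "?h powr (R - 1 - 1) = ?h powr R / ?h\<^sup>2"
        using h unfolding powr_diff[of ?h _ 1] by (simp_all add: power2_eq_square)
      have wp: "?w powr (- s - 1) = ?w powr (- s) / ?w" "?w powr (- s - 1 - 1) = ?w powr (- s) / ?w\<^sup>2"
        using w unfolding powr_diff[of ?w _ 1] by (simp_all add: power2_eq_square)
      have m: "\<mu> \<ge> 0" using h w R by (simp add: \<mu>_def)
      have T11: "T P11 v = \<mu> * ((R - 1) * (Hx (v$1) (v$2))\<^sup>2 + ?h * Hxx (v$1) (v$2))"
        using h unfolding T_def P11_def \<mu>_def hp by (simp add: field_simps power2_eq_square)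
      have T12: "T P12 v = \<mu> * ((R - 1) * (Hx (v$1) (v$2) * Hy (v$1) (v$2)) + ?h * Hxy (v$1) (v$2))"
        using h unfolding T_def P12_def \<mu>_def hp by (simp add: field_simps power2_eq_square)
      have T22: "T P22 v = \<mu> * ((R - 1) * (Hy (v$1) (v$2))\<^sup>2 + ?h * Hyy (v$1) (v$2))"
        using h unfolding T_def P22_def \<mu>_def hp by (simp add: field_simps power2_eq_square)
      have T13: "T P13 v = - \<mu> * s * ?h * Hx (v$1) (v$2) / ?w"
        using h w unfolding T_def P13_def \<mu>_def hp wp by (simp add: field_simps power2_eq_square)
      have T23: "T P23 v = - \<mu> * s * ?h * Hy (v$1) (v$2) / ?w"
        using h w unfolding T_def P23_def \<mu>_def hp wp by (simp add: field_simps power2_eq_square)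
      have T33: "T P33 v = \<mu> * s * (s + 1) * ?h\<^sup>2 / (R * ?w\<^sup>2)"
        using h w R unfolding T_def P33_def \<mu>_def hp wp by (simp add: field_simps power2_eq_square)
      \<comment> \<open>The signs are moved into the variables. As they square to 1, the first
        vector becomes sign-free and the second retains only the product e1 * e2 in its mixed
        term.\<close>
      let ?x1 = "e1 * r$1" and ?x2 = "e2 * r$2"
      have r: "r$1 = e1 * ?x1" "r$2 = e2 * ?x2" using e by (simp_all add: power2_eq_square flip: mult.assoc)
      have sp: "sqrt p * sqrt p = p" using p by simp
      have ee: "e1 * (e1 * t) = t" "e2 * (e2 * t) = t" for t using e by (simp_all add: power2_eq_square flip: mult.assoc)
      have dd: "(- 1 / (a * sqrt p) * r$1) * (- 1 / (a * sqrt p) * r$1) = ?x1\<^sup>2 / (a\<^sup>2 * p)"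
        "(1 / (b * sqrt p) * r$2) * (1 / (b * sqrt p) * r$2) = ?x2\<^sup>2 / (b\<^sup>2 * p)"
        "(- 1 / (a * sqrt p) * r$1) * (1 / (b * sqrt p) * r$2) = - (e1 * e2 * (?x1 * ?x2) / (a * b * p))"
        using e p by (simp_all add: power_mult_distrib power2_eq_square sp ee mult_ac)
      have "0 \<le> (T P11 v * ?x1\<^sup>2 + T P22 v * ?x2\<^sup>2 + T P33 v * (r$3)\<^sup>2 + 2 * T P12 v * (?x1 * ?x2)
          + 2 * T P13 v * (?x1 * r$3) + 2 * T P23 v * (?x2 * r$3))
        + (T P11 v * (?x1\<^sup>2 / (a\<^sup>2 * p)) + T P22 v * (?x2\<^sup>2 / (b\<^sup>2 * p)) - 2 * T P12 v * (e1 * e2 * (?x1 * ?x2) / (a * b * p)))"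
        using K[OF Bx]
        by (intro hessian_form_nonneg[OF ab e ae h w nz m R s p _ _ _ cond[OF Bx] k1 \<rho> big1 big2 big3 T11 T12 T22 T13 T23 T33]) auto
      also have "\<dots> = Q v (\<chi> i. vector [e1, e2, 1] $ i * r $ i) (\<chi> i. vector [e1, e2, 1] $ i * r $ i) +
          Q v (\<chi> i. vector [- 1 / (a * sqrt p), 1 / (b * sqrt p), 0] $ i * r $ i)
           (\<chi> i. vector [- 1 / (a * sqrt p), 1 / (b * sqrt p), 0] $ i * r $ i)"
        unfolding Q_def vec_lambda_beta vector_3 dd mult.commute[of "1 / (b * sqrt p) * r$2" "- 1 / (a * sqrt p) * r$1"]
        by (simp add: power2_eq_square algebra_simps)
      finally show ?thesis .
    qed
  qed
qed

section \<open>From the Jensen inequality to the mixed norm\<close>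

lemma continuous_on_rectangle_bounded:
  fixes F :: "real \<Rightarrow> real \<Rightarrow> real"
  assumes "continuous_on ({l1..u1} \<times> {l2..u2}) (\<lambda>(u, v). F u v)"
  obtains M where "\<And>u v. u \<in> {l1..u1} \<Longrightarrow> v \<in> {l2..u2} \<Longrightarrow> \<bar>F u v\<bar> \<le> M"
proof -
  have "compact ((\<lambda>(u, v). F u v) ` ({l1..u1} \<times> {l2..u2}))"
    by (intro compact_continuous_image assms compact_Times compact_Icc)
  then obtain M where M: "\<forall>x\<in>(\<lambda>(u, v). F u v) ` ({l1..u1} \<times> {l2..u2}). norm x \<le> M"
    using compact_imp_bounded bounded_iff by metis
  show thesis
  proof (rule that)
    show "\<bar>F u v\<bar> \<le> M" if "u \<in> {l1..u1}" "v \<in> {l2..u2}" for u v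
      using M that by (auto simp del: atLeastAtMost_iff)
  qed
qed

text \<open>Jensen is applied to \<open>f\<close>, \<open>g\<close> and \<open>k\<close>, where
  \<open>k\<close> is built from the inner integral of \<open>f\<close> and \<open>g\<close>
  themselves. The lower bound \<open>\<delta>\<close> on \<open>H\<close> keeps \<open>W\<close>,
  hence \<open>k\<close>, away from 0, so that \<open>k\<close> takes values in an interval on which
  the negative power is smooth.\<close>

lemma mixed_norm_inequality:
  fixes H :: "real \<Rightarrow> real \<Rightarrow> real" and I :: "nat set"
  assumes cont: "continuous_on ({l1..u1} \<times> {l2..u2}) (\<lambda>(u, v). H u v)"
    and pos: "\<And>u v. u \<in> {l1..u1} \<Longrightarrow> v \<in> {l2..u2} \<Longrightarrow> H u v > \<delta>" and \<delta>: "\<delta> > 0"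
    and gj: "\<And>\<kappa>0 \<kappa>1. \<kappa>0 > 0 \<Longrightarrow> \<exists>G Q B. gaussian_jensen (powr_kernel H R s) G Q (vector [l1, l2, \<kappa>0]) (vector [u1, u2, \<kappa>1])
      (vector [e1, e2, 1]) (vector [d1, d2, 0]) B"
    and e: "e1\<^sup>2 = 1" "e2\<^sup>2 = 1" and R: "R > 0" and s: "s \<ge> 0" and I: "finite I"
    and fm: "f \<in> borel_measurable (gamma_PiM I)" and fI: "\<And>y. y \<in> space (gamma_PiM I) \<Longrightarrow> f y \<in> {l1..u1}"
    and gm: "g \<in> borel_measurable (gamma_PiM I)" and gI: "\<And>y. y \<in> space (gamma_PiM I) \<Longrightarrow> g y \<in> {l2..u2}"
  shows "H (\<integral>y. f (\<lambda>j\<in>I. sqrt (1 + d1\<^sup>2) * y j) \<partial>gamma_PiM I) (\<integral>y. g (\<lambda>j\<in>I. sqrt (1 + d2\<^sup>2) * y j) \<partial>gamma_PiM I) powr (R / (s + 1))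
    \<le> (\<integral>x. (\<integral>z. H (f (\<lambda>j\<in>I. e1 * x j + d1 * z j)) (g (\<lambda>j\<in>I. e2 * x j + d2 * z j)) powr R \<partial>gamma_PiM I) powr (1 / (s + 1)) \<partial>gamma_PiM I)"
proof -
  let ?G = "gamma_PiM I"
  interpret G: prob_space ?G by (rule prob_space_gamma_PiM)
  define \<theta> where "\<theta> = 1 / (s + 1)"
  have \<theta>: "\<theta> > 0" "1 - \<theta> * s = \<theta>" "(s + 1) * \<theta> = 1" using s by (simp_all add: \<theta>_def field_simps)
  obtain M0 where "\<And>u v. u \<in> {l1..u1} \<Longrightarrow> v \<in> {l2..u2} \<Longrightarrow> \<bar>H u v\<bar> \<le> M0"
    by (rule continuous_on_rectangle_bounded[OF cont]) blast
  then have M0: "\<And>u v. u \<in> {l1..u1} \<Longrightarrow> v \<in> {l2..u2} \<Longrightarrow> H u v \<le> M0" by (meson abs_le_D1)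
  define Z where "Z x z = H (f (\<lambda>j\<in>I. e1 * x j + d1 * z j)) (g (\<lambda>j\<in>I. e2 * x j + d2 * z j)) powr R" for x z
  have rsp: "(\<lambda>j\<in>I. h j) \<in> space ?G" for h by (simp add: space_gamma_PiM)
  have Zm: "(\<lambda>p. Z (x p) (z p)) \<in> borel_measurable M"
    if "x \<in> M \<rightarrow>\<^sub>M ?G" "z \<in> M \<rightarrow>\<^sub>M ?G" for x z and M :: "'m measure"
  proof -
    have "(\<lambda>p. (\<lambda>(u, v). H u v) (f (\<lambda>j\<in>I. e1 * x p j + d1 * z p j), g (\<lambda>j\<in>I. e2 * x p j + d2 * z p j))) \<in> borel_measurable M"
      using that by (intro measurable_continuous_on_compose[OF cont] borel_measurable_Pair
        measurable_compose[OF measurable_restrict_lin fm] measurable_compose[OF measurable_restrict_lin gm])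
        (auto simp: fI[OF rsp] gI[OF rsp] simp del: atLeastAtMost_iff)
    then show ?thesis unfolding Z_def by simp
  qed
  have Zb: "Z x z \<in> {\<delta> powr R .. M0 powr R}" for x z
  proof -
    let ?u = "f (\<lambda>j\<in>I. e1 * x j + d1 * z j)" and ?v = "g (\<lambda>j\<in>I. e2 * x j + d2 * z j)"
    have "\<delta> < H ?u ?v" "H ?u ?v \<le> M0" using pos[OF fI[OF rsp] gI[OF rsp]] M0[OF fI[OF rsp] gI[OF rsp]] by blast+
    then show ?thesis using \<delta> R by (simp add: Z_def powr_mono2)
  qed
  define W where "W x = (\<integral>z. Z x z \<partial>?G)" for x
  have Wm: "W \<in> borel_measurable ?G"
    unfolding W_def[abs_def] by (intro measurable_integral_prob prob_space_gamma_PiM Zm) auto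
  have Wb: "W x \<in> {\<delta> powr R .. M0 powr R}" if "x \<in> space ?G" for x
    unfolding W_def using that by (intro integral_interval prob_space_gamma_PiM Zb Zm) auto
  \<comment> \<open>The range of \<open>k\<close>; it depends on \<open>R\<close>, which is why the
    Jensen property was assumed for every positive \<open>\<kappa>0\<close>.\<close>
  define \<kappa>0 \<kappa>1 where "\<kappa>0 = (\<delta> powr R) powr \<theta>" and "\<kappa>1 = (M0 powr R) powr \<theta>"
  have \<kappa>0: "\<kappa>0 > 0" using \<delta> by (simp add: \<kappa>0_def)
  define k where "k x = W x powr \<theta>" for x
  have km: "k \<in> borel_measurable ?G" unfolding k_def[abs_def] using Wm by measurable
  have Wpos: "W x > 0" if "x \<in> space ?G" for x
    using Wb[OF that] \<delta> by (auto intro: less_le_trans[of 0 "\<delta> powr R"])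
  have kI: "k x \<in> {\<kappa>0..\<kappa>1}" if "x \<in> space ?G" for x
    using Wb[OF that] less_imp_le[OF Wpos[OF that]] \<theta> \<delta> by (auto simp: k_def \<kappa>0_def \<kappa>1_def intro!: powr_mono2)
  obtain G Q B where "gaussian_jensen (powr_kernel H R s) G Q (vector [l1, l2, \<kappa>0]) (vector [u1, u2, \<kappa>1])
      (vector [e1, e2, 1]) (vector [d1, d2, 0]) B"
    using gj[OF \<kappa>0] by blast
  then interpret J: gaussian_jensen "powr_kernel H R s" G Q "vector [l1, l2, \<kappa>0]" "vector [u1, u2, \<kappa>1]"
      "vector [e1, e2, 1]" "vector [d1, d2, 0]" B .
  define F where "F i y = (vector [f y, g y, k y] :: real^3) $ i" for i y
  have F: "F 1 = f" "F 2 = g" "F 3 = k" by (simp_all add: F_def fun_eq_iff)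
  \<comment> \<open>The third deviation is 1, so the mean of \<open>k\<close> inside
    \<open>Psi\<close> on the left is the same number \<open>Kb\<close> that the right side reduces
    to.\<close>
  have sd: "J.sd 1 = sqrt (1 + d1\<^sup>2)" "J.sd 2 = sqrt (1 + d2\<^sup>2)" "J.sd 3 = 1"
    using e by (simp_all add: J.sd_def)
  have kern: "powr_kernel H R s (\<chi> i. h i) = H (h 1) (h 2) powr R * h 3 powr (-s)" for h
    by (simp add: powr_kernel_def)
  have id: "(\<lambda>j\<in>I. x j) = x" if "x \<in> space ?G" for x
    using that by (auto simp: space_gamma_PiM PiE_iff extensional_def)
  define Kb where "Kb = (\<integral>x. k x \<partial>?G)"
  have Kb: "Kb > 0"
    using integral_interval[OF prob_space_gamma_PiM km kI] \<kappa>0 by (simp add: Kb_def)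
  have "powr_kernel H R s (\<chi> i. \<integral>y. F i (\<lambda>j\<in>I. J.sd i * y j) \<partial>?G)
    \<le> (\<integral>x. (\<integral>z. powr_kernel H R s (\<chi> i. F i (\<lambda>j\<in>I. vector [e1, e2, 1] $ i * x j + vector [d1, d2, 0] $ i * z j)) \<partial>?G) \<partial>?G)"
  proof (rule J.jensen[OF I])
    show "F i \<in> borel_measurable ?G" for i
      using exhaust_3[of i] fm gm km F by auto
    show "F i y \<in> {vector [l1, l2, \<kappa>0] $ i..vector [u1, u2, \<kappa>1] $ i}" if "y \<in> space ?G" for i y
      using exhaust_3[of i] fI[OF that] gI[OF that] kI[OF that] F by auto
  qed
  also have "(\<integral>x. (\<integral>z. powr_kernel H R s (\<chi> i. F i (\<lambda>j\<in>I. vector [e1, e2, 1] $ i * x j + vector [d1, d2, 0] $ i * z j)) \<partial>?G) \<partial>?G) = Kb"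
    unfolding Kb_def
  proof (rule Bochner_Integration.integral_cong[OF refl])
    fix x assume x: "x \<in> space ?G"
    have "(\<integral>z. powr_kernel H R s (\<chi> i. F i (\<lambda>j\<in>I. vector [e1, e2, 1] $ i * x j + vector [d1, d2, 0] $ i * z j)) \<partial>?G)
       = (\<integral>z. Z x z * k x powr (-s) \<partial>?G)"
      unfolding kern F vector_3 Z_def using id[OF x] by simp
    also have "\<dots> = W x * k x powr (-s)" by (simp add: W_def)
    also have "\<dots> = W x powr (1 - \<theta> * s)"
      using Wpos[OF x] by (simp add: k_def powr_powr powr_diff powr_minus divide_inverse)
    finally show "(\<integral>z. powr_kernel H R s (\<chi> i. F i (\<lambda>j\<in>I. vector [e1, e2, 1] $ i * x j + vector [d1, d2, 0] $ i * z j)) \<partial>?G) = k x"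
      unfolding \<theta>(2) k_def .
  qed
  also have "powr_kernel H R s (\<chi> i. \<integral>y. F i (\<lambda>j\<in>I. J.sd i * y j) \<partial>?G)
     = H (\<integral>y. f (\<lambda>j\<in>I. sqrt (1 + d1\<^sup>2) * y j) \<partial>?G) (\<integral>y. g (\<lambda>j\<in>I. sqrt (1 + d2\<^sup>2) * y j) \<partial>?G) powr R * Kb powr (-s)"
  proof -
    have "(\<integral>y. k (\<lambda>j\<in>I. 1 * y j) \<partial>?G) = Kb"
      unfolding Kb_def by (rule Bochner_Integration.integral_cong) (simp_all add: id)
    then show ?thesis unfolding kern F sd by simp
  qed
  finally have main: "H (\<integral>y. f (\<lambda>j\<in>I. sqrt (1 + d1\<^sup>2) * y j) \<partial>?G) (\<integral>y. g (\<lambda>j\<in>I. sqrt (1 + d2\<^sup>2) * y j) \<partial>?G) powr R * Kb powr (-s) \<le> Kb"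
    (is "?h powr R * _ \<le> _") .
  \<comment> \<open>Solving for \<open>?h\<close>: multiplication by \<open>Kb powr s\<close> gives
    \<open>Kb powr (s + 1)\<close> on the right, and the exponent \<open>\<theta>\<close> undoes s +
    1.\<close>
  have "?h powr R = ?h powr R * Kb powr (-s) * Kb powr s" using Kb by (simp add: powr_minus)
  also have "\<dots> \<le> Kb * Kb powr s" using main by (intro mult_right_mono) auto
  also have "\<dots> = Kb powr (s + 1)" using Kb by (simp add: powr_add)
  finally have "(?h powr R) powr \<theta> \<le> (Kb powr (s + 1)) powr \<theta>"
    using \<theta> by (intro powr_mono2) auto
  then have "?h powr (R * \<theta>) \<le> Kb" using Kb by (simp add: powr_powr \<theta>(3))
  then show ?thesis unfolding Kb_def k_def W_def Z_def \<theta>_def by simp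
qed

section \<open>Transfer to the measures and parameters of the statement\<close>

lemma sets_Rn [measurable_cong]: "sets (Rn n) = sets (gamma_PiM {..<n})"
  unfolding Rn_def sets_gamma_PiM by (rule sets_PiM_cong) auto

lemma space_Rn: "space (Rn n) = space (gamma_PiM {..<n})"
  by (rule sets_eq_imp_space_eq) (rule sets_Rn)

lemma integral_gauss:
  fixes F :: "(nat \<Rightarrow> real) \<Rightarrow> real"
  assumes "p > 0" "F \<in> borel_measurable (Rn n)"
  shows "(\<integral>y. F y \<partial>gauss n p q x) = (\<integral>z. F (\<lambda>i\<in>{..<n}. - q * x i / p + z i / sqrt p) \<partial>gamma_PiM {..<n})"
  unfolding gauss_eq_distr[OF assms(1)]
proof (rule integral_distr[OF _ assms(2)])
  show "(\<lambda>z. \<lambda>i\<in>{..<n}. - q * x i / p + z i / sqrt p) \<in> gamma_PiM {..<n} \<rightarrow>\<^sub>M Rn n"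
    unfolding Rn_def by measurable
qed

text \<open>The quotient is 1 exactly when (a + b)^2 = 1 and -1 exactly when (a - b)^2 = 1.
  Positivity leaves a + b = 1, b = a + 1 and a = b + 1, and the first two are a = |1 - b|.\<close>

lemma abs_diff_or_sum_cases:
  fixes a b :: real
  assumes "a > 0" "b > 0" and "((1 - a\<^sup>2 - b\<^sup>2) / (2 * a * b))\<^sup>2 = 1"
  obtains "a = \<bar>1 - b\<bar>" | "a = b + 1"
proof -
  have "(1 - a\<^sup>2 - b\<^sup>2) / (2 * a * b) = 1 \<or> (1 - a\<^sup>2 - b\<^sup>2) / (2 * a * b) = - 1"
    using assms(3) by (simp add: power2_eq_1_iff)
  then show thesis
  proof
    assume "(1 - a\<^sup>2 - b\<^sup>2) / (2 * a * b) = 1"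
    then have "(a + b)\<^sup>2 = 1" using assms(1,2) by (simp add: field_simps power2_eq_square)
    then have "a + b = 1" using assms(1,2) by (auto simp: power2_eq_1_iff)
    then show thesis using that(1) assms(1) by auto
  next
    assume "(1 - a\<^sup>2 - b\<^sup>2) / (2 * a * b) = - 1"
    then have "(a - b)\<^sup>2 = 1" using assms(1,2) by (simp add: field_simps power2_eq_square)
    then have "a - b = 1 \<or> a - b = - 1" by (simp add: power2_eq_1_iff)
    then show thesis using that assms by (auto simp: abs_if)
  qed
qed

theorem lemma5:
  fixes a b \<delta> \<alpha> \<beta> l\<^sub>1 u\<^sub>1 l\<^sub>2 u\<^sub>2 :: real
    and I J :: "real set"
    and H Hx Hy Hxx Hxy Hyy :: "real \<Rightarrow> real \<Rightarrow> real"
  assumes "l\<^sub>1 < u\<^sub>1" and "I = {l\<^sub>1..u\<^sub>1}"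
    and "l\<^sub>2 < u\<^sub>2" and "J = {l\<^sub>2..u\<^sub>2}"
    and "a > 0" and "b > 0"
    and "((1 - a\<^sup>2 - b\<^sup>2) / (2 * a * b))\<^sup>2 = 1"
    and "Ck_on 3 I J H"
    and "Hx = partial1 I H" and "Hy = partial2 J H"
    and "Hxx = partial1 I Hx" and "Hxy = partial2 J Hx" and "Hyy = partial2 J Hy"
    and "\<delta> > 0"
    and "\<forall>x\<in>I. \<forall>y\<in>J. H x y > \<delta> \<and> \<bar>Hx x y\<bar> > \<delta> \<and> \<bar>Hy x y\<bar> > \<delta>"
    and "\<forall>x\<in>I. \<forall>y\<in>J.
           a\<^sup>2 * (Hxx x y / (Hx x y)\<^sup>2)
           + (1 - a\<^sup>2 - b\<^sup>2) * (Hxy x y / (Hx x y * Hy x y))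
           + b\<^sup>2 * (Hyy x y / (Hy x y)\<^sup>2) \<ge> 0"
    and "1 > \<alpha>" and "\<alpha> > \<beta>" and "\<beta> > 0" and "\<alpha> + \<beta> > 1"
  shows "\<exists>R\<^sub>0::real. \<forall>R>R\<^sub>0. \<forall>n\<ge>1. \<forall>f g p q.
           f \<in> borel_measurable (Rn n) \<longrightarrow> f \<in> space (Rn n) \<rightarrow> I \<longrightarrow>
           g \<in> borel_measurable (Rn n) \<longrightarrow> g \<in> space (Rn n) \<rightarrow> J \<longrightarrow>
           p = R powr \<beta> \<longrightarrow>
           (a = \<bar>1 - b\<bar> \<longrightarrow> q = - b * R powr \<beta>) \<longrightarrow>
           (a = b + 1 \<longrightarrow> q = b * R powr \<beta>) \<longrightarrow>
           (\<integral>x. (\<integral>y. H (f (\<lambda>i\<in>{..<n}. (x i - y i) / a)) (g (\<lambda>i\<in>{..<n}. y i / b)) powr R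
                   \<partial>gauss n p q x) powr (1 / (R - R powr \<alpha>)) \<partial>std_gauss n)
           \<ge> H (\<integral>x. f (\<lambda>i\<in>{..<n}. x i * sqrt (1 + 1 / (a\<^sup>2 * R powr \<beta>))) \<partial>std_gauss n)
               (\<integral>x. g (\<lambda>i\<in>{..<n}. x i * sqrt (1 + 1 / (b\<^sup>2 * R powr \<beta>))) \<partial>std_gauss n)
             powr (R / (R - R powr \<alpha>))"
proof -
  have IJ: "I = {l\<^sub>1..u\<^sub>1}" "J = {l\<^sub>2..u\<^sub>2}" by fact+
  have C3: "Ck_on 3 I J H" by fact
  have der1: "((\<lambda>u. F u v) has_real_derivative partial1 I F u v) (at u within I)"
    if "(\<lambda>u. F u v) differentiable (at u within I)" for F u v
    using that vector_derivative_works unfolding partial1_def has_real_derivative_iff_has_vector_derivative by blast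
  have der2: "((\<lambda>v. F u v) has_real_derivative partial2 J F u v) (at v within J)"
    if "(\<lambda>v. F u v) differentiable (at v within J)" for F u v
    using that vector_derivative_works unfolding partial2_def has_real_derivative_iff_has_vector_derivative by blast
  note parts = \<open>Hx = partial1 I H\<close> \<open>Hy = partial2 J H\<close> \<open>Hxx = partial1 I Hx\<close> \<open>Hxy = partial2 J Hx\<close> \<open>Hyy = partial2 J Hy\<close>
  have Ck: "Ck_on (Suc (Suc 0)) I J Hx" "Ck_on (Suc (Suc 0)) I J Hy"
    using C3 unfolding numeral_3_eq_3 Ck_on.simps(2)[of "Suc (Suc 0)"] parts(1,2) by blast+
  have Ck1: "Ck_on (Suc 0) I J Hxx" "Ck_on (Suc 0) I J Hxy" "Ck_on (Suc 0) I J Hyy"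
    using Ck unfolding Ck_on.simps(2)[of "Suc 0"] parts(3-5) by blast+
  have cont: "continuous_on (I \<times> J) (\<lambda>(u, v). F u v)" if "F \<in> {H, Hx, Hy, Hxx, Hxy, Hyy}" for F
    using that C3 Ck Ck1 by (auto simp: numeral_3_eq_3)
  have dH: "\<And>u v. u \<in> I \<Longrightarrow> v \<in> J \<Longrightarrow> ((\<lambda>u. H u v) has_real_derivative Hx u v) (at u within I)"
    "\<And>u v. u \<in> I \<Longrightarrow> v \<in> J \<Longrightarrow> ((\<lambda>v. H u v) has_real_derivative Hy u v) (at v within J)"
    unfolding parts(1,2) using C3 by (auto simp: numeral_3_eq_3 intro!: der1 der2)
  have dHx: "\<And>u v. u \<in> I \<Longrightarrow> v \<in> J \<Longrightarrow> ((\<lambda>u. Hx u v) has_real_derivative Hxx u v) (at u within I)"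
    "\<And>u v. u \<in> I \<Longrightarrow> v \<in> J \<Longrightarrow> ((\<lambda>v. Hx u v) has_real_derivative Hxy u v) (at v within J)"
    unfolding parts(3,4) using Ck(1) by (auto intro!: der1 der2)
  have dHy: "\<And>u v. u \<in> I \<Longrightarrow> v \<in> J \<Longrightarrow> ((\<lambda>v. Hy u v) has_real_derivative Hyy u v) (at v within J)"
    unfolding parts(5) using Ck(2) by (auto intro!: der2)
  have pos: "H u v > \<delta>" "H u v > 0" "Hx u v \<noteq> 0" "Hy u v \<noteq> 0" if "u \<in> I" "v \<in> J" for u v
    using assms(14,15) that by fastforce+
  have bdd: "\<exists>K. \<forall>u\<in>I. \<forall>v\<in>J. \<bar>F u v\<bar> \<le> K" if "continuous_on (I \<times> J) (\<lambda>(u, v). F u v)" for F :: "real \<Rightarrow> real \<Rightarrow> real"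
    using continuous_on_rectangle_bounded[OF that[unfolded IJ]] unfolding IJ by metis
  have cont': "continuous_on (I \<times> J) (\<lambda>q. F (fst q) (snd q))" if "F \<in> {H, Hx, Hy, Hxx, Hxy, Hyy}" for F
    using cont[OF that] by (simp add: split_beta)
  note cont'' = cont'[of H, simplified] cont'[of Hx, simplified] cont'[of Hy, simplified] cont'[of Hxx, simplified]
    cont'[of Hxy, simplified] cont'[of Hyy, simplified]
  have nz: "\<forall>q\<in>I \<times> J. Hx (fst q) (snd q) \<noteq> 0" "\<forall>q\<in>I \<times> J. Hy (fst q) (snd q) \<noteq> 0" using pos by auto
  obtain K1 K2 K3 where K123: "\<forall>u\<in>I. \<forall>v\<in>J. \<bar>H u v * Hxx u v / (Hx u v)\<^sup>2\<bar> \<le> K1"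
    "\<forall>u\<in>I. \<forall>v\<in>J. \<bar>H u v * Hxy u v / (Hx u v * Hy u v)\<bar> \<le> K2" "\<forall>u\<in>I. \<forall>v\<in>J. \<bar>H u v * Hyy u v / (Hy u v)\<^sup>2\<bar> \<le> K3"
  proof -
    have "continuous_on (I \<times> J) (\<lambda>(u, v). H u v * Hxx u v / (Hx u v)\<^sup>2)"
      "continuous_on (I \<times> J) (\<lambda>(u, v). H u v * Hxy u v / (Hx u v * Hy u v))"
      "continuous_on (I \<times> J) (\<lambda>(u, v). H u v * Hyy u v / (Hy u v)\<^sup>2)"
      unfolding split_beta using nz by (auto intro!: continuous_intros cont'')
    from bdd[OF this(1)] bdd[OF this(2)] bdd[OF this(3)] show thesis using that by blast
  qed
  have pos': "H u v > 0 \<and> Hx u v \<noteq> 0 \<and> Hy u v \<noteq> 0" if "u \<in> I" "v \<in> J" for u v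
    using pos that by blast
  have cond: "0 \<le> a\<^sup>2 * (Hxx u v / (Hx u v)\<^sup>2) + (1 - a\<^sup>2 - b\<^sup>2) * (Hxy u v / (Hx u v * Hy u v)) + b\<^sup>2 * (Hyy u v / (Hy u v)\<^sup>2)"
    if "u \<in> I" "v \<in> J" for u v
    using assms(16) that by blast
  \<comment> \<open>One bound for the three normalized second derivatives. It depends on
    \<open>H\<close> only, so the threshold obtained from it serves all \<open>n\<close>,
    \<open>f\<close> and \<open>g\<close>.\<close>
  define K where "K = \<bar>K1\<bar> + \<bar>K2\<bar> + \<bar>K3\<bar>"
  have K: "\<bar>H u v * Hxx u v / (Hx u v)\<^sup>2\<bar> \<le> K \<and> \<bar>H u v * Hxy u v / (Hx u v * Hy u v)\<bar> \<le> K
      \<and> \<bar>H u v * Hyy u v / (Hy u v)\<^sup>2\<bar> \<le> K" if "u \<in> I" "v \<in> J" for u v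
    using K123[rule_format, OF that] unfolding K_def by linarith
  define k1 where "k1 = 2 * K * (a\<^sup>2 + a * b)"
  have K0: "K \<ge> 0" "k1 \<ge> 0" using assms(5,6) by (simp_all add: K_def k1_def)
  have ab: "a > 0" "b > 0" by fact+
  \<comment> \<open>\<open>e2\<close> is 1 for a = |1 - b| and -1 for a = b + 1. As b > 0, the two
    cases exclude each other, so q = -b * e2 * p covers both. Then y = b * e2 * x + z / sqrt p,
    which makes \<open>e2\<close> the coefficient of \<open>x\<close> in y / b and (1 - b * e2) / a
    the one in (x - y) / a.\<close>
  have "\<exists>e2. e2\<^sup>2 = 1 \<and> ((1 - b * e2) / a)\<^sup>2 = 1 \<and> (\<forall>p q. (a = \<bar>1 - b\<bar> \<longrightarrow> q = - b * p) \<longrightarrow> (a = b + 1 \<longrightarrow> q = b * p) \<longrightarrow> q = - b * e2 * p)"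
    using ab assms(7)
  proof (cases rule: abs_diff_or_sum_cases)
    case 1
    then have "a \<noteq> b + 1" "(1 - b)\<^sup>2 = a\<^sup>2" using ab by auto
    with 1 ab show ?thesis by (intro exI[of _ 1]) (auto simp: power_divide)
  next
    case 2
    then have "a \<noteq> \<bar>1 - b\<bar>" "(1 + b)\<^sup>2 = a\<^sup>2" using ab by auto
    with 2 ab show ?thesis by (intro exI[of _ "-1"]) (auto simp: power_divide)
  qed
  then obtain e2 where e2: "e2\<^sup>2 = 1" "((1 - b * e2) / a)\<^sup>2 = 1"
    and q: "\<And>p q. (a = \<bar>1 - b\<bar> \<longrightarrow> q = - b * p) \<Longrightarrow> (a = b + 1 \<longrightarrow> q = b * p) \<Longrightarrow> q = - b * e2 * p"
    by blast
  define e1 where "e1 = (1 - b * e2) / a"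
  have e1: "e1\<^sup>2 = 1" "a * e1 = 1 - b * e2" using e2 ab by (simp_all add: e1_def)
  \<comment> \<open>This is a * e1 + b * e2 = 1 squared: the two correlated arguments must recombine
    to \<open>x\<close>.\<close>
  have ae: "1 - a\<^sup>2 - b\<^sup>2 = 2 * (e1 * e2) * a * b"
  proof -
    have "a\<^sup>2 = (1 - b * e2)\<^sup>2" using e1 by (metis mult.right_neutral power_mult_distrib)
    also have "\<dots> = 1 - 2 * b * e2 + b\<^sup>2" using e2(1) by (simp add: power2_diff power_mult_distrib)
    finally have "1 - a\<^sup>2 - b\<^sup>2 = 2 * b * e2 - 2 * b\<^sup>2" by simp
    also have "\<dots> = 2 * b * e2 * (1 - b * e2)" using e2(1) by (simp add: power2_eq_square algebra_simps)
    also have "\<dots> = 2 * (e1 * e2) * a * b" unfolding e1(2)[symmetric] by simp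
    finally show ?thesis .
  qed
  from eventually_large_parameter[OF assms(17-20) K0, of a]
  obtain R0 where R0: "\<And>R. R \<ge> R0 \<Longrightarrow> R > 1 \<and> R - R powr \<alpha> > 1 \<and> R powr \<alpha> / (R - R powr \<alpha>) / 4 \<ge> 8 * K / R powr \<beta>
    \<and> R - 1 \<ge> 2 * R powr \<beta> * (k1 + 8 * K / R powr \<beta> + R powr \<alpha> / (R - R powr \<alpha>) * a\<^sup>2)
    \<and> R powr \<alpha> / (R - R powr \<alpha>) * (R - 1) / (2 * R powr \<beta>) \<ge> k1\<^sup>2"
    unfolding eventually_at_top_linorder by auto
  show ?thesis
  proof (intro exI[of _ R0] allI impI)
    fix R :: real and n :: nat and f g :: "(nat \<Rightarrow> real) \<Rightarrow> real" and p q' :: real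
    assume "R > R0" and fm: "f \<in> borel_measurable (Rn n)" and fI: "f \<in> space (Rn n) \<rightarrow> I"
      and gm: "g \<in> borel_measurable (Rn n)" and gI: "g \<in> space (Rn n) \<rightarrow> J" and p: "p = R powr \<beta>"
      and q1: "a = \<bar>1 - b\<bar> \<longrightarrow> q' = - b * R powr \<beta>" and q2: "a = b + 1 \<longrightarrow> q' = b * R powr \<beta>"
    from R0[of R] \<open>R > R0\<close> have R: "R > 1" "R - R powr \<alpha> > 1"
      and big: "R powr \<alpha> / (R - R powr \<alpha>) / 4 \<ge> 8 * K / p"
      "R - 1 \<ge> 2 * p * (k1 + 8 * K / p + R powr \<alpha> / (R - R powr \<alpha>) * a\<^sup>2)"
      "R powr \<alpha> / (R - R powr \<alpha>) * (R - 1) / (2 * p) \<ge> k1\<^sup>2"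
      by (auto simp: p)
    have p0: "p > 0" using R by (simp add: p)
    have qq: "q' = - b * e2 * p" using q[of q' p] q1 q2 by (simp add: p)
    \<comment> \<open>The threshold guarantees R - R^\<alpha> > 1, so \<open>s\<close> is
      nonnegative and the outer exponent is 1 / (s + 1).\<close>
    define s where "s = R - R powr \<alpha> - 1"
    have s: "s \<ge> 0" "s + 1 = R - R powr \<alpha>" using R by (simp_all add: s_def)
    have \<rho>: "R powr \<alpha> / (R - R powr \<alpha>) = R / (s + 1) - 1" "R powr \<alpha> / (R - R powr \<alpha>) \<ge> 0"
      using R unfolding s by (simp_all add: field_simps)
    let ?d1 = "- 1 / (a * sqrt p)" and ?d2 = "1 / (b * sqrt p)"
    let ?G = "gamma_PiM {..<n}"
    have gj: "\<exists>G Q B. gaussian_jensen (powr_kernel H R s) G Q (vector [l\<^sub>1, l\<^sub>2, \<kappa>0]) (vector [u\<^sub>1, u\<^sub>2, \<kappa>1])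
      (vector [e1, e2, 1]) (vector [?d1, ?d2, 0]) B" if "\<kappa>0 > 0" for \<kappa>0 \<kappa>1
      by (rule gaussian_jensen_powr_kernel[where Hx=Hx and Hy=Hy and Hxx=Hxx and Hxy=Hxy and Hyy=Hyy,
        OF dH[unfolded IJ] dHx[unfolded IJ] dHy[unfolded IJ] cont[unfolded IJ] pos'[unfolded IJ] K[unfolded IJ]
          cond[unfolded IJ] ab e1(1) e2(1) ae _ s(1) p0 that k1_def \<rho> big]) (use R in simp_all)
    have "H (\<integral>y. f (\<lambda>j\<in>{..<n}. sqrt (1 + ?d1\<^sup>2) * y j) \<partial>?G) (\<integral>y. g (\<lambda>j\<in>{..<n}. sqrt (1 + ?d2\<^sup>2) * y j) \<partial>?G) powr (R / (s + 1))
      \<le> (\<integral>x. (\<integral>z. H (f (\<lambda>j\<in>{..<n}. e1 * x j + ?d1 * z j)) (g (\<lambda>j\<in>{..<n}. e2 * x j + ?d2 * z j)) powr R \<partial>?G) powr (1 / (s + 1)) \<partial>?G)"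
    proof (rule mixed_norm_inequality[OF cont[of H, unfolded IJ] _ \<open>\<delta> > 0\<close> gj e1(1) e2(1) _ s(1)])
      show "f \<in> borel_measurable ?G" "g \<in> borel_measurable ?G"
        using fm gm by (simp_all cong: measurable_cong_sets[OF sets_Rn refl])
      show "\<And>y. y \<in> space ?G \<Longrightarrow> f y \<in> {l\<^sub>1..u\<^sub>1}" "\<And>y. y \<in> space ?G \<Longrightarrow> g y \<in> {l\<^sub>2..u\<^sub>2}"
        using fI gI unfolding space_Rn IJ by blast+
      show "\<And>u v. u \<in> {l\<^sub>1..u\<^sub>1} \<Longrightarrow> v \<in> {l\<^sub>2..u\<^sub>2} \<Longrightarrow> \<delta> < H u v" using pos unfolding IJ by blast
    qed (use R in auto)
    \<comment> \<open>The squares of the coefficients of \<open>z\<close> are the excess variances: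
      they produce the factors sqrt (1 + 1 / (a^2 R^\<beta>)) and sqrt (1 + 1 / (b^2 R^\<beta>)) of
      the statement.\<close>
    moreover have "?d1\<^sup>2 = 1 / (a\<^sup>2 * R powr \<beta>)" "?d2\<^sup>2 = 1 / (b\<^sup>2 * R powr \<beta>)"
      using p0 by (simp_all add: power_divide power_mult_distrib p)
    moreover have "(\<integral>y. H (f (\<lambda>i\<in>{..<n}. (x i - y i) / a)) (g (\<lambda>i\<in>{..<n}. y i / b)) powr R \<partial>gauss n p q' x)
       = (\<integral>z. H (f (\<lambda>j\<in>{..<n}. e1 * x j + ?d1 * z j)) (g (\<lambda>j\<in>{..<n}. e2 * x j + ?d2 * z j)) powr R \<partial>?G)" for x
    proof -
      have fz: "(\<lambda>i\<in>{..<n}. (x i - (\<lambda>i\<in>{..<n}. - q' * x i / p + z i / sqrt p) i) / a) = (\<lambda>j\<in>{..<n}. e1 * x j + ?d1 * z j)" for z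
      proof (rule restrict_ext)
        fix i assume "i \<in> {..<n}"
        then show "(x i - (\<lambda>i\<in>{..<n}. - q' * x i / p + z i / sqrt p) i) / a = e1 * x i + ?d1 * z i"
          using p0 ab by (simp add: qq e1_def field_simps)
      qed
      have gz: "(\<lambda>i\<in>{..<n}. (\<lambda>i\<in>{..<n}. - q' * x i / p + z i / sqrt p) i / b) = (\<lambda>j\<in>{..<n}. e2 * x j + ?d2 * z j)" for z
      proof (rule restrict_ext)
        fix i assume "i \<in> {..<n}"
        then show "(\<lambda>i\<in>{..<n}. - q' * x i / p + z i / sqrt p) i / b = e2 * x i + ?d2 * z i"
          using p0 ab by (simp add: qq field_simps)
      qed
      have m: "(\<lambda>y. (\<lambda>(u, v). H u v) (f (\<lambda>i\<in>{..<n}. (x i - y i) / a), g (\<lambda>i\<in>{..<n}. y i / b))) \<in> borel_measurable (Rn n)"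
      proof (rule measurable_continuous_on_compose[OF cont[of H]])
        have "(\<lambda>y. \<lambda>i\<in>{..<n}. (x i - y i) / a) \<in> Rn n \<rightarrow>\<^sub>M Rn n" "(\<lambda>y. \<lambda>i\<in>{..<n}. y i / b) \<in> Rn n \<rightarrow>\<^sub>M Rn n"
          unfolding Rn_def by measurable
        from measurable_compose[OF this(1) fm] measurable_compose[OF this(2) gm]
        show "(\<lambda>y. (f (\<lambda>i\<in>{..<n}. (x i - y i) / a), g (\<lambda>i\<in>{..<n}. y i / b))) \<in> borel_measurable (Rn n)"
          by (rule borel_measurable_Pair)
        have "(\<lambda>i\<in>{..<n}. h i) \<in> space (Rn n)" for h by (simp add: space_Rn space_gamma_PiM)
        then show "(f (\<lambda>i\<in>{..<n}. (x i - y i) / a), g (\<lambda>i\<in>{..<n}. y i / b)) \<in> I \<times> J" for y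
          using fI gI by blast
      qed simp
      have "(\<lambda>y. H (f (\<lambda>i\<in>{..<n}. (x i - y i) / a)) (g (\<lambda>i\<in>{..<n}. y i / b)) powr R) \<in> borel_measurable (Rn n)"
        using measurable_compose[OF m, of "\<lambda>t. t powr R" borel] by simp
      from integral_gauss[OF p0 this, of q' x] show ?thesis unfolding fz gz .
    qed
    ultimately show "H (\<integral>x. f (\<lambda>i\<in>{..<n}. x i * sqrt (1 + 1 / (a\<^sup>2 * R powr \<beta>))) \<partial>std_gauss n)
               (\<integral>x. g (\<lambda>i\<in>{..<n}. x i * sqrt (1 + 1 / (b\<^sup>2 * R powr \<beta>))) \<partial>std_gauss n)
             powr (R / (R - R powr \<alpha>))
      \<le> (\<integral>x. (\<integral>y. H (f (\<lambda>i\<in>{..<n}. (x i - y i) / a)) (g (\<lambda>i\<in>{..<n}. y i / b)) powr R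
                   \<partial>gauss n p q' x) powr (1 / (R - R powr \<alpha>)) \<partial>std_gauss n)"
      unfolding std_gauss_eq_gamma_PiM s(2) by (simp add: mult.commute)
  qed
qed

end
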